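(* Let $\phi:\mathbb{R}^d\to\mathbb{R}$ be convex and let $\psi_h:\Omega\times\mathbb{R}\to\mathbb{R}\cup\{+\infty\}$ be proper and convex in the second argument and elementwise constant (with respect to $\mathcal{T}_h$) in the first argument. Define $$I_h(u_h)=\int_\Omega\phi(\nabla_hu_h)\,dx+\int_\Omega\psi_h(x,\Pi_{h,0}u_h)\,dx,\qquad u_h\in\mathcal{S}^{1,cr}_D(\mathcal{T}_h),$$ $$D_h(z_h)=-\int_\Omega\phi^*(\Pi_{h,0}z_h)\,dx-\int_\Omega\psi_h^*(x,\operatorname{div}z_h)\,dx,\qquad z_h\in\mathcal{RT}^0_N(\mathcal{T}_h).$$ Then $$\inf_{u_h\in\mathcal{S}^{1,cr}_D(\mathcal{T}_h)}I_h(u_h)\ \ge\ \sup_{z_h\in\mathcal{RT}^0_N(\mathcal{T}_h)}D_h(z_h).$$ If $\phi$ and $\psi_h(x,\cdot)$ are differentiable, then solutions $u_h$ (minimizer of $I_h$) and $z_h$ (maximizer of $D_h$) are related via $$z_h(x)=D\phi\big(\nabla_hu_h|_T\big)+d^{-1}D\psi_h\big(x,u_h(x_T)\big)(x-x_T)$$ for every $T\in\mathcal{T}_h$ and $x\in T$. The pair $(z_h,\overline u_h)\in\mathcal{RT}^0_N(\mathcal{T}_h)\times\mathcal{L}^0(\mathcal{T}_h)$ with $\overline u_h|_T=u_h(x_T)$ for all $T\in\mathcal{T}_h$ solves the saddle-point problem $$\big(D\phi^*(\Pi_{h,0}z_h),\Pi_{h,0}y_h\big)+(\overline u_h,\operatorname{div}y_h)=0,$$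 $$(\operatorname{div}z_h,\overline v_h)-\big(D\psi_h(\cdot,\overline u_h),\overline v_h\big)=0,$$ for all $(y_h,\overline v_h)\in\mathcal{RT}^0_N(\mathcal{T}_h)\times\mathcal{L}^0(\mathcal{T}_h)$. Moreover, in this case strong duality applies, i.e. $I_h(u_h)=D_h(z_h)$.
   Context: Let $d\in\{2,3\}$ and let $\Omega\subset\mathbb{R}^d$ be a bounded polyhedral Lipschitz domain, $\Gamma_D\subset\partial\Omega$, $\Gamma_N=\partial\Omega\setminus\Gamma_D$. $\mathcal{T}_h$ is a regular (conforming) triangulation of $\Omega$ into triangles ($d=2$) or tetrahedra ($d=3$), with set of sides (edges/faces) $\mathcal{S}_h$; every boundary side belongs to $\Gamma_D$ or to $\Gamma_N$ (up to null sets). $x_S$ and $x_T$ denote the barycenters of a side $S$ and an element $T$; $n$ is the outer unit normal on $\partial\Omega$. $(\cdot,\cdot)$ is the $L^2(\Omega)$ inner product of functions or vector fields. $\mathcal{L}^k(\mathcal{T}_h)^\ell$ is the space of (discontinuous) elementwise polynomial functions of total degree at most $k$ with values in $\mathbb{R}^\ell$. $\Pi_{h,0}$ is the $L^2$ projection onto $\mathcal{L}^0(\mathcal{T}_h)^\ell$, i.e. elementwise averaging. Crouzeix--Raviart space: $\mathcal{S}^{1,cr}(\mathcal{T}_h)=\{v_h\in\mathcal{L}^1(\mathcal{T}_h): v_h\text{ continuous at }x_S\text{ for all }S\in\mathcal{S}_h\}$, and $\mathcal{S}^{1,cr}_D(\mathcal{T}_h)$ is the subset of functions with $v_h(x_S)=0$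 for all sides $S\subset\Gamma_D$. $\nabla_h$ is the elementwise gradient. Raviart--Thomas space: $\mathcal{RT}^0(\mathcal{T}_h)$ is the set of $y_h\in L^1(\Omega;\mathbb{R}^d)$ with distributional $\operatorname{div}y_h\in L^1(\Omega)$ and $y_h|_T(x)=a_T+b_T(x-x_T)$, $a_T\in\mathbb{R}^d$, $b_T\in\mathbb{R}$, for all $T\in\mathcal{T}_h$; $\mathcal{RT}^0_N(\mathcal{T}_h)$ is the subset with $y_h\cdot n=0$ on $\Gamma_N$. Convex conjugates: $\phi^*(t)=\sup_{s\in\mathbb{R}^d}t\cdot s-\phi(s)$ and $\psi_h^*(x,t)=\sup_{s\in\mathbb{R}}ts-\psi_h(x,s)$. $D\psi_h$ denotes the derivative with respect to the second argument. Where $\phi^*$ is not differentiable, the derivative $D\phi^*$ is to be replaced by the subdifferential, i.e. the first saddle-point equation holds with $D\phi^*(\Pi_{h,0}z_h)$ replaced by some $q_h\in\mathcal{L}^0(\mathcal{T}_h)^d$ with $q_h\in\partial\phi^*(\Pi_{h,0}z_h)$ a.e. *)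

theory Defs
  imports "HOL-Analysis.Analysis"
begin

section \<open>Convex analysis\<close>

definition gradient :: "('a::real_inner \<Rightarrow> real) \<Rightarrow> 'a \<Rightarrow> 'a" where
  "gradient f x = (THE D. GDERIV f x :> D)"

definition ereal_convex :: "('a::real_vector \<Rightarrow> ereal) \<Rightarrow> bool" where
  "ereal_convex f \<longleftrightarrow>
     (\<forall>s t. \<forall>l::real. 0 < l \<and> l < 1 \<longrightarrow>
        f ((1 - l) *\<^sub>R s + l *\<^sub>R t) \<le> ereal (1 - l) * f s + ereal l * f t)"

definition ereal_proper :: "('a \<Rightarrow> ereal) \<Rightarrow> bool" where
  "ereal_proper f \<longleftrightarrow> (\<forall>s. f s \<noteq> -\<infinity>) \<and> (\<exists>s. f s \<noteq> \<infinity>)"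

definition convex_conjugate :: "('a::real_inner \<Rightarrow> ereal) \<Rightarrow> 'a \<Rightarrow> ereal" where
  "convex_conjugate f t = (SUP s. ereal (t \<bullet> s) - f s)"

definition subdifferential :: "('a::real_inner \<Rightarrow> ereal) \<Rightarrow> 'a \<Rightarrow> 'a set" where
  "subdifferential f t = {q. \<bar>f t\<bar> \<noteq> \<infinity> \<and> (\<forall>s. f t + ereal (q \<bullet> (s - t)) \<le> f s)}"

text \<open>An extended-real function is differentiable at \<open>t\<close> only if it is finite near \<open>t\<close>;
  without this clause \<^const>\<open>real_of_ereal\<close>, which sends infinities to 0, would make
  \<open>\<infinity>\<close> differentiable.\<close>

definition ereal_differentiable_at :: "('a::real_inner \<Rightarrow> ereal) \<Rightarrow> 'a \<Rightarrow> bool" where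
  "ereal_differentiable_at f t \<longleftrightarrow>
     (\<forall>\<^sub>F s in nhds t. \<bar>f s\<bar> \<noteq> \<infinity>) \<and> (\<lambda>s. real_of_ereal (f s)) differentiable (at t)"

definition ereal_gradient :: "('a::real_inner \<Rightarrow> ereal) \<Rightarrow> 'a \<Rightarrow> 'a" where
  "ereal_gradient f = gradient (\<lambda>s. real_of_ereal (f s))"

text \<open>The derivative, replaced by the subdifferential where the function is not
  differentiable.\<close>

definition generalized_derivative :: "('a::real_inner \<Rightarrow> ereal) \<Rightarrow> 'a \<Rightarrow> 'a set" where
  "generalized_derivative f t =
     (if ereal_differentiable_at f t then {ereal_gradient f t} else subdifferential f t)"

section \<open>Integrals\<close>

definition ereal_integral :: "'a measure \<Rightarrow> ('a \<Rightarrow> ereal) \<Rightarrow> ereal" where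
  "ereal_integral M f =
     enn2ereal (\<integral>\<^sup>+ x. e2ennreal (f x) \<partial>M) - enn2ereal (\<integral>\<^sup>+ x. e2ennreal (- f x) \<partial>M)"

definition L2_inner :: "'a::euclidean_space set \<Rightarrow> ('a \<Rightarrow> 'b::real_inner) \<Rightarrow> ('a \<Rightarrow> 'b) \<Rightarrow> real" where
  "L2_inner \<Omega> f g = (\<integral>x. f x \<bullet> g x \<partial>lebesgue_on \<Omega>)"

section \<open>Domain and triangulation\<close>

definition lipschitz_domain :: "'a::euclidean_space set \<Rightarrow> bool" where
  "lipschitz_domain \<Omega> \<longleftrightarrow>
     open \<Omega> \<and> connected \<Omega> \<and> \<Omega> \<noteq> {} \<and>
     (\<forall>p \<in> frontier \<Omega>. \<exists>e r L \<gamma>.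
        norm e = 1 \<and> 0 < r \<and> L-lipschitz_on {y. y \<bullet> e = 0} \<gamma> \<and>
        \<Omega> \<inter> ball p r = {x \<in> ball p r. \<gamma> (x - (x \<bullet> e) *\<^sub>R e) < x \<bullet> e})"

definition polyhedral_domain :: "'a::euclidean_space set \<Rightarrow> bool" where
  "polyhedral_domain \<Omega> \<longleftrightarrow> (\<exists>P. finite P \<and> (\<forall>K \<in> P. polytope K) \<and> closure \<Omega> = \<Union>P)"

definition regular_triangulation :: "'a::euclidean_space set \<Rightarrow> 'a set set \<Rightarrow> bool" where
  "regular_triangulation \<Omega> \<T> \<longleftrightarrow>
     triangulation \<T> \<and> (\<forall>T \<in> \<T>. int DIM('a) simplex T) \<and> \<Union>\<T> = closure \<Omega>"

definition barycenter :: "'a::euclidean_space set \<Rightarrow> 'a" where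
  "barycenter S =
     (let V = {v. v extreme_point_of S} in (1 / real (card V)) *\<^sub>R (\<Sum>v\<in>V. v))"

definition sides :: "'a::euclidean_space set set \<Rightarrow> 'a set set" where
  "sides \<T> = {S. \<exists>T \<in> \<T>. S facet_of T}"

definition boundary_sides :: "'a::euclidean_space set \<Rightarrow> 'a set set \<Rightarrow> 'a set set" where
  "boundary_sides \<Omega> \<T> = {S \<in> sides \<T>. S \<subseteq> frontier \<Omega>}"

text \<open>Null sets of the surface measure, for subsets \<open>N\<close> of a hyperplane: by Fubini, the prism
  over \<open>N\<close> in a direction \<open>v\<close> transversal to the hyperplane is a Lebesgue null set iff \<open>N\<close> is
  null for the \<open>(d-1)\<close>-dimensional measure; prisms in tangential directions are always null.\<close>

definition surface_null :: "'a::euclidean_space set \<Rightarrow> bool" where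
  "surface_null N \<longleftrightarrow> (\<forall>v. negligible {x + t *\<^sub>R v | x t. x \<in> N \<and> t \<in> {0..1::real}})"

definition side_within :: "'a::euclidean_space set \<Rightarrow> 'a set \<Rightarrow> bool" where
  "side_within S \<Gamma> \<longleftrightarrow> surface_null (S - \<Gamma>)"

definition outer_unit_normal :: "'a::euclidean_space set \<Rightarrow> 'a set \<Rightarrow> 'a \<Rightarrow> bool" where
  "outer_unit_normal T S n \<longleftrightarrow>
     norm n = 1 \<and> (\<forall>x \<in> S. \<forall>y \<in> S. n \<bullet> (x - y) = 0) \<and> (\<forall>x \<in> T. \<forall>y \<in> S. n \<bullet> (x - y) \<le> 0)"

section \<open>Discrete function spaces\<close>

text \<open>Discrete functions are functions on the whole space of which only the values in the
  interiors of the elements matter; the values on the (Lebesgue null) union of the element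
  boundaries are left unconstrained.  Consequently, values at points of element boundaries are
  always taken as limits from the element interiors.\<close>

definition polynomial_degree_le ::
    "nat \<Rightarrow> (real ^ 'd \<Rightarrow> 'b::real_vector) \<Rightarrow> bool" where
  "polynomial_degree_le k p \<longleftrightarrow>
     (\<exists>c :: ('d \<Rightarrow> nat) \<Rightarrow> 'b.
        \<forall>x. p x = (\<Sum>\<alpha> | (\<Sum>i\<in>UNIV. \<alpha> i) \<le> k. (\<Prod>i\<in>UNIV. (x $ i) ^ \<alpha> i) *\<^sub>R c \<alpha>))"

definition piecewise_polynomials ::
    "nat \<Rightarrow> (real ^ 'd) set set \<Rightarrow> (real ^ 'd \<Rightarrow> 'b::real_vector) set" where
  "piecewise_polynomials k \<T> =
     {v. \<forall>T \<in> \<T>. \<exists>p. polynomial_degree_le k p \<and> (\<forall>x \<in> interior T. v x = p x)}"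

definition elementwise_const ::
    "'a::euclidean_space set set \<Rightarrow> ('a set \<Rightarrow> 'b::real_vector) \<Rightarrow> 'a \<Rightarrow> 'b" where
  "elementwise_const \<T> c x = (\<Sum>T\<in>\<T>. indicat_real (interior T) x *\<^sub>R c T)"

definition L2_proj0 ::
    "'a::euclidean_space set set \<Rightarrow> ('a \<Rightarrow> 'b::euclidean_space) \<Rightarrow> 'a \<Rightarrow> 'b" where
  "L2_proj0 \<T> v =
     elementwise_const \<T> (\<lambda>T. (1 / measure lebesgue T) *\<^sub>R (\<integral>x. v x \<partial>lebesgue_on T))"

text \<open>The value at \<open>x \<in> T\<close> of the restriction of \<open>v\<close> to the closed element \<open>T\<close>.\<close>

definition on_element :: "'a::euclidean_space set \<Rightarrow> ('a \<Rightarrow> 'b::t2_space) \<Rightarrow> 'a \<Rightarrow> 'b" where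
  "on_element T v x = Lim (at x within interior T) v"

definition grad_h :: "(real ^ 'd) set set \<Rightarrow> (real ^ 'd \<Rightarrow> real) \<Rightarrow> real ^ 'd \<Rightarrow> real ^ 'd" where
  "grad_h \<T> u x = (if x \<in> (\<Union>T\<in>\<T>. interior T) then gradient u x else 0)"

definition CR :: "(real ^ 'd) set set \<Rightarrow> (real ^ 'd \<Rightarrow> real) set" where
  "CR \<T> = {v \<in> piecewise_polynomials 1 \<T>.
     \<forall>S \<in> sides \<T>. \<exists>l. (v \<longlongrightarrow> l) (at (barycenter S) within (\<Union>T\<in>\<T>. interior T))}"

definition CR_D ::
    "(real ^ 'd) set \<Rightarrow> (real ^ 'd) set \<Rightarrow> (real ^ 'd) set set \<Rightarrow> (real ^ 'd \<Rightarrow> real) set" where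
  "CR_D \<Omega> \<Gamma>D \<T> = {v \<in> CR \<T>.
     \<forall>S \<in> boundary_sides \<Omega> \<T>. side_within S \<Gamma>D \<longrightarrow>
       (v \<longlongrightarrow> 0) (at (barycenter S) within (\<Union>T\<in>\<T>. interior T))}"

primrec Ck :: "nat \<Rightarrow> (real ^ 'd \<Rightarrow> real) \<Rightarrow> bool" where
  "Ck 0 f \<longleftrightarrow> continuous_on UNIV f"
| "Ck (Suc k) f \<longleftrightarrow> (\<forall>x. f differentiable (at x)) \<and> (\<forall>i. Ck k (\<lambda>x. gradient f x $ i))"

definition test_functions :: "(real ^ 'd) set \<Rightarrow> (real ^ 'd \<Rightarrow> real) set" where
  "test_functions \<Omega> =
     {\<eta>. (\<forall>k. Ck k \<eta>) \<and> compact (closure {x. \<eta> x \<noteq> 0}) \<and> closure {x. \<eta> x \<noteq> 0} \<subseteq> \<Omega>}"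

definition has_weak_div ::
    "(real ^ 'd) set \<Rightarrow> (real ^ 'd \<Rightarrow> real ^ 'd) \<Rightarrow> (real ^ 'd \<Rightarrow> real) \<Rightarrow> bool" where
  "has_weak_div \<Omega> y g \<longleftrightarrow>
     integrable (lebesgue_on \<Omega>) g \<and>
     (\<forall>\<eta> \<in> test_functions \<Omega>.
        (\<integral>x. y x \<bullet> gradient \<eta> x \<partial>lebesgue_on \<Omega>) = - (\<integral>x. g x * \<eta> x \<partial>lebesgue_on \<Omega>))"

definition weak_div :: "(real ^ 'd) set \<Rightarrow> (real ^ 'd \<Rightarrow> real ^ 'd) \<Rightarrow> real ^ 'd \<Rightarrow> real" where
  "weak_div \<Omega> y = (SOME g. has_weak_div \<Omega> y g)"

definition RT0 :: "(real ^ 'd) set \<Rightarrow> (real ^ 'd) set set \<Rightarrow> (real ^ 'd \<Rightarrow> real ^ 'd) set" where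
  "RT0 \<Omega> \<T> = {y. integrable (lebesgue_on \<Omega>) y \<and> (\<exists>g. has_weak_div \<Omega> y g) \<and>
     (\<forall>T \<in> \<T>. \<exists>a b. \<forall>x \<in> interior T. y x = a + b *\<^sub>R (x - barycenter T))}"

definition RT0_N ::
    "(real ^ 'd) set \<Rightarrow> (real ^ 'd) set \<Rightarrow> (real ^ 'd) set set \<Rightarrow> (real ^ 'd \<Rightarrow> real ^ 'd) set" where
  "RT0_N \<Omega> \<Gamma>N \<T> = {y \<in> RT0 \<Omega> \<T>.
     \<forall>S \<in> boundary_sides \<Omega> \<T>. \<forall>T \<in> \<T>. \<forall>n. S facet_of T \<and> outer_unit_normal T S n \<longrightarrow>
       surface_null {x \<in> S \<inter> \<Gamma>N. on_element T y x \<bullet> n \<noteq> 0}}"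

section \<open>Primal and dual functionals\<close>

definition I_h ::
    "(real ^ 'd) set \<Rightarrow> (real ^ 'd) set set \<Rightarrow> (real ^ 'd \<Rightarrow> real) \<Rightarrow> (real ^ 'd \<Rightarrow> real \<Rightarrow> ereal)
      \<Rightarrow> (real ^ 'd \<Rightarrow> real) \<Rightarrow> ereal" where
  "I_h \<Omega> \<T> \<phi> \<psi> u =
     ereal_integral (lebesgue_on \<Omega>) (\<lambda>x. ereal (\<phi> (grad_h \<T> u x)))
     + ereal_integral (lebesgue_on \<Omega>) (\<lambda>x. \<psi> x (L2_proj0 \<T> u x))"

definition D_h ::
    "(real ^ 'd) set \<Rightarrow> (real ^ 'd) set set \<Rightarrow> (real ^ 'd \<Rightarrow> real) \<Rightarrow> (real ^ 'd \<Rightarrow> real \<Rightarrow> ereal)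
      \<Rightarrow> (real ^ 'd \<Rightarrow> real ^ 'd) \<Rightarrow> ereal" where
  "D_h \<Omega> \<T> \<phi> \<psi> z =
     - ereal_integral (lebesgue_on \<Omega>)
         (\<lambda>x. convex_conjugate (\<lambda>s. ereal (\<phi> s)) (L2_proj0 \<T> z x))
     - ereal_integral (lebesgue_on \<Omega>) (\<lambda>x. convex_conjugate (\<psi> x) (weak_div \<Omega> z x))"

end

theory Submission
  imports Defs
begin

text \<open>On a simplex the Raviart--Thomas fields are the combinations \<open>\<Sum>\<^sub>v c\<^sub>v (x - v)\<close> over the vertices \<open>v\<close>,
  and \<open>x - v\<close> has normal flux only through the face opposite to \<open>v\<close>.  Integration by parts on an
  element is thus a sum over its faces of \<open>c\<^sub>v\<close> times the mean of the scalar function over the face,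
  which for affine functions is the value at the barycenter.  Summing over the elements, the weak
  divergence of a field exists iff the jumps of its fluxes across interior sides vanish, and
  \<open>(\<nabla>\<^sub>h u, \<Pi> y) + (\<Pi> u, div y) = 0\<close> for \<open>u\<close> in the Crouzeix--Raviart and \<open>y\<close> in the Raviart--Thomas space.
  Weak duality is this identity together with the elementwise Fenchel--Young inequality.

  Conversely, stationarity of \<open>I\<^sub>h\<close> at a minimizer \<open>u\<close>, tested with the basis function of a side, says
  that the field \<open>D\<phi>(\<nabla>\<^sub>h u) + d\<^sup>-\<^sup>1 D\<psi>(\<Pi> u) (x - x\<^sub>T)\<close> has no flux jump there.  So this field is admissible; it
  turns every Fenchel--Young inequality into an equality and hence attains the value \<open>I\<^sub>h(u)\<close>.  Any
  other maximizer must then also have equality on every element, which determines it.\<close>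

section \<open>Barycentric coordinates\<close>

text \<open>No surface measure occurs. Face integrals are written as volume integrals of
  \<open>d f + grad f . (x - v)\<close>; comparing them across a shared face then requires an affine
  map between the two elements. Values of discrete functions on element boundaries are arbitrary, so
  integrals over the mesh are first moved to continuous functions on the closed elements, and
  completeness of Lebesgue measure absorbs the null skeleton. Two geometric facts are hidden behind
  the formulas: the Lipschitz property makes \<Omega> the interior of its closure, so that element
  interiors lie in \<Omega>; and the position of the barycenter of a side decides whether the whole
  side is a boundary side. Since \<open>weak_div\<close> is an arbitrary choice among weak
  divergences, it is known only up to null sets. Differentiability makes \<open>\<psi>\<close>
  finite, hence the energy real on the discrete space, while the conjugates may still be infinite;
  sums of conjugates therefore stay in \<open>ereal\<close> until they are known to equal a finite
  value.\<close>

definition verts :: "'a::euclidean_space set \<Rightarrow> 'a set" where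
  "verts T = {v. v extreme_point_of T}"

text \<open>The gradient of the affine function that is 1 at \<open>v\<close> and 0 at the other
  vertices, determined by its change \<open>- 1\<close> along each edge \<open>w - v\<close>. The
  choice is meaningful at a vertex of a full simplex, where affine independence makes the system
  solvable.\<close>

definition bary_grad :: "'a::euclidean_space set \<Rightarrow> 'a \<Rightarrow> 'a" where
  "bary_grad T v = (SOME g. \<forall>w \<in> verts T - {v}. g \<bullet> (w - v) = - 1)"

definition bary :: "'a::euclidean_space set \<Rightarrow> 'a \<Rightarrow> 'a \<Rightarrow> real" where
  "bary T v x = 1 + bary_grad T v \<bullet> (x - v)"

definition opp_face :: "'a::euclidean_space set \<Rightarrow> 'a \<Rightarrow> 'a set" where
  "opp_face T v = convex hull (verts T - {v})"

abbreviation full_simplex :: "'a::euclidean_space set \<Rightarrow> bool" where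
  "full_simplex T \<equiv> int DIM('a) simplex T"

lemma full_simplex_verts:
  fixes T :: "'a::euclidean_space set"
  assumes "full_simplex T"
  shows "finite (verts T)" "card (verts T) = Suc DIM('a)" "\<not> affine_dependent (verts T)"
    "T = convex hull verts T"
proof -
  obtain C where C: "\<not> affine_dependent C" "int (card C) = int DIM('a) + 1" "T = convex hull C"
    using assms unfolding simplex_def by blast
  have "verts T = C"
    unfolding verts_def C(3) using extreme_point_of_convex_hull_affine_independent[OF C(1)] by auto
  with C show "finite (verts T)" "card (verts T) = Suc DIM('a)" "\<not> affine_dependent (verts T)"
    "T = convex hull verts T"
    by (auto simp: aff_independent_finite)
qed

text \<open>Affine independence makes the edges \<open>w - v\<close> linearly independent, so some
  linear functional takes the value \<open>- 1\<close> on all of them. Its Riesz vector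
  \<open>adjoint L 1\<close> is a witness for the choice in \<open>bary_grad\<close>.\<close>

lemma bary_vertex:
  fixes T :: "'a::euclidean_space set"
  assumes T: "full_simplex T" and v: "v \<in> verts T" and w: "w \<in> verts T"
  shows "bary T v w = (if w = v then 1 else 0)"
proof -
  have "\<not> dependent ((\<lambda>x. - v + x) ` (verts T - {v}))"
    using affine_dependent_iff_dependent2[OF v] full_simplex_verts(3)[OF T] by simp
  from linear_independent_extend[OF this, of "\<lambda>_. - 1 :: real"]
  obtain L :: "'a \<Rightarrow> real" where L: "linear L"
    "\<forall>x\<in>(\<lambda>x. - v + x) ` (verts T - {v}). L x = - 1" by blast
  have "\<exists>g. \<forall>w \<in> verts T - {v}. g \<bullet> (w - v) = - 1"
  proof (intro exI ballI)
    fix w assume "w \<in> verts T - {v}"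
    then have "L (w - v) = - 1" using L(2) by force
    moreover have "adjoint L 1 \<bullet> (w - v) = L (w - v)"
      using adjoint_works[OF L(1), of "w - v" 1] by (simp add: inner_commute)
    ultimately show "adjoint L 1 \<bullet> (w - v) = - 1" by simp
  qed
  from someI_ex[OF this] have "\<forall>w \<in> verts T - {v}. bary_grad T v \<bullet> (w - v) = - 1"
    unfolding bary_grad_def by blast
  then show ?thesis using w by (auto simp: bary_def)
qed

lemma bary_diff: "bary T v x = bary T v y + bary_grad T v \<bullet> (x - y)"
  by (simp add: bary_def inner_diff_right)

lemma bary_affine_comb:
  assumes "sum u A = 1"
  shows "bary T v (\<Sum>w\<in>A. u w *\<^sub>R f w) = (\<Sum>w\<in>A. u w * bary T v (f w))"
proof -
  have "(\<Sum>w\<in>A. u w * bary T v (f w))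
      = sum u A + (\<Sum>w\<in>A. u w * (bary_grad T v \<bullet> f w)) - sum u A * (bary_grad T v \<bullet> v)"
    by (simp add: bary_def inner_diff_right algebra_simps sum.distrib sum_subtractf sum_distrib_left sum_distrib_right)
  also have "\<dots> = bary T v (\<Sum>w\<in>A. u w *\<^sub>R f w)"
    using assms by (simp add: bary_def inner_diff_right inner_sum_right)
  finally show ?thesis ..
qed

text \<open>\<open>bary T v\<close> is affine and takes the values 0 and 1 at the vertices, so it
  reads off the coefficient of \<open>v\<close> in any affine combination of the vertices, whatever
  the signs.\<close>

lemma bary_unique:
  fixes T :: "'a::euclidean_space set"
  assumes T: "full_simplex T" and u: "sum u (verts T) = 1" and v: "v \<in> verts T"
  shows "bary T v (\<Sum>w\<in>verts T. u w *\<^sub>R w) = u v"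
proof -
  have "bary T v (\<Sum>w\<in>verts T. u w *\<^sub>R w) = (\<Sum>w\<in>verts T. if w = v then u w else 0)"
    unfolding bary_affine_comb[OF u, of T v "\<lambda>w. w"]
    by (intro sum.cong) (auto simp: bary_vertex[OF T v])
  then show ?thesis using v full_simplex_verts(1)[OF T] by simp
qed

lemma bary_sum:
  fixes T :: "'a::euclidean_space set"
  assumes T: "full_simplex T"
  shows "(\<Sum>v\<in>verts T. bary T v x) = 1" "(\<Sum>v\<in>verts T. bary T v x *\<^sub>R v) = x"
proof -
  have "x \<in> affine hull (verts T)"
    using affine_independent_span_gt[OF full_simplex_verts(3)[OF T]] full_simplex_verts(2)[OF T] by simp
  then obtain u where u: "sum u (verts T) = 1" "(\<Sum>v\<in>verts T. u v *\<^sub>R v) = x"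
    unfolding affine_hull_finite[OF full_simplex_verts(1)[OF T]] by auto
  have "bary T v x = u v" if "v \<in> verts T" for v
    using bary_unique[OF T u(1) that] u(2) by simp
  then show "(\<Sum>v\<in>verts T. bary T v x) = 1" "(\<Sum>v\<in>verts T. bary T v x *\<^sub>R v) = x"
    using u by simp_all
qed

text \<open>Both identities of \<open>bary_sum\<close> are affine in the point; these are their
  derivatives.\<close>

lemma bary_grad_sum:
  fixes T :: "'a::euclidean_space set"
  assumes T: "full_simplex T"
  shows "(\<Sum>v\<in>verts T. bary_grad T v) = 0" "(\<Sum>v\<in>verts T. (bary_grad T v \<bullet> h) *\<^sub>R v) = h"
proof -
  have b: "bary_grad T v \<bullet> h = bary T v h - bary T v 0" for v h
    by (simp add: bary_def inner_diff_right)
  have "(\<Sum>v\<in>verts T. bary_grad T v) \<bullet> h = 0" for h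
    by (simp add: inner_sum_left b sum_subtractf bary_sum(1)[OF T])
  then show "(\<Sum>v\<in>verts T. bary_grad T v) = 0"
    by (metis inner_eq_zero_iff)
  show "(\<Sum>v\<in>verts T. (bary_grad T v \<bullet> h) *\<^sub>R v) = h"
    by (simp add: b scaleR_diff_left sum_subtractf bary_sum(2)[OF T])
qed

lemma simplex_bary:
  fixes T :: "'a::euclidean_space set"
  assumes T: "full_simplex T"
  shows "x \<in> T \<longleftrightarrow> (\<forall>v\<in>verts T. 0 \<le> bary T v x)"
    "x \<in> interior T \<longleftrightarrow> (\<forall>v\<in>verts T. 0 < bary T v x)"
proof -
  note V = full_simplex_verts[OF T]
  have "x \<in> T \<longleftrightarrow> (\<exists>u. (\<forall>v\<in>verts T. 0 \<le> u v) \<and> sum u (verts T) = 1 \<and> (\<Sum>v\<in>verts T. u v *\<^sub>R v) = x)"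
    by (subst V(4)) (auto simp: convex_hull_finite[OF V(1)])
  also have "\<dots> \<longleftrightarrow> (\<forall>v\<in>verts T. 0 \<le> bary T v x)"
    using bary_unique[OF T] bary_sum[OF T] by fastforce
  finally show "x \<in> T \<longleftrightarrow> (\<forall>v\<in>verts T. 0 \<le> bary T v x)" .
  have "x \<in> interior T \<longleftrightarrow> (\<exists>u. (\<forall>v\<in>verts T. 0 < u v) \<and> sum u (verts T) = 1 \<and> (\<Sum>v\<in>verts T. u v *\<^sub>R v) = x)"
    by (subst V(4)) (auto simp: interior_convex_hull_explicit_minimal[OF V(3)] V(2))
  also have "\<dots> \<longleftrightarrow> (\<forall>v\<in>verts T. 0 < bary T v x)"
    using bary_unique[OF T] bary_sum[OF T] by fastforce
  finally show "x \<in> interior T \<longleftrightarrow> (\<forall>v\<in>verts T. 0 < bary T v x)" .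
qed

lemma bary_barycenter:
  fixes T :: "'a::euclidean_space set"
  assumes T: "full_simplex T"
  shows "v \<in> verts T \<Longrightarrow> bary T v (barycenter T) = 1 / (real DIM('a) + 1)"
    "barycenter T \<in> interior T"
proof -
  note V = full_simplex_verts[OF T]
  have bc: "barycenter T = (\<Sum>w\<in>verts T. (1 / (real DIM('a) + 1)) *\<^sub>R w)"
    by (simp add: barycenter_def Let_def flip: verts_def) (simp add: V(2) scaleR_sum_right add_ac)
  show *: "bary T v (barycenter T) = 1 / (real DIM('a) + 1)" if "v \<in> verts T" for v
    unfolding bc by (rule bary_unique[OF T _ that]) (use V(2) in \<open>simp add: field_simps\<close>)
  show "barycenter T \<in> interior T"
    by (simp add: simplex_bary(2)[OF T] *)
qed

section \<open>Faces of a simplex and their barycenters\<close>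

lemma opp_face_iff:
  fixes T :: "'a::euclidean_space set"
  assumes T: "full_simplex T" and v: "v \<in> verts T"
  shows "x \<in> opp_face T v \<longleftrightarrow> x \<in> T \<and> bary T v x = 0"
proof -
  note V = full_simplex_verts[OF T]
  have fin: "finite (verts T - {v})" using V(1) by simp
  show ?thesis
  proof
    assume "x \<in> opp_face T v"
    then have "x \<in> T" unfolding opp_face_def using V(4) hull_mono[of "verts T - {v}" "verts T" convex] by blast
    from \<open>x \<in> opp_face T v\<close> obtain u where u: "sum u (verts T - {v}) = 1" "(\<Sum>w\<in>verts T - {v}. u w *\<^sub>R w) = x"
      unfolding opp_face_def convex_hull_finite[OF fin] by auto
    have "bary T v x = 0"
      unfolding u(2)[symmetric] bary_affine_comb[OF u(1)]
      by (intro sum.neutral) (auto simp: bary_vertex[OF T v])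
    with \<open>x \<in> T\<close> show "x \<in> T \<and> bary T v x = 0" by simp
  next
    assume x: "x \<in> T \<and> bary T v x = 0"
    have "(\<Sum>w\<in>verts T - {v}. bary T w x) = 1" "(\<Sum>w\<in>verts T - {v}. bary T w x *\<^sub>R w) = x"
      using bary_sum[OF T, of x] x by (simp_all add: sum_diff1 V(1) v sum_diff)
    moreover have "\<forall>w\<in>verts T - {v}. 0 \<le> bary T w x" using x simplex_bary(1)[OF T] by blast
    ultimately have "\<exists>u. (\<forall>w\<in>verts T - {v}. 0 \<le> u w) \<and> sum u (verts T - {v}) = 1 \<and> (\<Sum>w\<in>verts T - {v}. u w *\<^sub>R w) = x"
      by (intro exI[of _ "\<lambda>w. bary T w x"]) simp
    then show "x \<in> opp_face T v" unfolding opp_face_def convex_hull_finite[OF fin] by simp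
  qed
qed

lemma opp_face_subset: "full_simplex T \<Longrightarrow> v \<in> verts T \<Longrightarrow> opp_face T v \<subseteq> T"
  using opp_face_iff by blast

lemma verts_subset: "full_simplex T \<Longrightarrow> verts T \<subseteq> T"
  by (auto simp: verts_def extreme_point_of_def)

lemma verts_opp_face:
  fixes T :: "'a::euclidean_space set"
  assumes T: "full_simplex T" and v: "v \<in> verts T"
  shows "verts (opp_face T v) = verts T - {v}"
proof -
  have "\<not> affine_dependent (verts T - {v})"
    by (rule contrapos_nn[OF full_simplex_verts(3)[OF T]]) (rule affine_dependent_subset, auto)
  note e = extreme_point_of_convex_hull_affine_independent[OF this]
  show ?thesis
    unfolding verts_def[of "opp_face T v"] by (rule set_eqI) (simp only: mem_Collect_eq opp_face_def e)
qed

lemma opp_face_inj: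
  assumes T: "full_simplex T" and "v \<in> verts T" "w \<in> verts T" "opp_face T v = opp_face T w"
  shows "v = w"
proof -
  have "verts T - {v} = verts T - {w}" using verts_opp_face[OF T] assms by metis
  then show ?thesis using assms by auto
qed

lemma facet_of_simplex:
  fixes T :: "'a::euclidean_space set"
  assumes T: "full_simplex T"
  shows "S facet_of T \<longleftrightarrow> (\<exists>v\<in>verts T. S = opp_face T v)"
proof -
  note V = full_simplex_verts[OF T]
  \<comment> \<open>The characterization of facets asks for at least two vertices, which holds
    because the dimension is positive.\<close>
  have "2 \<le> card (verts T)" using V(2) DIM_positive[where 'a='a] by linarith
  have "S facet_of convex hull verts T \<longleftrightarrow> (\<exists>v\<in>verts T. S = opp_face T v)"
    unfolding facet_of_convex_hull_affine_independent_alt[OF V(3)] opp_face_def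
    using \<open>2 \<le> card (verts T)\<close> by auto
  then show ?thesis using V(4) by simp
qed

lemma bary_barycenter_face:
  fixes T :: "'a::euclidean_space set"
  assumes T: "full_simplex T" and v: "v \<in> verts T" and w: "w \<in> verts T"
  shows "bary T w (barycenter (opp_face T v)) = (if w = v then 0 else 1 / DIM('a))"
proof -
  note V = full_simplex_verts[OF T]
  have card: "card (verts T - {v}) = DIM('a)" using V v by simp
  let ?u = "\<lambda>w. if w = v then 0 else 1 / real DIM('a)"
  have "barycenter (opp_face T v) = (\<Sum>w\<in>verts T - {v}. (1 / DIM('a)) *\<^sub>R w)"
    by (simp add: barycenter_def Let_def flip: verts_def)
      (simp add: verts_opp_face[OF T v] card scaleR_sum_right)
  also have "\<dots> = (\<Sum>w\<in>verts T. ?u w *\<^sub>R w)"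
    by (rule sum.mono_neutral_cong_left) (auto simp: V(1))
  finally have bc: "barycenter (opp_face T v) = (\<Sum>w\<in>verts T. ?u w *\<^sub>R w)" .
  have "sum ?u (verts T) = (\<Sum>w\<in>verts T - {v}. 1 / DIM('a))"
    by (rule sum.mono_neutral_cong_right) (auto simp: V(1))
  then have "sum ?u (verts T) = 1" using card by simp
  from bary_unique[OF T this w] show ?thesis unfolding bc .
qed

lemma barycenter_opp_face:
  fixes T :: "'a::euclidean_space set"
  assumes T: "full_simplex T" and v: "v \<in> verts T"
  shows "barycenter (opp_face T v) \<in> opp_face T v"
  unfolding opp_face_iff[OF T v] simplex_bary(1)[OF T]
  by (simp add: bary_barycenter_face[OF T v] v)

lemma simplex_facts:
  fixes T :: "'a::euclidean_space set"
  assumes T: "full_simplex T"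
  shows "compact T" "convex T" "closed T" "interior T \<noteq> {}" "negligible (T - interior T)"
    "T \<in> lmeasurable" "0 < measure lebesgue T" "closure (interior T) = T"
proof -
  show c: "compact T" "convex T" "closed T" using compact_simplex convex_simplex closed_simplex T by blast+
  show i: "interior T \<noteq> {}" using bary_barycenter(2)[OF T] by blast
  show "negligible (T - interior T)"
    using negligible_convex_frontier[OF c(2)] by (simp add: frontier_def c(3))
  show m: "T \<in> lmeasurable" using c(1) lmeasurable_compact by blast
  have "\<not> negligible T" using i negligible_subset interior_subset open_not_negligible open_interior by metis
  then have "measure lebesgue T \<noteq> 0" using negligible_iff_measure m by blast
  then show "0 < measure lebesgue T" by (simp add: zero_less_measure_iff)
  show "closure (interior T) = T"
    using convex_closure_interior[OF c(2) i] c(3) by simp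
qed

lemma continuous_bary [continuous_intros]:
  "continuous_on A f \<Longrightarrow> continuous_on A (\<lambda>x. bary T v (f x))"
  unfolding bary_def by (intro continuous_intros)

section \<open>Affine changes of variables\<close>

text \<open>The library's change of variables formula needs a well-ordered index type.  The version
  below follows from uniqueness of translation-invariant measures, which is Fubini's theorem
  for \<open>\<integral>\<integral> 1\<^sub>A(x + y) 1\<^sub>B(y)\<close> with \<open>B\<close> the unit cube.\<close>

lemma translation_invariant_eq_lborel:
  fixes \<mu> :: "'a::euclidean_space measure"
  assumes sets[measurable_cong]: "sets \<mu> = sets borel" and sf: "sigma_finite_measure \<mu>"
    and inv: "\<And>a A. A \<in> sets borel \<Longrightarrow> emeasure \<mu> ((+) a -` A) = emeasure \<mu> A"
  obtains c where "\<And>A. A \<in> sets borel \<Longrightarrow> emeasure \<mu> A = c * emeasure lborel A"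
proof
  interpret \<mu>: sigma_finite_measure \<mu> by fact
  interpret pair_sigma_finite \<mu> lborel ..
  have sp: "space \<mu> = UNIV" using sets_eq_imp_space_eq[OF sets] by simp
  define B :: "'a set" where "B = cbox 0 One"
  have B[measurable]: "B \<in> sets borel" unfolding B_def by simp
  have B1: "emeasure lborel B = 1"
    unfolding B_def by (simp add: emeasure_lborel_cbox)
  fix A :: "'a set" assume A[measurable]: "A \<in> sets borel"
  have vim: "f -` X \<in> sets borel" if "continuous_on UNIV f" "X \<in> sets borel" for f :: "'a \<Rightarrow> 'a" and X
    using measurable_sets[OF borel_measurable_continuous_onI[OF that(1)] that(2)] by simp
  have 1: "(\<integral>\<^sup>+x. indicator A (x + y) \<partial>\<mu>) = emeasure \<mu> A" for y
  proof -
    have "(\<integral>\<^sup>+x. indicator A (x + y) \<partial>\<mu>) = (\<integral>\<^sup>+x. indicator ((+) y -` A) x \<partial>\<mu>)"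
      by (intro nn_integral_cong) (auto simp: indicator_def add_ac)
    also have "\<dots> = emeasure \<mu> ((+) y -` A)"
      by (intro nn_integral_indicator) (simp add: sets vim A continuous_intros)
    finally show ?thesis using inv[OF A] by simp
  qed
  have 2: "(\<integral>\<^sup>+x. indicator B (y - x) \<partial>\<mu>) = emeasure \<mu> (uminus -` B)" for y
  proof -
    have "(\<integral>\<^sup>+x. indicator B (y - x) \<partial>\<mu>) = (\<integral>\<^sup>+x. indicator ((+) (- y) -` (uminus -` B)) x \<partial>\<mu>)"
      by (intro nn_integral_cong) (auto simp: indicator_def)
    also have "\<dots> = emeasure \<mu> ((+) (- y) -` (uminus -` B))"
      by (intro nn_integral_indicator) (simp add: sets vim B continuous_intros)
    finally show ?thesis using inv[OF vim[OF _ B], of uminus "- y"] by (simp add: continuous_intros)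
  qed
  have 3: "(\<integral>\<^sup>+y. indicator A (x + y) * indicator B y \<partial>lborel)
         = (\<integral>\<^sup>+y. indicator A y * indicator B (y - x) \<partial>lborel)" for x
  proof -
    have "(\<integral>\<^sup>+y. indicator A y * indicator B (y - x) \<partial>lborel)
        = (\<integral>\<^sup>+y. indicator A y * indicator B (y - x) \<partial>distr lborel borel ((+) x))"
      by (simp only: lborel_distr_plus)
    also have "\<dots> = (\<integral>\<^sup>+y. indicator A (x + y) * indicator B y \<partial>lborel)"
      by (subst nn_integral_distr) (auto simp: add_ac)
    finally show ?thesis ..
  qed
  \<comment> \<open>The unit mass of \<open>B\<close> is inserted and \<open>x + y\<close> is
    replaced by \<open>y\<close> through the invariance of \<open>lborel\<close>; the remaining
    integral over \<open>x\<close> sees only the reflected cube, whose measure is the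
    constant.\<close>
  have "emeasure \<mu> A = (\<integral>\<^sup>+y. emeasure \<mu> A * indicator B y \<partial>lborel)"
    by (simp add: nn_integral_cmult B1)
  also have "\<dots> = (\<integral>\<^sup>+y. (\<integral>\<^sup>+x. indicator A (x + y) * indicator B y \<partial>\<mu>) \<partial>lborel)"
    by (intro nn_integral_cong) (subst nn_integral_multc, auto simp: 1)
  also have "\<dots> = (\<integral>\<^sup>+x. (\<integral>\<^sup>+y. indicator A (x + y) * indicator B y \<partial>lborel) \<partial>\<mu>)"
    by (rule Fubini') measurable
  also have "\<dots> = (\<integral>\<^sup>+x. (\<integral>\<^sup>+y. indicator A y * indicator B (y - x) \<partial>lborel) \<partial>\<mu>)"
    by (simp only: 3)
  also have "\<dots> = (\<integral>\<^sup>+y. (\<integral>\<^sup>+x. indicator A y * indicator B (y - x) \<partial>\<mu>) \<partial>lborel)"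
    by (rule Fubini'[symmetric]) measurable
  also have "\<dots> = (\<integral>\<^sup>+y. emeasure \<mu> (uminus -` B) * indicator A y \<partial>lborel)"
    by (intro nn_integral_cong) (subst nn_integral_cmult, auto simp: 2 mult_ac)
  also have "\<dots> = emeasure \<mu> (uminus -` B) * emeasure lborel A"
    by (simp add: nn_integral_cmult)
  finally show "emeasure \<mu> A = emeasure \<mu> (uminus -` B) * emeasure lborel A" .
qed

text \<open>Continuous functions on compact sets become Borel integrands on the whole space, where
  \<open>distr\<close> and \<open>density\<close> apply.\<close>

lemma integral_compact_lborel:
  fixes f :: "'a::euclidean_space \<Rightarrow> 'b::euclidean_space"
  assumes T: "compact T" and f: "continuous_on T f"
  shows "integrable (lebesgue_on T) f"
    "integral\<^sup>L (lebesgue_on T) f = integral\<^sup>L lborel (\<lambda>x. indicator T x *\<^sub>R f x)"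
proof -
  have i: "integrable lborel (\<lambda>x. indicator T x *\<^sub>R f x)" by (rule borel_integrable_compact[OF T f])
  have T': "T \<in> sets lebesgue" using lmeasurable_compact[OF T] by blast
  have "integrable lebesgue (\<lambda>x. indicator T x *\<^sub>R f x)"
    using i integrable_completion borel_measurable_integrable[OF i] by blast
  then show "integrable (lebesgue_on T) f" using T' by (simp add: integrable_restrict_space)
  show "integral\<^sup>L (lebesgue_on T) f = integral\<^sup>L lborel (\<lambda>x. indicator T x *\<^sub>R f x)"
    using T' integral_completion[OF borel_measurable_integrable[OF i]] by (simp add: integral_restrict_space)
qed

text \<open>The image of \<open>lborel\<close> under \<open>h\<close> is translation invariant,
  because \<open>h\<close> carries the shift by \<open>a'\<close> to the shift by
  \<open>L a'\<close>; so it is a multiple of \<open>lborel\<close>. The multiple is eliminated by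
  the case of the constant 1, which leaves the Jacobian as a ratio of volumes.\<close>

lemma integral_affine_image:
  fixes L :: "'a::euclidean_space \<Rightarrow> 'a" and f :: "'a \<Rightarrow> real"
  assumes L: "linear L" "inj L" and h: "\<And>x. h x = b + L x"
    and T: "compact T" and f: "continuous_on (h ` T) f"
  shows "measure lebesgue T * integral\<^sup>L (lebesgue_on (h ` T)) f
       = measure lebesgue (h ` T) * (\<integral>x. f (h x) \<partial>lebesgue_on T)"
proof -
  have surj: "surj L" using linear_injective_imp_surjective[OF L] by simp
  have hc: "continuous_on A h" for A
    unfolding h by (intro continuous_intros linear_continuous_on) (use L(1) linear_conv_bounded_linear in blast)
  have hm[measurable]: "h \<in> borel_measurable borel" using hc borel_measurable_continuous_onI by blast
  have hinj: "inj h" using L(2) by (auto simp: inj_def h)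
  have hsurj: "surj h" using surj by (metis h surj_def add_diff_cancel_left' diff_add_cancel add.commute)
  define \<mu> where "\<mu> = distr lborel borel h"
  have em: "emeasure \<mu> A = emeasure lborel (h -` A)" if "A \<in> sets borel" for A
    unfolding \<mu>_def using that by (simp add: emeasure_distr)
  have sf: "sigma_finite_measure \<mu>"
  proof
    have "compact (h ` cball 0 (real n))" for n by (intro compact_continuous_image hc compact_cball)
    then have b: "h ` cball 0 (real n) \<in> sets borel" for n by (simp add: compact_imp_closed)
    let ?A = "range (\<lambda>n. h ` cball 0 (real n))"
    have "\<Union>?A = UNIV"
    proof (intro set_eqI iffI UNIV_I)
      fix y :: 'a
      obtain x where "y = h x" using hsurj by blast
      moreover obtain n where "norm x \<le> real n" using real_arch_simple by blast
      then have "x \<in> cball 0 (real n)" by simp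
      ultimately show "y \<in> \<Union>?A" by blast
    qed
    moreover have "emeasure \<mu> (h ` cball 0 (real n)) \<noteq> \<infinity>" for n
      unfolding em[OF b] inj_vimage_image_eq[OF hinj] using emeasure_lborel_cball_finite by (metis less_irrefl infinity_ennreal_def)
    ultimately show "\<exists>A. countable A \<and> A \<subseteq> sets \<mu> \<and> \<Union> A = space \<mu> \<and> (\<forall>a\<in>A. emeasure \<mu> a \<noteq> \<infinity>)"
      using b by (intro exI[of _ ?A]) (auto simp: \<mu>_def)
  qed
  have inv: "emeasure \<mu> ((+) a -` A) = emeasure \<mu> A" if A: "A \<in> sets borel" for a A
  proof -
    obtain a' where a': "L a' = a" using surj by (metis surjD)
    have v: "(+) a -` A \<in> sets borel" "h -` A \<in> sets borel"
      using measurable_sets_borel[OF _ A, of "(+) a"] measurable_sets_borel[OF hm A] by auto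
    have "h -` ((+) a -` A) = (+) a' -` (h -` A)"
      by (auto simp: h linear_add[OF L(1)] a' add_ac)
    then have "emeasure \<mu> ((+) a -` A) = emeasure lborel ((+) a' -` (h -` A))" by (simp add: em v)
    also have "\<dots> = emeasure (distr lborel borel ((+) a')) (h -` A)"
      using v by (simp add: emeasure_distr)
    finally show ?thesis by (simp add: lborel_distr_plus em A)
  qed
  obtain c where c: "\<And>A. A \<in> sets borel \<Longrightarrow> emeasure \<mu> A = c * emeasure lborel A"
    using translation_invariant_eq_lborel[OF _ sf inv] unfolding \<mu>_def by auto
  \<comment> \<open>A closed unit ball has positive finite measure, while \<open>\<infinity>\<close>
    times the measure of its image can only be 0 or \<open>\<infinity>\<close>.\<close>
  have "c \<noteq> \<infinity>"
  proof
    assume inf: "c = \<infinity>"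
    have b: "h ` cball 0 1 \<in> sets borel"
      by (intro borel_compact compact_continuous_image hc compact_cball)
    have "emeasure lborel (cball (0::'a) 1) = c * emeasure lborel (h ` cball 0 1)"
      using c[OF b] em[OF b] by (simp add: inj_vimage_image_eq[OF hinj])
    moreover have "emeasure lborel (cball (0::'a) 1) < \<infinity>" using emeasure_lborel_cball_finite by simp
    moreover have "emeasure lborel (cball (0::'a) 1) \<noteq> 0"
    proof
      assume "emeasure lborel (cball (0::'a) 1) = 0"
      then have "negligible (cball (0::'a) 1)"
        by (simp add: negligible_iff_null_sets null_setsI null_sets_completionI)
      then show False
        using open_not_negligible[of "ball (0::'a) 1"] negligible_subset[OF _ ball_subset_cball] by auto
    qed
    ultimately show False unfolding inf by (auto simp: ennreal_top_mult split: if_splits)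
  qed
  then obtain c' where c': "c = ennreal c'" "0 \<le> c'" by (cases c) auto
  have \<mu>: "\<mu> = density lborel (\<lambda>_. ennreal c')"
    by (rule measure_eqI) (auto simp: \<mu>_def[THEN arg_cong[of _ _ sets]] emeasure_density_const c c')
  have hT: "compact (h ` T)" by (intro compact_continuous_image hc T)
  have main: "(\<integral>x. k (h x) \<partial>lebesgue_on T) = c' * integral\<^sup>L (lebesgue_on (h ` T)) k"
    if k: "continuous_on (h ` T) k" for k :: "'a \<Rightarrow> real"
  proof -
    let ?k = "\<lambda>x. indicator (h ` T) x *\<^sub>R k x"
    have m: "?k \<in> borel_measurable borel"
      using borel_measurable_integrable[OF borel_integrable_compact[OF hT k]] by simp
    have "(\<integral>x. k (h x) \<partial>lebesgue_on T) = (\<integral>x. indicator T x *\<^sub>R k (h x) \<partial>lborel)"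
      by (rule integral_compact_lborel(2)[OF T]) (intro continuous_on_compose2[OF k] hc, auto)
    also have "\<dots> = (\<integral>x. ?k (h x) \<partial>lborel)"
      by (intro Bochner_Integration.integral_cong) (auto simp: indicator_def inj_image_mem_iff[OF hinj])
    also have "\<dots> = integral\<^sup>L \<mu> ?k" unfolding \<mu>_def by (rule integral_distr[symmetric]) (use m in auto)
    also have "\<dots> = c' * integral\<^sup>L lborel ?k"
      unfolding \<mu> by (subst integral_density) (use m c' in auto)
    finally show ?thesis by (simp add: integral_compact_lborel(2)[OF hT k])
  qed
  have meas: "measure lebesgue X = integral\<^sup>L (lebesgue_on X) (\<lambda>_. 1)" if "compact X" for X :: "'a set"
    by (metis lmeasurable_compact that lmeasure_integral_UNIV lebesgue_integral_eq_integral
        integrable_on_const lmeasure_integral fmeasurableD integral_compact_lborel(1) continuous_on_const)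
  have "measure lebesgue T = c' * measure lebesgue (h ` T)"
    using main[of "\<lambda>_. 1"] by (simp only: meas[OF T] meas[OF hT] continuous_on_const)
  then show ?thesis using main[OF f] by simp
qed

section \<open>Fluxes through the faces of a simplex\<close>

text \<open>The field \<open>x - v\<close> has normal component zero on all faces but the one opposite to \<open>v\<close>.
  By the divergence theorem, \<open>face_flux T v f g\<close> with \<open>g\<close> the gradient of \<open>f\<close> is therefore
  \<open>d |T|\<close> times the mean of \<open>f\<close> over that face, and replaces surface integrals throughout.\<close>

definition face_flux :: "'a::euclidean_space set \<Rightarrow> 'a \<Rightarrow> ('a \<Rightarrow> real) \<Rightarrow> ('a \<Rightarrow> 'a) \<Rightarrow> real" where
  "face_flux T v f g = (\<integral>x. real DIM('a) * f x + g x \<bullet> (x - v) \<partial>lebesgue_on T)"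

lemma continuous_on_GDERIV:
  assumes "\<And>x. GDERIV f x :> g x"
  shows "continuous_on A f"
proof (rule continuous_at_imp_continuous_on, rule ballI)
  fix x
  have "f differentiable (at x)" using assms[of x] unfolding gderiv_def differentiable_def by blast
  then show "isCont f x" by (rule differentiable_imp_continuous_within)
qed

lemma GDERIV_line:
  fixes f :: "'a::real_inner \<Rightarrow> real"
  assumes "GDERIV f (v + r *\<^sub>R y) :> g"
  shows "((\<lambda>r. f (v + r *\<^sub>R y)) has_real_derivative g \<bullet> y) (at r)"
proof -
  have "((\<lambda>r. v + r *\<^sub>R y) has_derivative (\<lambda>h. h *\<^sub>R y)) (at r)"
    by (auto intro!: derivative_eq_intros)
  from has_derivative_compose[OF this assms[unfolded gderiv_def]]
  show ?thesis by (simp add: has_field_derivative_def inner_commute mult_commute_abs)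
qed

lemma GDERIV_increment_bound:
  fixes f :: "'a::real_inner \<Rightarrow> real"
  assumes T: "convex T" and f: "\<And>x. GDERIV f x :> g x" and K: "\<And>x. x \<in> T \<Longrightarrow> norm (g x) \<le> K"
    and xy: "x \<in> T" "y \<in> T"
  shows "\<bar>f x - f y\<bar> \<le> K * norm (x - y)"
proof -
  have "\<bar>f (y + 1 *\<^sub>R (x - y)) - f (y + 0 *\<^sub>R (x - y))\<bar> \<le> (K * norm (x - y)) * \<bar>1 - 0\<bar>"
  proof (rule field_differentiable_bound[where S="{0..1::real}", unfolded real_norm_def])
    fix r :: real assume r: "r \<in> {0..1}"
    show "((\<lambda>r. f (y + r *\<^sub>R (x - y))) has_field_derivative g (y + r *\<^sub>R (x - y)) \<bullet> (x - y)) (at r within {0..1})"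
      by (rule has_field_derivative_at_within[OF GDERIV_line[OF f]])
    have "y + r *\<^sub>R (x - y) = (1 - r) *\<^sub>R y + r *\<^sub>R x" by (simp add: algebra_simps)
    then have "y + r *\<^sub>R (x - y) \<in> T" using T xy r by (auto simp: convex_alt)
    then have "norm (g (y + r *\<^sub>R (x - y))) * norm (x - y) \<le> K * norm (x - y)"
      by (intro mult_right_mono K) auto
    with Cauchy_Schwarz_ineq2 show "\<bar>g (y + r *\<^sub>R (x - y)) \<bullet> (x - y)\<bar> \<le> K * norm (x - y)"
      by (rule order_trans)
  qed auto
  then show ?thesis by simp
qed

text \<open>The difference quotient of \<open>r \<mapsto> \<integral>\<^bsub>v + r(T - v)\<^esub> f\<close> at \<open>r = 1\<close> tends to the flux.  It also tends to 0,
  because the layer \<open>T - (v + r(T - v))\<close> has volume of order \<open>1 - r\<close>, and so have the values of \<open>f\<close> there.\<close>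

lemma face_flux_eq_0:
  fixes T :: "'a::euclidean_space set"
  assumes T: "full_simplex T" and v: "v \<in> verts T"
    and f: "\<And>x. GDERIV f x :> g x" and g: "continuous_on UNIV g"
    and f0: "\<And>x. x \<in> opp_face T v \<Longrightarrow> f x = 0"
  shows "face_flux T v f g = 0"
proof -
  note S = simplex_facts[OF T]
  let ?d = "DIM('a)"
  let ?h = "\<lambda>r x. v + r *\<^sub>R (x - v)"
  have vT: "v \<in> T" using verts_subset[OF T] v by blast
  have fc: "continuous_on A f" for A by (rule continuous_on_GDERIV[OF f])
  have gc: "continuous_on A g" for A using g continuous_on_subset by blast
  have "bounded (g ` T)" "bounded (f ` T)" "bounded ((\<lambda>x. x - v) ` T)"
    using S(1) by (auto intro!: compact_imp_bounded compact_continuous_image fc gc continuous_intros)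
  then obtain G F R where GF: "\<And>x. x \<in> T \<Longrightarrow> norm (g x) \<le> G" "\<And>x. x \<in> T \<Longrightarrow> \<bar>f x\<bar> \<le> F"
      "\<And>x. x \<in> T \<Longrightarrow> norm (x - v) \<le> R"
    unfolding bounded_iff by (force simp: image_iff)
  have pos: "0 \<le> G" "0 \<le> F" "0 \<le> R" using GF vT norm_ge_zero abs_ge_zero order_trans by metis+
  have hT: "?h r x \<in> T" if "x \<in> T" "0 \<le> r" "r \<le> 1" for r x
  proof -
    have "?h r x = (1 - r) *\<^sub>R v + r *\<^sub>R x" by (simp add: algebra_simps)
    then show ?thesis using S(2) vT that by (auto simp: convex_alt)
  qed
  \<comment> \<open>\<open>q r\<close> is the difference quotient at \<open>r = 1\<close> of the
    integral over the contracted simplex, pulled back to \<open>T\<close>: the Jacobian of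
    \<open>?h r\<close> is \<open>r ^ ?d\<close>.\<close>
  define q where "q r x = (f x - r ^ ?d * f (?h r x)) / (1 - r)" for r x
  \<comment> \<open>Approaches 1 from below; the offset 2 keeps \<open>rr n\<close> at least 1/2,
    which later bounds \<open>1 / (1 - l)\<close> by 2.\<close>
  define rr where "rr n = 1 - 1 / real (n + 2)" for n :: nat
  have rr: "0 < rr n" "1/2 \<le> rr n" "rr n < 1" for n by (auto simp: rr_def field_simps)
  have rr1: "rr \<longlonglongrightarrow> 1"
  proof -
    have "(\<lambda>n. 1 - 1 / real (n + 2)) \<longlonglongrightarrow> 1 - 0"
      by (intro tendsto_intros LIMSEQ_ignore_initial_segment[OF lim_1_over_n])
    then show ?thesis unfolding rr_def by simp
  qed
  have der: "((\<lambda>r. r ^ ?d * f (?h r x)) has_real_derivative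
      (real ?d * r ^ (?d - 1) * f (?h r x) + r ^ ?d * (g (?h r x) \<bullet> (x - v)))) (at r)" for r x
    by (rule derivative_eq_intros GDERIV_line[OF f] | simp)+
  have lim: "(\<lambda>n. q (rr n) x) \<longlonglongrightarrow> real ?d * f x + g x \<bullet> (x - v)" for x
  proof -
    have "filterlim rr (at 1) sequentially"
      using rr1 rr(3) by (auto simp: filterlim_at intro!: always_eventually) (metis less_irrefl)
    moreover have "((\<lambda>r. (r ^ ?d * f (?h r x) - 1 ^ ?d * f (?h 1 x)) / (r - 1)) \<longlongrightarrow>
        real ?d * 1 ^ (?d - 1) * f (?h 1 x) + 1 ^ ?d * (g (?h 1 x) \<bullet> (x - v))) (at 1)"
      using der[of x 1] unfolding has_field_derivative_iff by simp
    ultimately have "(\<lambda>n. (rr n ^ ?d * f (?h (rr n) x) - 1 ^ ?d * f (?h 1 x)) / (rr n - 1)) \<longlonglongrightarrow>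
        real ?d * 1 ^ (?d - 1) * f (?h 1 x) + 1 ^ ?d * (g (?h 1 x) \<bullet> (x - v))"
      using filterlim_compose by fast
    moreover have "(rr n ^ ?d * f (?h (rr n) x) - 1 ^ ?d * f (?h 1 x)) / (rr n - 1) = q (rr n) x" for n
      using minus_divide_divide[of "rr n ^ ?d * f (?h (rr n) x) - f x" "rr n - 1"] by (simp add: q_def)
    ultimately show ?thesis by simp
  qed
  have qb: "\<bar>q (rr n) x\<bar> \<le> real ?d * F + G * R" if x: "x \<in> T" for n x
  proof -
    \<comment> \<open>By the mean value theorem the quotient is a derivative at an intermediate
      radius, which gives the bound uniform in \<open>n\<close> for dominated convergence.\<close>
    obtain s where s: "rr n < s" "s < 1" and
      e: "1 ^ ?d * f (?h 1 x) - rr n ^ ?d * f (?h (rr n) x)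
        = (1 - rr n) * (real ?d * s ^ (?d - 1) * f (?h s x) + s ^ ?d * (g (?h s x) \<bullet> (x - v)))"
      using MVT2[OF rr(3)[of n], of "\<lambda>r. r ^ ?d * f (?h r x)" "\<lambda>r. real ?d * r ^ (?d - 1) * f (?h r x) + r ^ ?d * (g (?h r x) \<bullet> (x - v))"] der
      by blast
    have s0: "0 \<le> s" using s(1) rr(1)[of n] by simp
    have "q (rr n) x = real ?d * s ^ (?d - 1) * f (?h s x) + s ^ ?d * (g (?h s x) \<bullet> (x - v))"
      using e rr(3)[of n] by (simp add: q_def field_simps)
    moreover have "\<bar>real ?d * s ^ (?d - 1) * f (?h s x)\<bar> \<le> real ?d * 1 * F"
      unfolding abs_mult using s s0 hT[OF x] GF(2) pos by (intro mult_mono) (auto simp: power_le_one)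
    moreover have "\<bar>s ^ ?d * (g (?h s x) \<bullet> (x - v))\<bar> \<le> 1 * (G * R)"
      unfolding abs_mult
    proof (rule mult_mono)
      have "\<bar>g (?h s x) \<bullet> (x - v)\<bar> \<le> norm (g (?h s x)) * norm (x - v)" by (rule Cauchy_Schwarz_ineq2)
      also have "\<dots> \<le> G * R" using s s0 hT[OF x] GF x pos by (intro mult_mono) auto
      finally show "\<bar>g (?h s x) \<bullet> (x - v)\<bar> \<le> G * R" .
    qed (use s s0 in \<open>auto simp: power_le_one\<close>)
    ultimately show ?thesis by linarith
  qed
  have qc: "continuous_on T (q r)" for r
  proof -
    have "continuous_on T (\<lambda>x. (f x - r ^ ?d * f (?h r x)) * (1 / (1 - r)))"
      by (intro continuous_intros continuous_on_compose2[OF fc[of UNIV]] fc) auto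
    then show ?thesis by (simp add: q_def[abs_def])
  qed
  have "(\<lambda>n. integral\<^sup>L (lebesgue_on T) (q (rr n))) \<longlonglongrightarrow> face_flux T v f g"
    unfolding face_flux_def
  proof (rule integral_dominated_convergence[where w="\<lambda>_. real ?d * F + G * R"])
    show "(\<lambda>x. real ?d * f x + g x \<bullet> (x - v)) \<in> borel_measurable (lebesgue_on T)"
      by (intro borel_measurable_integrable integral_compact_lborel(1) S(1) continuous_intros fc gc)
    show "q (rr n) \<in> borel_measurable (lebesgue_on T)" for n
      by (intro borel_measurable_integrable integral_compact_lborel(1) S(1) qc)
    show "integrable (lebesgue_on T) (\<lambda>_. real ?d * F + G * R)"
      by (intro integral_compact_lborel(1) S(1) continuous_intros)
    show "AE x in lebesgue_on T. (\<lambda>n. q (rr n) x) \<longlonglongrightarrow> real ?d * f x + g x \<bullet> (x - v)" using lim by simp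
    show "AE x in lebesgue_on T. norm (q (rr n) x) \<le> real ?d * F + G * R" for n
      using S(6) qb by (intro AE_I2) simp
  qed
  moreover have "(\<lambda>n. integral\<^sup>L (lebesgue_on T) (q (rr n))) \<longlonglongrightarrow> 0"
  proof (rule Lim_null_comparison)
    let ?K = "2 * G * R * real ?d * measure lebesgue T"
    show "(\<lambda>n. ?K * (1 - rr n)) \<longlonglongrightarrow> 0"
      using tendsto_mult[OF tendsto_const[of ?K] tendsto_diff[OF tendsto_const[of 1] rr1]] by simp
    have "\<bar>integral\<^sup>L (lebesgue_on T) (q r)\<bar> \<le> ?K * (1 - r)" if r: "1/2 \<le> r" "r < 1" for r
    proof -
      let ?Tr = "?h r ` T"
      have r0: "0 < r" using r by simp
      have Tr: "compact ?Tr" by (intro compact_continuous_image continuous_intros S(1))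
      have sub: "?Tr \<subseteq> T" using hT r by auto
      have "linear (\<lambda>x. r *\<^sub>R x)" by (simp add: linear_scaleR)
      moreover have "inj (\<lambda>x::'a. r *\<^sub>R x)" using r0 by (auto simp: inj_def)
      moreover have "?h r x = (1 - r) *\<^sub>R v + r *\<^sub>R x" for x by (simp add: algebra_simps)
      ultimately have cv: "measure lebesgue T * integral\<^sup>L (lebesgue_on ?Tr) f
          = measure lebesgue ?Tr * (\<integral>x. f (?h r x) \<partial>lebesgue_on T)"
        by (rule integral_affine_image) (use S(1) fc in auto)
      have img: "?Tr = (\<lambda>x. r *\<^sub>R x + (1 - r) *\<^sub>R v) ` T" by (auto simp: algebra_simps)
      have ms: "measure lebesgue ?Tr = r ^ ?d * measure lebesgue T"
        unfolding img using measure_lebesgue_affine[of r "(1 - r) *\<^sub>R v" T] r0 by simp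
      have "(\<integral>x. r ^ ?d * f (?h r x) \<partial>lebesgue_on T) = integral\<^sup>L (lebesgue_on ?Tr) f"
        using cv S(7) unfolding ms by simp
      moreover have "integral\<^sup>L (lebesgue_on T) (q r)
        = (integral\<^sup>L (lebesgue_on T) f - (\<integral>x. r ^ ?d * f (?h r x) \<partial>lebesgue_on T)) / (1 - r)"
        unfolding q_def
        by (subst Bochner_Integration.integral_diff[symmetric])
           (auto intro!: integral_compact_lborel(1) S(1) continuous_intros fc continuous_on_compose2[OF fc[of UNIV]])
      moreover have "integral\<^sup>L (lebesgue_on T) f - integral\<^sup>L (lebesgue_on ?Tr) f
        = (\<integral>x. indicator (T - ?Tr) x *\<^sub>R f x \<partial>lborel)"
        unfolding integral_compact_lborel(2)[OF S(1) fc] integral_compact_lborel(2)[OF Tr fc]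
        by (subst Bochner_Integration.integral_diff[symmetric, OF borel_integrable_compact[OF S(1) fc] borel_integrable_compact[OF Tr fc]])
           (use sub in \<open>intro Bochner_Integration.integral_cong refl, fastforce simp: indicator_def\<close>)
      ultimately have I: "integral\<^sup>L (lebesgue_on T) (q r) = (\<integral>x. indicator (T - ?Tr) x *\<^sub>R f x \<partial>lborel) / (1 - r)"
        by simp
      have fb: "\<bar>f x\<bar> \<le> 2 * G * R * (1 - r)" if x: "x \<in> T - ?Tr" for x
      proof -
        define l where "l = bary T v x"
        have l0: "0 \<le> l" using x simplex_bary(1)[OF T] v unfolding l_def by blast
        \<comment> \<open>A point of \<open>T\<close> whose coordinate at \<open>v\<close> is at
          least \<open>1 - r\<close> belongs to the contracted simplex: \<open>y\<close> is its
          preimage.\<close>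
        have l1: "l < 1 - r"
        proof (rule ccontr)
          assume "\<not> l < 1 - r"
          then have l: "1 - r \<le> l" by simp
          define y where "y = v + (1 / r) *\<^sub>R (x - v)"
          have "bary T w y \<ge> 0" if w: "w \<in> verts T" for w
          proof -
            have "bary T w y = bary T w v + (1 / r) * (bary T w x - bary T w v)"
              unfolding y_def by (simp add: bary_def inner_simps)
            moreover have "0 \<le> bary T w x" using x w simplex_bary(1)[OF T] by blast
            moreover have "bary T w v + (1 / r) * (bary T w x - bary T w v)
                = (if w = v then (l - (1 - r)) / r else bary T w x / r)"
              using bary_vertex[OF T w v] r0 by (simp add: l_def diff_divide_distrib add_divide_distrib)
            ultimately show ?thesis using l r0 by simp
          qed
          then have "y \<in> T" using simplex_bary(1)[OF T] by blast
          moreover have "?h r y = x" using r0 by (simp add: y_def)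
          ultimately show False using x by force
        qed
        then have l2: "l < 1" "1 / 2 \<le> 1 - l" using r by auto
        \<comment> \<open>The projection of \<open>x\<close> from \<open>v\<close> onto the opposite
          face, where \<open>f\<close> vanishes; its distance to \<open>x\<close> is of order
          \<open>1 - r\<close>.\<close>
        define s where "s = v + (1 / (1 - l)) *\<^sub>R (x - v)"
        have bs: "bary T w s = bary T w v + (1 / (1 - l)) * (bary T w x - bary T w v)" for w
          unfolding s_def by (simp add: bary_def inner_simps)
        have "bary T w s \<ge> 0" if w: "w \<in> verts T" for w
        proof -
          have "0 \<le> bary T w x" using x w simplex_bary(1)[OF T] by blast
          moreover have "bary T w s = (if w = v then 0 else bary T w x / (1 - l))"
            using bary_vertex[OF T w v] l2(1) unfolding bs by (simp add: l_def[symmetric] field_simps)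
          ultimately show ?thesis using l2(1) by simp
        qed
        then have sT: "s \<in> T" using simplex_bary(1)[OF T] by blast
        have "bary T v s = 0" unfolding bs using bary_vertex[OF T v v] l2(1)
          by (auto simp: l_def[symmetric] field_simps)
        then have "f s = 0" using f0 sT opp_face_iff[OF T v] by blast
        then have "\<bar>f x\<bar> \<le> G * norm (x - s)"
          using GDERIV_increment_bound[OF S(2) f GF(1), of x s] sT x by auto
        moreover have "x - s = (1 - 1 / (1 - l)) *\<^sub>R (x - v)" by (simp add: s_def algebra_simps)
        then have "norm (x - s) = (l / (1 - l)) * norm (x - v)" using l0 l2 by (simp add: divide_simps)
        moreover have "(l / (1 - l)) * norm (x - v) \<le> (2 * (1 - r)) * R"
        proof (rule mult_mono)
          have "l / (1 - l) \<le> l / (1/2)" using l0 l2 by (intro divide_left_mono) auto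
          then show "l / (1 - l) \<le> 2 * (1 - r)" using l1 by simp
        qed (use GF(3) x r in auto)
        ultimately have "\<bar>f x\<bar> \<le> G * ((2 * (1 - r)) * R)" using pos(1) mult_left_mono by fastforce
        then show ?thesis by (simp add: mult_ac)
      qed
      have D: "T - ?Tr \<in> lmeasurable" using S(6) lmeasurable_compact[OF Tr] by blast
      have Db: "T - ?Tr \<in> sets borel" using S(1) Tr by (simp add: borel_compact sets.Diff)
      have mD: "measure lborel (T - ?Tr) = (1 - r ^ ?d) * measure lebesgue T"
      proof -
        have "measure lebesgue (T - ?Tr) = measure lebesgue T - measure lebesgue ?Tr"
          using S(6) lmeasurable_compact[OF Tr] sub by (intro measurable_measure_Diff) (auto dest: fmeasurableD)
        moreover have "measure lebesgue (T - ?Tr) = measure lborel (T - ?Tr)" using Db by simp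
        ultimately show ?thesis unfolding ms by (simp only: left_diff_distrib mult_1_left)
      qed
      have fin: "emeasure lborel (T - ?Tr) < \<infinity>"
        using fmeasurableD2[OF D] Db by (simp add: top.not_eq_extremum)
      have "\<bar>\<integral>x. indicator (T - ?Tr) x *\<^sub>R f x \<partial>lborel\<bar> \<le> (\<integral>x. indicator (T - ?Tr) x *\<^sub>R (2 * G * R * (1 - r)) \<partial>lborel)"
      proof (rule order_trans[OF integral_abs_bound integral_mono_AE'])
        show "integrable lborel (\<lambda>x. indicator (T - ?Tr) x *\<^sub>R (2 * G * R * (1 - r)))"
          using Db fin by (intro integrable_scaleR_left) (auto simp: integrable_indicator_iff)
      qed (use pos r in \<open>auto simp: indicator_def fb\<close>)
      also have "\<dots> = 2 * G * R * (1 - r) * ((1 - r ^ ?d) * measure lebesgue T)"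
        using Db fin mD by simp
      also have "\<dots> \<le> 2 * G * R * (1 - r) * ((real ?d * (1 - r)) * measure lebesgue T)"
      proof (intro mult_left_mono mult_right_mono)
        \<comment> \<open>Bernoulli: the layer has volume at most \<open>?d * (1 - r)\<close> times
          that of \<open>T\<close>.\<close>
        have "1 + real ?d * (r - 1) \<le> (1 + (r - 1)) ^ ?d"
          by (rule Bernoulli_inequality) (use r in auto)
        then show "1 - r ^ ?d \<le> real ?d * (1 - r)" by (simp add: algebra_simps)
      qed (use pos r in auto)
      finally show ?thesis unfolding I using r by (simp add: abs_divide field_simps)
    qed
    then show "\<forall>\<^sub>F n in sequentially. norm (integral\<^sup>L (lebesgue_on T) (q (rr n))) \<le> ?K * (1 - rr n)"
      using rr by (intro always_eventually) auto
  qed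
  ultimately show ?thesis using LIMSEQ_unique by blast
qed

section \<open>Integrals of affine functions over simplices and faces\<close>

lemma GDERIV_affine: "GDERIV (\<lambda>x. a + b \<bullet> x) x :> b"
  unfolding gderiv_def by (auto intro!: derivative_eq_intros simp: inner_commute)

lemma GDERIV_bary: "GDERIV (bary T v) x :> bary_grad T v"
proof -
  have "bary T v = (\<lambda>x. (1 - bary_grad T v \<bullet> v) + bary_grad T v \<bullet> x)"
    by (auto simp: bary_def inner_simps)
  then show ?thesis using GDERIV_affine by metis
qed

lemma integral_const_simplex:
  fixes T :: "'a::euclidean_space set"
  assumes "full_simplex T"
  shows "(\<integral>x. (c::'b::euclidean_space) \<partial>lebesgue_on T) = measure lebesgue T *\<^sub>R c"
  using simplex_facts(6)[OF assms] by (simp add: measure_restrict_space fmeasurableD)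

text \<open>\<open>bary T v\<close> vanishes on the face opposite to \<open>v\<close>, so its flux
  there is 0. The integrand of that flux is \<open>(d + 1) * bary T v x - 1\<close>, which forces
  the mean value \<open>1 / (d + 1)\<close>.\<close>

lemma integral_bary:
  fixes T :: "'a::euclidean_space set"
  assumes T: "full_simplex T" and v: "v \<in> verts T"
  shows "integral\<^sup>L (lebesgue_on T) (bary T v) = measure lebesgue T / (real DIM('a) + 1)"
proof -
  have i: "integrable (lebesgue_on T) (bary T v)"
    by (intro integral_compact_lborel(1) simplex_facts(1)[OF T] continuous_intros)
  have c: "integrable (lebesgue_on T) (\<lambda>_. 1::real)"
    by (intro integral_compact_lborel(1) simplex_facts(1)[OF T] continuous_intros)
  have "face_flux T v (bary T v) (\<lambda>_. bary_grad T v) = 0"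
    by (rule face_flux_eq_0[OF T v GDERIV_bary]) (auto simp: opp_face_iff[OF T v])
  moreover have "real DIM('a) * bary T v x + bary_grad T v \<bullet> (x - v) = (real DIM('a) + 1) * bary T v x - 1" for x
    by (simp add: bary_def algebra_simps)
  ultimately have "(\<integral>x. (real DIM('a) + 1) * bary T v x - 1 \<partial>lebesgue_on T) = 0"
    unfolding face_flux_def by simp
  then have "(real DIM('a) + 1) * integral\<^sup>L (lebesgue_on T) (bary T v) = measure lebesgue T"
    using i c integral_const_simplex[OF T, of "1::real"]
    by (subst (asm) Bochner_Integration.integral_diff) auto
  then show ?thesis by (simp add: field_simps)
qed

lemma integral_ident_simplex:
  fixes T :: "'a::euclidean_space set"
  assumes T: "full_simplex T"
  shows "(\<integral>x. x \<partial>lebesgue_on T) = measure lebesgue T *\<^sub>R barycenter T"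
proof -
  have "(\<integral>x. x \<partial>lebesgue_on T) = (\<integral>x. (\<Sum>v\<in>verts T. bary T v x *\<^sub>R v) \<partial>lebesgue_on T)"
    by (simp add: bary_sum(2)[OF T])
  also have "\<dots> = (\<Sum>v\<in>verts T. \<integral>x. bary T v x *\<^sub>R v \<partial>lebesgue_on T)"
    by (intro Bochner_Integration.integral_sum integral_compact_lborel(1) simplex_facts(1)[OF T] continuous_intros)
  also have "\<dots> = (\<Sum>v\<in>verts T. integral\<^sup>L (lebesgue_on T) (bary T v) *\<^sub>R v)"
    by (intro sum.cong refl integral_scaleR_left integral_compact_lborel(1) simplex_facts(1)[OF T] continuous_intros)
  also have "\<dots> = measure lebesgue T *\<^sub>R (\<Sum>v\<in>verts T. bary T v (barycenter T) *\<^sub>R v)"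
    by (auto simp: integral_bary[OF T] bary_barycenter(1)[OF T] scaleR_sum_right intro!: sum.cong)
  finally show ?thesis by (simp add: bary_sum(2)[OF T])
qed

lemma integral_affine_simplex:
  fixes T :: "'a::euclidean_space set"
  assumes T: "full_simplex T"
  shows "(\<integral>x. a + b \<bullet> x \<partial>lebesgue_on T) = measure lebesgue T * (a + b \<bullet> barycenter T)"
    "(\<integral>x. c + e *\<^sub>R (x - barycenter T) \<partial>lebesgue_on T) = measure lebesgue T *\<^sub>R c"
proof -
  have i: "integrable (lebesgue_on T) (\<lambda>x. x)" "integrable (lebesgue_on T) (\<lambda>x. b \<bullet> x)"
      "integrable (lebesgue_on T) (\<lambda>x. a)" "integrable (lebesgue_on T) (\<lambda>x. c)"
      "integrable (lebesgue_on T) (\<lambda>x. e *\<^sub>R (x - barycenter T))" "integrable (lebesgue_on T) (\<lambda>x. barycenter T)"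
    by (intro integral_compact_lborel(1) simplex_facts(1)[OF T] continuous_intros)+
  show "(\<integral>x. a + b \<bullet> x \<partial>lebesgue_on T) = measure lebesgue T * (a + b \<bullet> barycenter T)"
    using i integral_const_simplex[OF T, of a] integral_ident_simplex[OF T]
    by (subst Bochner_Integration.integral_add) (auto simp: algebra_simps)
  have "measure (lebesgue_on T) T = measure lebesgue T"
    using simplex_facts(6)[OF T] by (simp add: measure_restrict_space fmeasurableD)
  then show "(\<integral>x. c + e *\<^sub>R (x - barycenter T) \<partial>lebesgue_on T) = measure lebesgue T *\<^sub>R c"
    using i by (subst Bochner_Integration.integral_add)
      (auto simp: integral_const_simplex[OF T] integral_ident_simplex[OF T] Bochner_Integration.integral_diff)
qed

text \<open>Both sides are the sum of all vertices.\<close>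

lemma barycenter_face_vertex:
  fixes T :: "'a::euclidean_space set"
  assumes T: "full_simplex T" and v: "v \<in> verts T"
  shows "(real DIM('a) + 1) *\<^sub>R barycenter T = v + real DIM('a) *\<^sub>R barycenter (opp_face T v)"
proof -
  note V = full_simplex_verts[OF T]
  have "real DIM('a) *\<^sub>R barycenter (opp_face T v)
      = (\<Sum>w\<in>verts T. (real DIM('a) * bary T w (barycenter (opp_face T v))) *\<^sub>R w)"
    by (simp only: scaleR_scaleR[symmetric] scaleR_sum_right[symmetric] bary_sum(2)[OF T])
  also have "\<dots> = (\<Sum>w\<in>verts T. w - (if w = v then w else 0))"
    by (intro sum.cong) (auto simp: bary_barycenter_face[OF T v])
  also have "\<dots> = (\<Sum>w\<in>verts T. w) - v" using v V(1) by (simp add: sum_subtractf)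
  also have "(\<Sum>w\<in>verts T. w) = (\<Sum>w\<in>verts T. ((real DIM('a) + 1) * bary T w (barycenter T)) *\<^sub>R w)"
    by (intro sum.cong) (auto simp: bary_barycenter(1)[OF T])
  also have "\<dots> = (real DIM('a) + 1) *\<^sub>R barycenter T"
    by (simp only: scaleR_scaleR[symmetric] scaleR_sum_right[symmetric] bary_sum(2)[OF T])
  finally show ?thesis by simp
qed

text \<open>The flux integrand is itself affine, so its integral is the volume times its value at
  the barycenter of \<open>T\<close>; \<open>barycenter_face_vertex\<close> turns this into the
  value at the barycenter of the face. This is why continuity at side barycenters is the right
  coupling for Crouzeix--Raviart functions.\<close>

lemma face_flux_affine:
  fixes T :: "'a::euclidean_space set"
  assumes T: "full_simplex T" and v: "v \<in> verts T"
  shows "face_flux T v (\<lambda>x. a + b \<bullet> x) (\<lambda>_. b)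
       = real DIM('a) * measure lebesgue T * (a + b \<bullet> barycenter (opp_face T v))"
proof -
  have "real DIM('a) * (a + b \<bullet> x) + b \<bullet> (x - v) = (real DIM('a) * a - b \<bullet> v) + ((real DIM('a) + 1) *\<^sub>R b) \<bullet> x" for x
    by (simp add: algebra_simps)
  then have "face_flux T v (\<lambda>x. a + b \<bullet> x) (\<lambda>_. b)
      = measure lebesgue T * ((real DIM('a) * a - b \<bullet> v) + ((real DIM('a) + 1) *\<^sub>R b) \<bullet> barycenter T)"
    unfolding face_flux_def by (simp only: integral_affine_simplex[OF T])
  also have "((real DIM('a) + 1) *\<^sub>R b) \<bullet> barycenter T = b \<bullet> ((real DIM('a) + 1) *\<^sub>R barycenter T)" by simp
  also have "\<dots> = b \<bullet> v + real DIM('a) * (b \<bullet> barycenter (opp_face T v))"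
    unfolding barycenter_face_vertex[OF T v] by (simp add: inner_simps)
  finally show ?thesis by (simp add: algebra_simps)
qed

text \<open>The affine map between the simplices which fixes the common face preserves fluxes up to the
  volume ratio, and changes \<open>f\<close> only away from that face.\<close>

lemma face_flux_common_face:
  fixes T T' :: "'a::euclidean_space set"
  assumes T: "full_simplex T" "v \<in> verts T" and T': "full_simplex T'" "v' \<in> verts T'"
    and S: "opp_face T v = opp_face T' v'"
    and f: "\<And>x. GDERIV f x :> g x" and g: "continuous_on UNIV g"
  shows "measure lebesgue T * face_flux T' v' f g = measure lebesgue T' * face_flux T v f g"
proof -
  define \<gamma> where "\<gamma> = bary_grad T v"
  define L where "L x = x + (\<gamma> \<bullet> x) *\<^sub>R (v' - v)" for x
  define h where "h x = x + bary T v x *\<^sub>R (v' - v)" for x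
  have hL: "h x = (1 - \<gamma> \<bullet> v) *\<^sub>R (v' - v) + L x" for x
    by (simp add: h_def L_def bary_def \<gamma>_def inner_simps algebra_simps)
  \<comment> \<open>Stated for any two simplices with a common face, since it is applied in both
    directions: to \<open>h\<close> and to its inverse \<open>h'\<close>.\<close>
  have map: "bary T2 v2 (x + bary T1 v1 x *\<^sub>R (v2 - v1)) = bary T1 v1 x \<and>
      (x \<in> T1 \<longrightarrow> x + bary T1 v1 x *\<^sub>R (v2 - v1) \<in> T2)"
    if T1: "full_simplex T1" "v1 \<in> verts T1" and T2: "full_simplex T2" "v2 \<in> verts T2"
      and S: "opp_face T1 v1 = opp_face T2 v2" for T1 T2 :: "'a set" and v1 v2 x
  proof -
    note V1 = full_simplex_verts[OF T1(1)] and V2 = full_simplex_verts[OF T2(1)]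
    have V: "verts T1 - {v1} = verts T2 - {v2}"
      using verts_opp_face[OF T1] verts_opp_face[OF T2] S by simp
    define u where "u w = (if w = v2 then bary T1 v1 x else bary T1 w x)" for w
    have eq: "(\<Sum>w\<in>verts T2 - {v2}. u w) = (\<Sum>w\<in>verts T1 - {v1}. bary T1 w x)"
      "(\<Sum>w\<in>verts T2 - {v2}. u w *\<^sub>R w) = (\<Sum>w\<in>verts T1 - {v1}. bary T1 w x *\<^sub>R w)"
      by (intro sum.cong; auto simp: V u_def)+
    have s1: "sum u (verts T2) = 1"
      using bary_sum(1)[OF T1(1), of x] eq(1) sum.remove[OF V2(1) T2(2), of u]
        sum.remove[OF V1(1) T1(2), of "\<lambda>w. bary T1 w x"] by (simp add: u_def)
    have s2: "(\<Sum>w\<in>verts T2. u w *\<^sub>R w) = x + bary T1 v1 x *\<^sub>R (v2 - v1)"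
      using bary_sum(2)[OF T1(1), of x] eq(2) sum.remove[OF V2(1) T2(2), of "\<lambda>w. u w *\<^sub>R w"]
        sum.remove[OF V1(1) T1(2), of "\<lambda>w. bary T1 w x *\<^sub>R w"] by (simp add: u_def algebra_simps)
    have b: "bary T2 w (x + bary T1 v1 x *\<^sub>R (v2 - v1)) = u w" if "w \<in> verts T2" for w
      using bary_unique[OF T2(1) s1 that] s2 by simp
    have "u w \<ge> 0" if "x \<in> T1" "w \<in> verts T2" for w
      using that simplex_bary(1)[OF T1(1)] T1(2) V by (auto simp: u_def)
    then show ?thesis using b T2(2) simplex_bary(1)[OF T2(1)] by (auto simp: u_def)
  qed
  define h' where "h' y = y + bary T' v' y *\<^sub>R (v - v')" for y
  have h'h: "h' (h x) = x" for x
    using map[OF T T' S, of x] by (simp add: h'_def h_def algebra_simps)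
  have hh': "h (h' y) = y" for y
    using map[OF T' T S[symmetric], of y] by (simp add: h'_def h_def algebra_simps)
  have hT: "h ` T = T'"
  proof
    show "h ` T \<subseteq> T'" using map[OF T T' S] by (auto simp: h_def)
    have "h' ` T' \<subseteq> T" using map[OF T' T S[symmetric]] by (auto simp: h'_def)
    then show "T' \<subseteq> h ` T" using hh' by (metis image_iff image_subset_iff subsetI)
  qed
  have L: "linear L"
    unfolding L_def by (intro linearI) (auto simp: inner_simps algebra_simps)
  have "inj h" using h'h by (metis injI)
  then have "inj L" by (auto simp: inj_def hL)
  have fc: "continuous_on A f" for A by (rule continuous_on_GDERIV[OF f])
  have gc: "continuous_on A g" for A using g continuous_on_subset by blast
  have hc: "continuous_on A h" for A unfolding h_def by (intro continuous_intros)
  let ?F = "\<lambda>y. real DIM('a) * f y + g y \<bullet> (y - v')"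
  have "measure lebesgue T * integral\<^sup>L (lebesgue_on (h ` T)) ?F
      = measure lebesgue (h ` T) * (\<integral>x. ?F (h x) \<partial>lebesgue_on T)"
    by (rule integral_affine_image[OF L \<open>inj L\<close> hL simplex_facts(1)[OF T(1)]])
       (intro continuous_intros fc gc)
  moreover
  define f' where "f' x = f (h x)" for x
  define g' where "g' x = g (h x) + (g (h x) \<bullet> (v' - v)) *\<^sub>R \<gamma>" for x
  have f': "GDERIV f' x :> g' x" for x
  proof -
    have "(h has_derivative (\<lambda>k. k + (\<gamma> \<bullet> k) *\<^sub>R (v' - v))) (at x)"
      unfolding h_def bary_def \<gamma>_def by (auto intro!: derivative_eq_intros)
    from has_derivative_compose[OF this f[unfolded gderiv_def]]
    show ?thesis unfolding gderiv_def f'_def g'_def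
      by (simp add: inner_simps inner_commute mult_ac)
  qed
  have g'c: "continuous_on A g'" for A
    unfolding g'_def by (intro continuous_intros continuous_on_compose2[OF gc[of UNIV] hc]) auto
  have "?F (h x) = real DIM('a) * f' x + g' x \<bullet> (x - v)" for x
  proof -
    \<comment> \<open>The derivative of \<open>h\<close> carries \<open>x - v\<close> to
      \<open>h x - v'\<close>; hence the flux integrand of \<open>f\<close> over \<open>T'\<close>,
      taken at \<open>h x\<close>, is that of \<open>f'\<close> over \<open>T\<close> at
      \<open>x\<close>.\<close>
    have "h x - v' = (x - v) + (\<gamma> \<bullet> (x - v)) *\<^sub>R (v' - v)"
      by (simp add: h_def bary_def \<gamma>_def algebra_simps)
    then have "g (h x) \<bullet> (h x - v') = g' x \<bullet> (x - v)"
      by (simp only: g'_def inner_add_left inner_add_right inner_scaleR_left inner_scaleR_right mult.commute)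
    then show ?thesis by (simp add: f'_def)
  qed
  then have "(\<integral>x. ?F (h x) \<partial>lebesgue_on T) = face_flux T v f' g'" unfolding face_flux_def by simp
  moreover have "face_flux T v (\<lambda>x. f' x - f x) (\<lambda>x. g' x - g x) = 0"
  proof (rule face_flux_eq_0[OF T])
    show "GDERIV (\<lambda>x. f' x - f x) x :> g' x - g x" for x by (rule GDERIV_diff[OF f' f])
    show "continuous_on UNIV (\<lambda>x. g' x - g x)" by (intro continuous_intros g'c g)
    show "f' x - f x = 0" if "x \<in> opp_face T v" for x
      using that opp_face_iff[OF T] by (simp add: f'_def h_def)
  qed
  then have "face_flux T v f' g' = face_flux T v f g"
  proof -
    have "real DIM('a) * (f' x - f x) + (g' x - g x) \<bullet> (x - v)
      = (real DIM('a) * f' x + g' x \<bullet> (x - v)) - (real DIM('a) * f x + g x \<bullet> (x - v))" for x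
      by (simp add: algebra_simps inner_simps)
    moreover have "continuous_on A f'" for A by (rule continuous_on_GDERIV[OF f'])
    ultimately have "face_flux T v (\<lambda>x. f' x - f x) (\<lambda>x. g' x - g x) = face_flux T v f' g' - face_flux T v f g"
      unfolding face_flux_def
      by (simp only:) (intro Bochner_Integration.integral_diff integral_compact_lborel(1) simplex_facts(1)[OF T(1)] continuous_intros fc gc g'c)
    with \<open>face_flux T v (\<lambda>x. f' x - f x) (\<lambda>x. g' x - g x) = 0\<close> show ?thesis by simp
  qed
  ultimately show ?thesis unfolding hT face_flux_def[of T'] by simp
qed

section \<open>Test functions\<close>

lemma AE_notin_negligible: "negligible N \<Longrightarrow> AE x in lebesgue. x \<notin> N"
  by (rule AE_not_in) (simp add: negligible_iff_null_sets)

text \<open>Discrete functions are arbitrary on the skeleton; their measurability comes from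
  completeness of Lebesgue measure, through \<open>absolutely_integrable_spike\<close>.\<close>

lemma integral_lebesgue_spike:
  fixes F G :: "'a::euclidean_space \<Rightarrow> 'b::euclidean_space"
  assumes S: "S \<in> sets lebesgue" and G: "integrable (lebesgue_on S) G"
    and eq: "AE x in lebesgue_on S. F x = G x"
  shows "integrable (lebesgue_on S) F" "integral\<^sup>L (lebesgue_on S) F = integral\<^sup>L (lebesgue_on S) G"
proof -
  have "AE x in lebesgue. x \<in> S \<longrightarrow> F x = G x"
    using eq by (subst (asm) AE_restrict_space_iff) (use S in simp_all)
  then obtain N where N: "N \<in> null_sets lebesgue" "{x. \<not> (x \<in> S \<longrightarrow> F x = G x)} \<subseteq> N"
    unfolding eventually_ae_filter by auto
  have "integrable lebesgue (\<lambda>x. indicator S x *\<^sub>R G x)"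
    using G S by (simp add: integrable_restrict_space)
  then have "(\<lambda>x. indicator S x *\<^sub>R G x) absolutely_integrable_on UNIV" by (simp add: set_integrable_def)
  then have "(\<lambda>x. indicator S x *\<^sub>R F x) absolutely_integrable_on UNIV"
    by (rule absolutely_integrable_spike[where S=N])
      (use N in \<open>auto simp: negligible_iff_null_sets indicator_def\<close>)
  then show F: "integrable (lebesgue_on S) F"
    using S by (simp add: set_integrable_def integrable_restrict_space)
  show "integral\<^sup>L (lebesgue_on S) F = integral\<^sup>L (lebesgue_on S) G"
    by (rule integral_cong_AE[OF borel_measurable_integrable[OF F] borel_measurable_integrable[OF G] eq])
qed

lemma gradient_eq: "GDERIV f x :> D \<Longrightarrow> gradient f x = D"
proof -
  assume D: "GDERIV f x :> D"
  have "E = D" if "GDERIV f x :> E" for E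
  proof -
    have "(\<lambda>h. h \<bullet> E) = (\<lambda>h. h \<bullet> D)"
      using has_derivative_unique that D unfolding gderiv_def by blast
    then have "(E - D) \<bullet> (E - D) = 0" by (metis inner_diff_right right_minus_eq)
    then show ?thesis by simp
  qed
  with D show ?thesis unfolding gradient_def by (rule the_equality)
qed

lemma differentiable_GDERIV:
  fixes f :: "'a::euclidean_space \<Rightarrow> real"
  assumes "f differentiable (at x)"
  shows "GDERIV f x :> gradient f x"
proof -
  obtain f' where f': "(f has_derivative f') (at x)" using assms unfolding differentiable_def by blast
  have L: "linear f'" using f' has_derivative_linear by blast
  have eq: "f' h = h \<bullet> adjoint f' 1" for h
    using adjoint_works[OF L, of h 1] by simp
  have "GDERIV f x :> adjoint f' 1"
    unfolding gderiv_def by (rule has_derivative_eq_rhs[OF f']) (rule ext, rule eq)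
  then show ?thesis using gradient_eq by fastforce
qed

text \<open>The smooth step \<open>exp (- 1 / t)\<close>, extended by 0. The extra powers of
  \<open>1 / t\<close> make the family closed under differentiation up to linear
  combinations.\<close>

definition flat_exp :: "nat \<Rightarrow> real \<Rightarrow> real" where
  "flat_exp m t = (if 0 < t then (1 / t) ^ m / exp (1 / t) else 0)"

lemma flat_exp_nonneg: "0 \<le> flat_exp m t"
  by (simp add: flat_exp_def)

lemma DERIV_flat_exp:
  "(flat_exp m has_real_derivative flat_exp (m + 2) t - m * flat_exp (m + 1) t) (at t)"
proof -
  have cong: "(flat_exp m has_real_derivative D) (at t)"
    if "(g has_real_derivative D) (at t)" "\<forall>\<^sub>F s in nhds t. g s = flat_exp m s" for g D
    using DERIV_cong_ev[OF refl that(2) refl, of D] that(1) by simp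
  consider "t < 0" | "t = 0" | "0 < t" by linarith
  then show ?thesis
  proof cases
    case 1
    have "((\<lambda>_. 0) has_real_derivative 0) (at t)" by simp
    moreover have "\<forall>\<^sub>F s in nhds t. 0 = flat_exp m s"
      by (rule eventually_mono[OF eventually_nhds_in_open[of "{..<0}" t]]) (use 1 in \<open>auto simp: flat_exp_def\<close>)
    ultimately have "(flat_exp m has_real_derivative 0) (at t)" by (rule cong)
    then show ?thesis using 1 by (simp add: flat_exp_def)
  next
    case 2
    have "((\<lambda>s. flat_exp (m + 1) s) \<longlongrightarrow> 0) (at_right 0)"
    proof (rule Lim_transform_eventually)
      show "((\<lambda>s::real. inverse s ^ (m + 1) / exp (inverse s)) \<longlongrightarrow> 0) (at_right 0)"
        by (rule filterlim_compose[OF tendsto_power_div_exp_0 filterlim_inverse_at_top_right])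
      show "\<forall>\<^sub>F s::real in at_right 0. inverse s ^ (m + 1) / exp (inverse s) = flat_exp (m + 1) s"
        by (rule eventually_mono[OF eventually_at_right_less]) (auto simp: flat_exp_def inverse_eq_divide)
    qed
    moreover have "((\<lambda>s. flat_exp (m + 1) s) \<longlongrightarrow> 0) (at_left 0)"
    proof (rule Lim_transform_eventually[OF tendsto_const])
      show "\<forall>\<^sub>F s::real in at_left 0. 0 = flat_exp (m + 1) s"
        by (auto simp: eventually_at_filter flat_exp_def)
    qed
    ultimately have "((\<lambda>s. flat_exp (m + 1) s) \<longlongrightarrow> 0) (at 0)" using filterlim_split_at by blast
    \<comment> \<open>At 0 the difference quotient is the next member of the family; for
      \<open>s = 0\<close> both sides are 0 by division by zero.\<close>
    moreover have "flat_exp (m + 1) s = (flat_exp m s - flat_exp m 0) / (s - 0)" for s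
      by (simp add: flat_exp_def)
    ultimately have "(flat_exp m has_real_derivative 0) (at 0)"
      unfolding has_field_derivative_iff by simp
    then show ?thesis using 2 by (simp add: flat_exp_def)
  next
    case 3
    define k where "k = (1 / t) ^ m"
    have "((\<lambda>t. (1 / t) ^ m * exp (- (1 / t))) has_real_derivative
        (m * (1 / t) ^ (m - 1) * (- ((1 / t) ^ 2))) * exp (- (1 / t)) + (1 / t) ^ m * (exp (- (1 / t)) * (1 / t) ^ 2)) (at t)"
      using 3 by (auto intro!: derivative_eq_intros simp: power2_eq_square)
    also have "(m * (1 / t) ^ (m - 1) * (- ((1 / t) ^ 2))) * exp (- (1 / t)) + (1 / t) ^ m * (exp (- (1 / t)) * (1 / t) ^ 2)
       = flat_exp (m + 2) t - m * flat_exp (m + 1) t"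
      using 3 by (cases m) (auto simp: flat_exp_def exp_minus field_simps power2_eq_square)
    finally have "((\<lambda>t. (1 / t) ^ m * exp (- (1 / t))) has_real_derivative
        flat_exp (m + 2) t - m * flat_exp (m + 1) t) (at t)" .
    moreover have "\<forall>\<^sub>F s in nhds t. (1 / s) ^ m * exp (- (1 / s)) = flat_exp m s"
      by (rule eventually_mono[OF eventually_nhds_in_open[of "{0<..}" t]])
        (use 3 in \<open>auto simp: flat_exp_def exp_minus divide_inverse\<close>)
    ultimately show ?thesis by (rule cong)
  qed
qed

text \<open>Closed under partial derivatives (\<open>smooth_ring_GDERIV\<close>), so that
  \<open>Ck k\<close> follows for every \<open>k\<close> by induction on \<open>k\<close>, and rich
  enough for bumps on boxes and balls.\<close>

inductive_set smooth_ring :: "(real ^ 'd \<Rightarrow> real) set" where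
  const: "(\<lambda>_. c) \<in> smooth_ring"
| coord: "(\<lambda>x. x $ i) \<in> smooth_ring"
| add: "f \<in> smooth_ring \<Longrightarrow> g \<in> smooth_ring \<Longrightarrow> (\<lambda>x. f x + g x) \<in> smooth_ring"
| mult: "f \<in> smooth_ring \<Longrightarrow> g \<in> smooth_ring \<Longrightarrow> (\<lambda>x. f x * g x) \<in> smooth_ring"
| flat: "f \<in> smooth_ring \<Longrightarrow> (\<lambda>x. flat_exp m (f x)) \<in> smooth_ring"

lemma smooth_ring_diff: "f \<in> smooth_ring \<Longrightarrow> g \<in> smooth_ring \<Longrightarrow> (\<lambda>x. f x - g x) \<in> smooth_ring"
  using smooth_ring.add[OF _ smooth_ring.mult[OF smooth_ring.const[of "- 1"]], of f g] by simp

lemma smooth_ring_sum: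
  "finite A \<Longrightarrow> (\<And>i. i \<in> A \<Longrightarrow> f i \<in> smooth_ring) \<Longrightarrow> (\<lambda>x. \<Sum>i\<in>A. f i x) \<in> smooth_ring"
  by (induction A rule: finite_induct) (auto intro: smooth_ring.const smooth_ring.add)

lemma smooth_ring_prod:
  "finite A \<Longrightarrow> (\<And>i. i \<in> A \<Longrightarrow> f i \<in> smooth_ring) \<Longrightarrow> (\<lambda>x. \<Prod>i\<in>A. f i x) \<in> smooth_ring"
  by (induction A rule: finite_induct) (auto intro: smooth_ring.const smooth_ring.mult)

lemma smooth_ring_GDERIV:
  "f \<in> smooth_ring \<Longrightarrow> \<exists>D. (\<forall>x. GDERIV f x :> D x) \<and> (\<forall>i. (\<lambda>x. D x $ i) \<in> smooth_ring)"
proof (induction rule: smooth_ring.induct)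
  case (const c)
  show ?case by (intro exI[of _ "\<lambda>_. 0"]) (auto intro: GDERIV_const smooth_ring.const)
next
  case (coord i)
  have "GDERIV (\<lambda>x. x $ i) x :> axis i 1" for x
    using GDERIV_affine[of 0 "axis i 1" x] by (simp add: inner_axis')
  then show ?case by (intro exI[of _ "\<lambda>_. axis i 1"]) (auto intro: smooth_ring.const)
next
  case (add f g)
  then obtain F G where "\<forall>x. GDERIV f x :> F x" "\<forall>i. (\<lambda>x. F x $ i) \<in> smooth_ring"
    "\<forall>x. GDERIV g x :> G x" "\<forall>i. (\<lambda>x. G x $ i) \<in> smooth_ring" by blast
  then show ?case by (intro exI[of _ "\<lambda>x. F x + G x"]) (auto intro: GDERIV_add smooth_ring.add)
next
  case (mult f g)
  then obtain F G where "\<forall>x. GDERIV f x :> F x" "\<forall>i. (\<lambda>x. F x $ i) \<in> smooth_ring"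
    "\<forall>x. GDERIV g x :> G x" "\<forall>i. (\<lambda>x. G x $ i) \<in> smooth_ring" by blast
  with mult show ?case by (intro exI[of _ "\<lambda>x. f x *\<^sub>R G x + g x *\<^sub>R F x"])
    (auto intro!: GDERIV_mult smooth_ring.add smooth_ring.mult)
next
  case (flat f m)
  then obtain F where F: "\<forall>x. GDERIV f x :> F x" "\<forall>i. (\<lambda>x. F x $ i) \<in> smooth_ring" by blast
  let ?D = "\<lambda>x. (flat_exp (m + 2) (f x) - m * flat_exp (m + 1) (f x)) *\<^sub>R F x"
  have "GDERIV (\<lambda>x. flat_exp m (f x)) x :> ?D x" for x
    using GDERIV_DERIV_compose[OF F(1)[rule_format] DERIV_flat_exp] .
  moreover have "(\<lambda>x. ?D x $ i) \<in> smooth_ring" for i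
    unfolding vector_scaleR_component real_scaleR_def
    by (intro smooth_ring_diff smooth_ring.mult smooth_ring.const smooth_ring.flat flat F(2)[rule_format])
  ultimately show ?case by (intro exI[of _ ?D]) blast
qed

lemma smooth_ring_Ck: "f \<in> smooth_ring \<Longrightarrow> Ck k f"
proof (induction k arbitrary: f)
  case 0
  then show ?case using smooth_ring_GDERIV continuous_on_GDERIV by (metis Ck.simps(1))
next
  case (Suc k)
  then obtain D where D: "\<forall>x. GDERIV f x :> D x" "\<forall>i. (\<lambda>x. D x $ i) \<in> smooth_ring"
    using smooth_ring_GDERIV by blast
  then have "gradient f = D" using gradient_eq by fast
  moreover have "f differentiable at x" for x using D(1) unfolding gderiv_def differentiable_def by blast
  ultimately show ?case using Suc.IH D(2) by simp
qed

lemma smooth_ring_test_function: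
  assumes f: "f \<in> smooth_ring" and K: "compact K" "K \<subseteq> U" "\<And>x. x \<notin> K \<Longrightarrow> f x = 0"
  shows "f \<in> test_functions U"
proof -
  have "closure {x. f x \<noteq> 0} \<subseteq> K" using K by (intro closure_minimal compact_imp_closed) auto
  moreover have "compact (closure {x. f x \<noteq> 0})"
    using calculation K(1) by (metis closed_closure compact_Int_closed inf.absorb_iff2)
  moreover have "closure {x. f x \<noteq> 0} \<subseteq> U" using calculation(1) K(2) by (rule order_trans)
  ultimately show ?thesis unfolding test_functions_def
    by (intro CollectI conjI allI smooth_ring_Ck[OF f])
qed

lemma test_function_C1:
  assumes "\<eta> \<in> test_functions U"
  shows "GDERIV \<eta> x :> gradient \<eta> x" "continuous_on A (gradient \<eta>)"
proof -
  have C: "Ck (Suc 0) \<eta>" using assms unfolding test_functions_def by blast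
  then show "GDERIV \<eta> x :> gradient \<eta> x" using differentiable_GDERIV by auto
  have "continuous_on UNIV (\<lambda>x. \<chi> i. gradient \<eta> x $ i)"
    using C by (intro continuous_on_vec_lambda) auto
  then show "continuous_on A (gradient \<eta>)" using continuous_on_subset by simp blast
qed

lemma test_function_eq_0: "\<eta> \<in> test_functions U \<Longrightarrow> x \<notin> U \<Longrightarrow> \<eta> x = 0"
  using closure_subset[of "{x. \<eta> x \<noteq> 0}"] by (auto simp: test_functions_def)

lemma test_functions_mono: "U \<subseteq> V \<Longrightarrow> test_functions U \<subseteq> test_functions V"
  unfolding test_functions_def by blast

text \<open>As \<open>n\<close> grows, the product of the functions \<open>exp (-1 / (n t))\<close> of the distances \<open>t\<close> to the
  facets tends to the indicator function of the open box.\<close>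

lemma box_limit_test_functions:
  fixes a b :: "real ^ 'd"
  assumes "cbox a b \<subseteq> U"
  obtains \<eta> :: "nat \<Rightarrow> real ^ 'd \<Rightarrow> real" where "\<And>n. \<eta> n \<in> test_functions U" "\<And>n x. \<bar>\<eta> n x\<bar> \<le> 1"
    "\<And>x. (\<lambda>n. \<eta> n x) \<longlonglongrightarrow> indicator (box a b) x"
proof
  define \<eta> where "\<eta> n x = (\<Prod>i\<in>UNIV. flat_exp 0 (real (Suc n) * (x $ i - a $ i)) * flat_exp 0 (real (Suc n) * (b $ i - x $ i)))"
    for n and x :: "real ^ 'd"
  have fe: "0 \<le> flat_exp 0 t" "flat_exp 0 t \<le> 1" for t by (auto simp: flat_exp_def)
  show "\<bar>\<eta> n x\<bar> \<le> 1" for n x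
    unfolding \<eta>_def by (auto simp: abs_prod abs_mult fe intro!: prod_le_1 mult_le_one)
  show "\<eta> n \<in> test_functions U" for n
  proof (rule smooth_ring_test_function[OF _ compact_cbox assms])
    show "\<eta> n \<in> smooth_ring"
      unfolding \<eta>_def
      by (intro smooth_ring_prod smooth_ring.mult smooth_ring.flat smooth_ring.const smooth_ring_diff smooth_ring.coord) simp
    fix x assume "x \<notin> cbox a b"
    then obtain i where "x $ i < a $ i \<or> b $ i < x $ i" unfolding mem_box_cart by (auto simp: not_le)
    then have "flat_exp 0 (real (Suc n) * (x $ i - a $ i)) * flat_exp 0 (real (Suc n) * (b $ i - x $ i)) = 0"
      by (auto simp: flat_exp_def zero_less_mult_iff)
    then show "\<eta> n x = 0" unfolding \<eta>_def by (intro prod_zero) auto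
  qed
  have fl: "(\<lambda>n. flat_exp 0 (real (Suc n) * t)) \<longlonglongrightarrow> (if 0 < t then 1 else 0)" for t
  proof (cases "0 < t")
    case True
    have "(\<lambda>n. (1 / exp ((1 / real (Suc n)) * (1 / t)))) \<longlonglongrightarrow> 1 / exp (0 * (1 / t))"
      by (intro tendsto_intros LIMSEQ_Suc[OF lim_1_over_n]) auto
    then show ?thesis using True by (simp add: flat_exp_def)
  next
    case False
    then show ?thesis by (simp add: flat_exp_def zero_less_mult_iff)
  qed
  show "(\<lambda>n. \<eta> n x) \<longlonglongrightarrow> indicator (box a b) x" for x
  proof -
    have "(\<lambda>n. \<eta> n x) \<longlonglongrightarrow> (\<Prod>i\<in>UNIV. (if 0 < x $ i - a $ i then 1 else 0) * (if 0 < b $ i - x $ i then 1 else 0))"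
      unfolding \<eta>_def by (intro tendsto_prod tendsto_mult fl)
    also have "(\<Prod>i\<in>UNIV. (if 0 < x $ i - a $ i then 1 else 0) * (if 0 < b $ i - x $ i then 1 else 0)) = (indicator (box a b) x :: real)"
    proof (cases "x \<in> box a b")
      case True
      then show ?thesis by (auto simp: mem_box_cart intro!: prod.neutral)
    next
      case False
      then obtain i where "\<not> (a $ i < x $ i \<and> x $ i < b $ i)" unfolding mem_box_cart by blast
      then show ?thesis using False by (simp add: prod_zero_iff) (auto intro!: exI[of _ i])
    qed
    finally show ?thesis .
  qed
qed

text \<open>The positive and negative parts of \<open>k\<close> are densities of two measures that
  agree on open boxes, an intersection-stable generator of the Borel sets. So the densities coincide
  almost everywhere, and two parts that are never both positive can only coincide at 0.\<close>

lemma AE_0_of_box_integrals: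
  fixes k :: "'a::euclidean_space \<Rightarrow> real"
  assumes k: "integrable lborel k" and box: "\<And>a b. (\<integral>x. indicator (box a b) x * k x \<partial>lborel) = 0"
  shows "AE x in lborel. k x = 0"
proof -
  have [measurable]: "k \<in> borel_measurable borel" using borel_measurable_integrable[OF k] by simp
  define P where "P = density lborel (\<lambda>x. ennreal (max 0 (k x)))"
  define N where "N = density lborel (\<lambda>x. ennreal (max 0 (- k x)))"
  have int: "integrable lborel (\<lambda>x. max 0 (s * k x) * indicator A x)" if "A \<in> sets borel" for A s
    using that k by (intro integrable_real_mult_indicator) (auto intro!: Bochner_Integration.integrable_max)
  have em: "emeasure (density lborel (\<lambda>x. ennreal (max 0 (s * k x)))) A = ennreal (\<integral>x. max 0 (s * k x) * indicator A x \<partial>lborel)"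
    if A: "A \<in> sets borel" for A s
  proof -
    have "emeasure (density lborel (\<lambda>x. ennreal (max 0 (s * k x)))) A = (\<integral>\<^sup>+x. ennreal (max 0 (s * k x) * indicator A x) \<partial>lborel)"
      using A by (subst emeasure_density) (auto intro!: nn_integral_cong simp: indicator_def)
    also have "\<dots> = ennreal (\<integral>x. max 0 (s * k x) * indicator A x \<partial>lborel)"
      by (rule nn_integral_eq_integral[OF int[OF A]]) auto
    finally show ?thesis .
  qed
  have "P = N"
  proof (rule measure_eqI_generator_eq[where E="range (\<lambda>(a, b). box a b)" and \<Omega>=UNIV and A="\<lambda>n. box (- real n *\<^sub>R One) (real n *\<^sub>R One)"])
    show "Int_stable (range (\<lambda>(a, b::'a). box a b))"
      by (auto simp: Int_stable_def box_Int_box)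
    show "sets P = sigma_sets UNIV (range (\<lambda>(a, b). box a b))" "sets N = sigma_sets UNIV (range (\<lambda>(a, b). box a b))"
      unfolding P_def N_def by (simp_all add: borel_eq_box)
    show "(\<Union>n. box (- real n *\<^sub>R One) (real n *\<^sub>R One)) = (UNIV :: 'a set)"
      using UN_box_eq_UNIV by (auto simp: scaleR_minus_left)
    have P1: "P = density lborel (\<lambda>x. ennreal (max 0 (1 * k x)))" "N = density lborel (\<lambda>x. ennreal (max 0 (-1 * k x)))"
      by (simp_all add: P_def N_def)
    fix X :: "'a set" assume "X \<in> range (\<lambda>(a, b). box a b)"
    then obtain a b where X: "X = box a b" by auto
    have "(\<integral>x. max 0 (1 * k x) * indicator X x \<partial>lborel) - (\<integral>x. max 0 (-1 * k x) * indicator X x \<partial>lborel)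
        = (\<integral>x. indicator (box a b) x * k x \<partial>lborel)"
      unfolding X by (subst Bochner_Integration.integral_diff[symmetric, OF int int])
        (auto intro!: Bochner_Integration.integral_cong simp: indicator_def)
    moreover have "X \<in> sets borel" unfolding X by simp
    ultimately show "emeasure P X = emeasure N X" unfolding P1 using box[of a b]
      by (simp only: em right_minus_eq)
  next
    show "emeasure P (box (- real n *\<^sub>R One) (real n *\<^sub>R One)) \<noteq> \<infinity>" for n
      using em[of "box (- real n *\<^sub>R One) (real n *\<^sub>R One)" 1] by (simp add: P_def)
  qed auto
  then have "AE x in lborel. ennreal (max 0 (k x)) = ennreal (max 0 (- k x))"
    unfolding P_def N_def
    by (subst (asm) sigma_finite_measure.density_unique_iff[OF lborel.sigma_finite_measure_axioms]) auto
  then show ?thesis by eventually_elim (auto simp: max_def split: if_splits)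
qed

text \<open>The fundamental lemma of the calculus of variations. Indicators of boxes in
  \<open>U\<close> are bounded limits of test functions, so the integrals of \<open>h\<close> over
  such boxes vanish; \<open>AE_0_of_box_integrals\<close> then applies on each of countably many
  boxes that cover \<open>U\<close>.\<close>

lemma AE_0_of_test_functions:
  fixes h :: "real ^ 'd \<Rightarrow> real"
  assumes \<Omega>: "\<Omega> \<in> sets lebesgue" and U: "open U" "U \<subseteq> \<Omega>"
    and h: "integrable (lebesgue_on \<Omega>) h"
    and 0: "\<And>\<eta>. \<eta> \<in> test_functions U \<Longrightarrow> (\<integral>x. h x * \<eta> x \<partial>lebesgue_on \<Omega>) = 0"
  shows "negligible {x \<in> U. h x \<noteq> 0}"
proof -
  define H where "H x = indicator \<Omega> x * h x" for x
  have H: "integrable lebesgue H"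
    using h \<Omega> by (simp add: H_def[abs_def] integrable_restrict_space)
  have Hbox: "(\<integral>x. indicator (box a b) x * H x \<partial>lebesgue) = 0" if ab: "cbox a b \<subseteq> U" for a b
  proof -
    obtain \<eta> where \<eta>: "\<And>n. \<eta> n \<in> test_functions U" "\<And>n x. \<bar>\<eta> n x\<bar> \<le> 1"
      "\<And>x. (\<lambda>n. \<eta> n x) \<longlonglongrightarrow> indicator (box a b) x" using box_limit_test_functions[OF ab] by metis
    have "\<eta> n \<in> borel_measurable lborel" for n
      using continuous_on_GDERIV[OF test_function_C1(1)[OF \<eta>(1)[of n]], of UNIV]
      by (simp add: borel_measurable_continuous_onI)
    note \<eta>m[measurable] = measurable_completion[OF this]
    note [measurable] = borel_measurable_integrable[OF H]
    have "(\<lambda>n. \<integral>x. H x * \<eta> n x \<partial>lebesgue) \<longlonglongrightarrow> (\<integral>x. indicator (box a b) x * H x \<partial>lebesgue)"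
    proof (rule integral_dominated_convergence[where w="\<lambda>x. \<bar>H x\<bar>"])
      show "(\<lambda>x. indicator (box a b) x * H x) \<in> borel_measurable lebesgue"
        by (intro borel_measurable_times borel_measurable_indicator borel_measurable_integrable[OF H]) auto
      show "AE x in lebesgue. (\<lambda>n. H x * \<eta> n x) \<longlonglongrightarrow> indicator (box a b) x * H x"
        using tendsto_mult[OF tendsto_const \<eta>(3)] by (auto simp: mult.commute)
      show "AE x in lebesgue. norm (H x * \<eta> n x) \<le> \<bar>H x\<bar>" for n
        using \<eta>(2) by (auto simp: abs_mult intro!: mult_left_le)
    qed (use H in auto)
    moreover have "(\<integral>x. H x * \<eta> n x \<partial>lebesgue) = 0" for n
      using 0[OF \<eta>(1)[of n]] \<Omega> by (simp add: integral_restrict_space H_def mult.assoc)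
    ultimately show ?thesis by (simp add: LIMSEQ_const_iff)
  qed
  \<comment> \<open>A Borel version of \<open>H\<close>, since the uniqueness argument compares
    measures on Borel sets.\<close>
  obtain H' where H'm[measurable]: "H' \<in> borel_measurable lborel" and H': "AE x in lborel. H x = H' x"
    using completion_ex_borel_measurable_real[OF borel_measurable_integrable[OF H]] by blast
  have H'l: "AE x in lebesgue. H x = H' x" using H' by (rule AE_completion)
  have "integrable lebesgue H'"
    using H by (subst integrable_cong_AE[OF _ borel_measurable_integrable[OF H]]) (use H'l H'm in \<open>auto intro: measurable_completion\<close>)
  then have H'i: "integrable lborel H'" using integrable_completion[of H' lborel] H'm by simp
  have H'box: "(\<integral>x. indicator (box a b) x * H' x \<partial>lborel) = 0" if ab: "cbox a b \<subseteq> U" for a b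
  proof -
    have "(\<integral>x. indicator (box a b) x * H' x \<partial>lborel) = (\<integral>x. indicator (box a b) x * H' x \<partial>lebesgue)"
      by (rule integral_completion[symmetric]) measurable
    also have "\<dots> = (\<integral>x. indicator (box a b) x * H x \<partial>lebesgue)"
    proof (rule integral_cong_AE)
      show "(\<lambda>x. indicator (box a b) x * H' x) \<in> borel_measurable lebesgue"
        by (intro borel_measurable_times borel_measurable_indicator measurable_completion[OF H'm]) auto
      show "(\<lambda>x. indicator (box a b) x * H x) \<in> borel_measurable lebesgue"
        by (intro borel_measurable_times borel_measurable_indicator borel_measurable_integrable[OF H]) auto
    qed (use H'l in auto)
    finally show ?thesis using Hbox[OF ab] by simp
  qed
  have Q: "AE x in lborel. x \<in> box p q \<longrightarrow> H' x = 0" if "cbox p q \<subseteq> U" for p q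
  proof -
    have "AE x in lborel. indicator (box p q) x * H' x = 0"
    proof (rule AE_0_of_box_integrals)
      show "integrable lborel (\<lambda>x. indicator (box p q) x * H' x)"
        using integrable_real_mult_indicator[OF _ H'i, of "box p q"] by (simp add: mult.commute)
      fix a b :: "real ^ 'd"
      obtain c d where cd: "box a b \<inter> box p q = box c d" "cbox c d \<subseteq> cbox p q"
        by (rule that[OF box_Int_box[of a b p q]]) (subst Int_interval[symmetric], rule Int_lower2)
      then have "(\<integral>x. indicator (box a b) x * (indicator (box p q) x * H' x) \<partial>lborel) = (\<integral>x. indicator (box c d) x * H' x \<partial>lborel)"
        by (intro Bochner_Integration.integral_cong) (auto simp: indicator_def)
      then show "(\<integral>x. indicator (box a b) x * (indicator (box p q) x * H' x) \<partial>lborel) = 0"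
        using H'box cd that by auto
    qed
    then show ?thesis by eventually_elim (auto simp: indicator_def)
  qed
  have Q': "AE x in lborel. x \<in> cbox p q \<longrightarrow> H' x = 0" if pq: "cbox p q \<subseteq> U" for p q
  proof -
    have "negligible (cbox p q - box p q)" by (rule negligible_frontier_interval)
    then have "AE x in lebesgue. x \<notin> cbox p q - box p q"
      by (rule AE_notin_negligible)
    then have "AE x in lborel. x \<notin> cbox p q - box p q" by (simp add: AE_completion_iff)
    with Q[OF pq] show ?thesis by eventually_elim auto
  qed
  obtain D where D: "countable D" "D \<subseteq> Pow U" "\<And>X. X \<in> D \<Longrightarrow> \<exists>a b. X = cbox a b" "\<Union>D = U"
    using open_countable_Union_open_cbox[OF U(1)] by metis
  have "AE x in lborel. \<forall>X\<in>D. x \<in> X \<longrightarrow> H' x = 0"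
    unfolding AE_ball_countable[OF D(1)] using D(2,3) Q' by blast
  then have "AE x in lebesgue. \<forall>X\<in>D. x \<in> X \<longrightarrow> H' x = 0" by (rule AE_completion)
  with H'l have "AE x in lebesgue. x \<notin> {x \<in> U. h x \<noteq> 0}"
  proof eventually_elim
    case (elim x)
    show ?case
    proof
      assume x: "x \<in> {x \<in> U. h x \<noteq> 0}"
      then have "H' x = 0" using elim(2) D(4) by blast
      moreover have "H x = h x" using x U(2) by (auto simp: H_def)
      ultimately show False using elim(1) x by simp
    qed
  qed
  then obtain N where "N \<in> null_sets lebesgue" "{x \<in> U. h x \<noteq> 0} \<subseteq> N"
    unfolding eventually_ae_filter by auto
  then show ?thesis using negligible_iff_null_sets negligible_subset by blast
qed

text \<open>The bump is centred outside \<open>T\<close>, across the face, so that the part of its support inside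
  \<open>T\<close> is a small cap at \<open>x0\<close> where the bump increases in the direction \<open>x - v\<close>.\<close>

lemma positive_face_flux:
  fixes T :: "(real ^ 'd) set"
  assumes T: "full_simplex T" and v: "v \<in> verts T" and x0: "x0 \<in> opp_face T v"
    and U: "open U" "x0 \<in> U"
  obtains \<eta> where "\<eta> \<in> test_functions U" "0 < face_flux T v \<eta> (gradient \<eta>)"
proof -
  note S = simplex_facts[OF T]
  define \<gamma> where "\<gamma> = bary_grad T v"
  have b: "bary T v x0 = 0" "x0 \<in> T" using x0 opp_face_iff[OF T v] by auto
  then have \<gamma>1: "\<gamma> \<bullet> (x0 - v) = - 1" by (simp add: bary_def \<gamma>_def)
  then have "\<gamma> \<noteq> 0" by auto
  \<comment> \<open>\<open>n\<close> is the outer unit normal of the face and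
    \<open>\<delta>\<close> the distance from \<open>v\<close> to its hyperplane.\<close>
  define n where "n = - (1 / norm \<gamma>) *\<^sub>R \<gamma>"
  define \<delta> where "\<delta> = 1 / norm \<gamma>"
  have \<delta>: "0 < \<delta>" using \<open>\<gamma> \<noteq> 0\<close> by (simp add: \<delta>_def)
  have n: "n \<bullet> n = 1" "n \<bullet> (x0 - v) = \<delta>" "norm n = 1"
    using \<open>\<gamma> \<noteq> 0\<close> \<gamma>1 by (auto simp: n_def \<delta>_def dot_square_norm power2_eq_square)
  have nT: "n \<bullet> (x - x0) \<le> 0" if "x \<in> T" for x
  proof -
    have "0 \<le> bary T v x" using that simplex_bary(1)[OF T] v by blast
    then have "0 \<le> \<gamma> \<bullet> (x - x0)" using bary_diff[of T v x x0] b by (simp add: \<gamma>_def)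
    then show ?thesis by (simp add: n_def mult_nonneg_nonneg)
  qed
  obtain e where e: "0 < e" "ball x0 e \<subseteq> U" using U openE by blast
  define R where "R = norm (x0 - v) + 1"
  have R: "0 < R" by (simp add: R_def add_nonneg_pos)
  define t where "t = e / 4"
  have t: "0 < t" using e by (simp add: t_def)
  \<comment> \<open>The bound 1 gives \<open>norm (x - v) \<le> R\<close> on the cap,
    \<open>e / 4\<close> keeps the support in \<open>U\<close>, \<open>\<delta> / 2\<close> keeps
    \<open>n \<bullet> (x - v)\<close> at least \<open>\<delta> / 2\<close>, and the last bound
    keeps the error term within half of \<open>t * (\<delta> / 2)\<close>.\<close>
  define \<rho> where "\<rho> = min (min 1 (e / 4)) (min (\<delta> / 2) (t * \<delta> / (4 * R)))"
  have \<rho>: "0 < \<rho>" "\<rho> \<le> 1" "\<rho> \<le> e / 4" "\<rho> \<le> \<delta> / 2" "\<rho> \<le> t * \<delta> / (4 * R)"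
    using e t \<delta> R unfolding \<rho>_def by auto
  define c where "c = x0 + t *\<^sub>R n"
  \<comment> \<open>Positive on a ball around \<open>c\<close> whose radius slightly exceeds the
    distance \<open>t\<close> from \<open>c\<close> to \<open>x0\<close>; the points of
    \<open>T\<close> in that ball are within \<open>\<rho>\<close> of \<open>x0\<close>.\<close>
  define q where "q x = (t\<^sup>2 + \<rho>\<^sup>2) - (x - c) \<bullet> (x - c)" for x
  define \<eta> where "\<eta> x = flat_exp 0 (q x)" for x
  define r where "r = t + \<rho>"
  have qr: "q x \<le> 0" if "x \<notin> cball c r" for x
  proof -
    have "r < norm (x - c)" using that by (simp add: dist_norm norm_minus_commute)
    moreover have "0 \<le> r" using t \<rho> by (simp add: r_def)
    ultimately have "r\<^sup>2 \<le> (norm (x - c))\<^sup>2" by (intro power_mono) auto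
    moreover have "t\<^sup>2 + \<rho>\<^sup>2 \<le> r\<^sup>2" using t \<rho> by (simp add: r_def power2_sum)
    ultimately show ?thesis by (simp add: q_def power2_norm_eq_inner)
  qed
  have dc: "dist x0 c = t" using t n(3) by (simp add: c_def dist_norm)
  have sub: "cball c r \<subseteq> U"
  proof
    fix x assume "x \<in> cball c r"
    then have "dist x0 x \<le> t + r" using dist_triangle[of x0 x c] dc by simp
    also have "\<dots> < e" using e \<rho>(3) by (simp add: r_def t_def)
    finally show "x \<in> U" using e(2) by auto
  qed
  have \<eta>t: "\<eta> \<in> test_functions U"
  proof (rule smooth_ring_test_function[OF _ compact_cball sub])
    show "\<eta> \<in> smooth_ring"
      unfolding \<eta>_def q_def inner_vec_def inner_real_def vector_minus_component
      by (intro smooth_ring.flat smooth_ring_diff smooth_ring.const smooth_ring_sum smooth_ring.mult smooth_ring.coord) simp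
    show "\<eta> x = 0" if "x \<notin> cball c r" for x using qr[OF that] by (simp add: \<eta>_def flat_exp_def)
  qed
  have grad: "gradient \<eta> x = (2 * flat_exp 2 (q x)) *\<^sub>R (c - x)" for x
  proof (rule gradient_eq)
    have "GDERIV q x :> 2 *\<^sub>R (c - x)"
      unfolding q_def gderiv_def by (auto intro!: derivative_eq_intros simp: inner_simps inner_commute)
    from GDERIV_DERIV_compose[OF this DERIV_flat_exp[of 0]]
    show "GDERIV \<eta> x :> (2 * flat_exp 2 (q x)) *\<^sub>R (c - x)"
      unfolding \<eta>_def by (simp add: mult.commute numeral_2_eq_2)
  qed
  have key: "0 \<le> flat_exp 2 (q x) * ((c - x) \<bullet> (x - v))" if x: "x \<in> T" for x
  proof (cases "0 < q x")
    case True
    have "(x - c) \<bullet> (x - c) = (x - x0) \<bullet> (x - x0) - 2 * t * (n \<bullet> (x - x0)) + t\<^sup>2"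
      by (simp add: c_def inner_simps n(1) inner_commute power2_eq_square algebra_simps)
    then have "(norm (x - x0))\<^sup>2 < \<rho>\<^sup>2 + 2 * t * (n \<bullet> (x - x0))"
      using True by (simp add: q_def power2_norm_eq_inner)
    also have "\<dots> \<le> \<rho>\<^sup>2" using nT[OF x] t by (simp add: mult_nonneg_nonpos)
    finally have xx: "norm (x - x0) < \<rho>" using \<rho>(1) power_less_imp_less_base by fastforce
    have "norm (x - v) \<le> R"
      using norm_triangle_ineq[of "x - x0" "x0 - v"] xx \<rho>(2) by (simp add: R_def)
    have "\<bar>(x0 - x) \<bullet> (x - v)\<bar> \<le> norm (x0 - x) * norm (x - v)" by (rule Cauchy_Schwarz_ineq2)
    also have "\<dots> \<le> \<rho> * R"
      using xx \<open>norm (x - v) \<le> R\<close> \<rho>(1) by (intro mult_mono) (auto simp: norm_minus_commute)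
    also have "\<dots> \<le> t * \<delta> / 4" using \<rho>(5) R by (simp add: field_simps)
    finally have 1: "\<bar>(x0 - x) \<bullet> (x - v)\<bar> \<le> t * \<delta> / 4" .
    have "\<bar>n \<bullet> (x - x0)\<bar> \<le> norm (x - x0)" using Cauchy_Schwarz_ineq2[of n "x - x0"] n(3) by simp
    then have "\<delta> / 2 \<le> n \<bullet> (x - v)"
      using n(2) xx \<rho>(4) by (simp add: inner_diff_right)
    then have 2: "t * (\<delta> / 2) \<le> t * (n \<bullet> (x - v))" using t by simp
    have "(c - x) \<bullet> (x - v) = t * (n \<bullet> (x - v)) + (x0 - x) \<bullet> (x - v)"
      by (simp add: c_def inner_simps algebra_simps)
    moreover have "0 < t * \<delta>" using t \<delta> by simp
    ultimately have "0 \<le> (c - x) \<bullet> (x - v)" using 1 2 by linarith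
    then show ?thesis using flat_exp_nonneg by (intro mult_nonneg_nonneg)
  qed (simp add: flat_exp_def)
  let ?F = "\<lambda>x. real DIM(real ^ 'd) * \<eta> x + gradient \<eta> x \<bullet> (x - v)"
  have Fge: "real DIM(real ^ 'd) * \<eta> x \<le> ?F x" if "x \<in> T" for x
    using key[OF that] by (simp add: grad mult.assoc)
  have F0: "0 \<le> ?F x" if "x \<in> T" for x
    using Fge[OF that] flat_exp_nonneg[of 0 "q x"] by (simp add: \<eta>_def)
  have Fi: "integrable (lebesgue_on T) ?F"
    by (intro integral_compact_lborel(1) S(1) continuous_intros test_function_C1(2)[OF \<eta>t]
        continuous_on_GDERIV[OF test_function_C1(1)[OF \<eta>t]])
  have AET: "AE x in lebesgue_on T. x \<in> T" by (rule AE_I2) simp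
  have nn: "AE x in lebesgue_on T. 0 \<le> ?F x"
    using AET by eventually_elim (rule F0)
  then have "0 \<le> integral\<^sup>L (lebesgue_on T) ?F" by (rule integral_nonneg_AE)
  moreover have "integral\<^sup>L (lebesgue_on T) ?F \<noteq> 0"
  proof
    assume "integral\<^sup>L (lebesgue_on T) ?F = 0"
    then have "AE x in lebesgue_on T. ?F x = 0"
      using integral_nonneg_eq_0_iff_AE[OF Fi nn] by simp
    then have "AE x in lebesgue. x \<in> T \<longrightarrow> ?F x = 0"
      by (subst (asm) AE_restrict_space_iff) (use S(6) in \<open>auto dest: fmeasurableD\<close>)
    then obtain N where N: "N \<in> null_sets lebesgue" "{x. \<not> (x \<in> T \<longrightarrow> ?F x = 0)} \<subseteq> N"
      unfolding eventually_ae_filter by auto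
    let ?W = "interior T \<inter> {x. 0 < q x}"
    have "open {x. 0 < q x}" unfolding q_def by (intro open_Collect_less continuous_intros)
    then have "open ?W" by blast
    have "x0 \<in> {x. 0 < q x}" using \<rho>(1) n(1) by (simp add: q_def c_def power2_eq_square)
    moreover have "x0 \<in> closure (interior T)" using b(2) S(8) by simp
    ultimately have "?W \<noteq> {}"
      using open_Int_closure_eq_empty[OF \<open>open {x. 0 < q x}\<close>, of "interior T"] by blast
    have "?W \<subseteq> N"
    proof
      fix x assume "x \<in> ?W"
      then have "x \<in> T" "0 < \<eta> x" using interior_subset by (auto simp: \<eta>_def flat_exp_def)
      then have "0 < ?F x" using Fge[of x] DIM_positive[where 'a="real ^ 'd"]
        by (meson less_le_trans mult_pos_pos of_nat_0_less_iff)
      then show "x \<in> N" using N(2) \<open>x \<in> T\<close> by auto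
    qed
    then have "negligible ?W" using N(1) negligible_iff_null_sets negligible_subset by blast
    then show False using open_not_negligible[OF \<open>open ?W\<close> \<open>?W \<noteq> {}\<close>] by blast
  qed
  ultimately have "0 < face_flux T v \<eta> (gradient \<eta>)" unfolding face_flux_def by simp
  with \<eta>t that show ?thesis by blast
qed

section \<open>Conforming triangulations\<close>

text \<open>Locally a Lipschitz domain is the region above a graph. Arbitrarily close below a
  boundary point \<open>p\<close> there are points with a neighbourhood disjoint from the domain, so
  \<open>p\<close> is not interior to the closure. This excludes slits.\<close>

lemma lipschitz_domain_regular_open:
  assumes "lipschitz_domain \<Omega>"
  shows "interior (closure \<Omega>) = \<Omega>"
proof
  have op: "open \<Omega>" using assms unfolding lipschitz_domain_def by blast
  then show "\<Omega> \<subseteq> interior (closure \<Omega>)" by (simp add: closure_subset interior_maximal)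
  show "interior (closure \<Omega>) \<subseteq> \<Omega>"
  proof (rule ccontr)
    assume "\<not> ?thesis"
    then obtain p where p: "p \<in> interior (closure \<Omega>)" "p \<notin> \<Omega>" by blast
    have "p \<in> frontier \<Omega>" using p interior_subset by (auto simp: frontier_def interior_open[OF op])
    then obtain e r L \<gamma> where *: "norm e = 1" "0 < r" "L-lipschitz_on {y. y \<bullet> e = 0} \<gamma>"
        "\<Omega> \<inter> ball p r = {x \<in> ball p r. \<gamma> (x - (x \<bullet> e) *\<^sub>R e) < x \<bullet> e}"
      using assms unfolding lipschitz_domain_def by blast
    have ee: "e \<bullet> e = 1" using *(1) by (simp add: dot_square_norm)
    define P where "P x = x - (x \<bullet> e) *\<^sub>R e" for x
    have P0: "P x \<in> {y. y \<bullet> e = 0}" for x by (simp add: P_def inner_simps ee)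
    have cont: "continuous_on UNIV (\<lambda>x. \<gamma> (P x) - x \<bullet> e)"
    proof -
      have "continuous_on UNIV P" unfolding P_def by (intro continuous_intros)
      then have "continuous_on UNIV (\<lambda>x. \<gamma> (P x))"
        using continuous_on_compose2[OF lipschitz_on_continuous_on[OF *(3)]] P0 by blast
      then show ?thesis by (intro continuous_intros)
    qed
    have "\<gamma> (P p) - p \<bullet> e \<ge> 0" using *(4) p(2) *(2) unfolding P_def[symmetric] by force
    obtain s where s: "0 < s" "ball p s \<subseteq> closure \<Omega>" using p(1) by (meson mem_interior)
    define t where "t = min r s / 2"
    have t: "0 < t" "t < r" "t < s" using s *(2) by (auto simp: t_def)
    define x where "x = p - t *\<^sub>R e"
    have xp: "dist p x = t" using t *(1) by (simp add: x_def dist_norm)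
    have "P x = P p" by (simp add: P_def x_def inner_simps ee algebra_simps)
    moreover have "x \<bullet> e = p \<bullet> e - t" by (simp add: x_def inner_simps ee)
    ultimately have gx: "0 < \<gamma> (P x) - x \<bullet> e" using \<open>\<gamma> (P p) - p \<bullet> e \<ge> 0\<close> t(1) by simp
    have op': "open ({x. 0 < \<gamma> (P x) - x \<bullet> e} \<inter> ball p r)"
      by (intro open_Int open_ball open_Collect_less continuous_intros cont)
    have "({x. 0 < \<gamma> (P x) - x \<bullet> e} \<inter> ball p r) \<inter> \<Omega> = {}"
    proof -
      have "\<gamma> (P y) < y \<bullet> e" if "y \<in> \<Omega> \<inter> ball p r" for y
        using that unfolding *(4) P_def by simp
      then show ?thesis by force
    qed
    then have "({x. 0 < \<gamma> (P x) - x \<bullet> e} \<inter> ball p r) \<inter> closure \<Omega> = {}"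
      using op' open_Int_closure_eq_empty by blast
    moreover have "x \<in> {x. 0 < \<gamma> (P x) - x \<bullet> e} \<inter> ball p r" using gx xp t(2) by simp
    ultimately have "x \<notin> closure \<Omega>" by blast
    then show False using s(2) xp t(3) by auto
  qed
qed

locale mesh =
  fixes \<Omega> :: "(real ^ 'd) set" and \<T> :: "(real ^ 'd) set set"
  assumes lipschitz: "lipschitz_domain \<Omega>" and triang: "regular_triangulation \<Omega> \<T>"
begin

abbreviation \<mu> :: "(real ^ 'd) set \<Rightarrow> real" where "\<mu> T \<equiv> measure lebesgue T"

lemma open_domain: "open \<Omega>"
  using lipschitz unfolding lipschitz_domain_def by blast

lemma domain_measurable: "\<Omega> \<in> sets lebesgue"
  using open_domain by simp

lemma finite_mesh: "finite \<T>"
  and element: "T \<in> \<T> \<Longrightarrow> full_simplex T"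
  and Int_face: "T \<in> \<T> \<Longrightarrow> T' \<in> \<T> \<Longrightarrow> (T \<inter> T') face_of T"
  and Union_mesh: "\<Union>\<T> = closure \<Omega>"
  using triang unfolding regular_triangulation_def triangulation_def by auto

lemma measure_pos: "T \<in> \<T> \<Longrightarrow> 0 < measure lebesgue T"
  using simplex_facts(7) element by blast

lemma finite_verts: "T \<in> \<T> \<Longrightarrow> finite (verts T)"
  using full_simplex_verts(1) element by blast

lemma interior_element_subset: "T \<in> \<T> \<Longrightarrow> interior T \<subseteq> \<Omega>"
  using lipschitz_domain_regular_open[OF lipschitz] Union_mesh interior_mono by (metis Union_upper)

lemma barycenter_in_domain: "T \<in> \<T> \<Longrightarrow> barycenter T \<in> \<Omega>"
  using bary_barycenter(2)[OF element] interior_element_subset by blast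

text \<open>A face that meets the interior is the whole simplex. Overlap would thus make
  \<open>T\<close> a face of \<open>T'\<close>, a proper one as they differ, and such a face has no
  point in the interior of \<open>T'\<close>.\<close>

lemma interior_element_disjoint:
  assumes T: "T \<in> \<T>" "T' \<in> \<T>" "T \<noteq> T'"
  shows "interior T \<inter> T' = {}"
proof (rule ccontr)
  assume "interior T \<inter> T' \<noteq> {}"
  then have "T \<inter> T' = T"
    using face_of_disjoint_interior[OF Int_face[OF T(1,2)]] interior_subset by blast
  then have "T face_of T'" "T \<subseteq> T'" using Int_face[OF T(2,1)] by (simp_all add: Int_commute inf.absorb_iff1)
  then have "T \<inter> interior T' = {}" using face_of_disjoint_interior T(3) by blast
  moreover have "interior T \<subseteq> interior T'" using \<open>T \<subseteq> T'\<close> by (rule interior_mono)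
  ultimately show False using simplex_facts(4)[OF element[OF T(1)]] interior_subset by blast
qed

lemma skeleton_negligible: "negligible (\<Union>T\<in>\<T>. T - interior T)"
  using finite_mesh simplex_facts(5)[OF element] by (intro negligible_Union) auto

lemma elementwise_const_eq:
  assumes "T \<in> \<T>" "x \<in> interior T"
  shows "elementwise_const \<T> c x = c T"
proof -
  have "elementwise_const \<T> c x = (\<Sum>T'\<in>\<T>. if T' = T then c T else 0)"
    unfolding elementwise_const_def
  proof (rule sum.cong)
    fix T' assume "T' \<in> \<T>"
    then show "indicat_real (interior T') x *\<^sub>R c T' = (if T' = T then c T else 0)"
      using assms interior_element_disjoint[of T' T] interior_subset by (auto simp: indicator_def)
  qed simp
  then show ?thesis using assms finite_mesh by simp
qed

text \<open>The closed elements overlap in null sets only, so the sum of the continuous extensions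
  \<open>\<Phi> T\<close> agrees with \<open>F\<close> almost everywhere in the domain, whatever
  \<open>F\<close> is on the skeleton.\<close>

lemma integral_mesh:
  fixes F :: "real ^ 'd \<Rightarrow> 'b::euclidean_space"
  assumes F: "\<And>T x. T \<in> \<T> \<Longrightarrow> x \<in> interior T \<Longrightarrow> F x = \<Phi> T x"
    and \<Phi>: "\<And>T. T \<in> \<T> \<Longrightarrow> continuous_on T (\<Phi> T)"
  shows "integrable (lebesgue_on \<Omega>) F"
    "integral\<^sup>L (lebesgue_on \<Omega>) F = (\<Sum>T\<in>\<T>. integral\<^sup>L (lebesgue_on T) (\<Phi> T))"
proof -
  let ?N = "\<Union>T\<in>\<T>. T - interior T"
  let ?G = "\<lambda>x. \<Sum>T\<in>\<T>. indicator T x *\<^sub>R \<Phi> T x"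
  have Ts: "T \<in> sets lebesgue" if "T \<in> \<T>" for T
    using simplex_facts(6)[OF element[OF that]] by blast
  have i: "integrable lebesgue (\<lambda>x. indicator T x *\<^sub>R \<Phi> T x)" if "T \<in> \<T>" for T
    using integral_compact_lborel(1)[OF simplex_facts(1)[OF element[OF that]] \<Phi>[OF that]] Ts[OF that]
    by (simp add: integrable_restrict_space)
  have eq: "indicator \<Omega> x *\<^sub>R F x = ?G x" if x: "x \<notin> ?N" for x
  proof (cases "x \<in> \<Union>\<T>")
    case True
    then obtain T where T: "T \<in> \<T>" "x \<in> interior T" using x by blast
    have "?G x = (\<Sum>T'\<in>\<T>. if T' = T then \<Phi> T x else 0)"
    proof (rule sum.cong)
      fix T' assume "T' \<in> \<T>"
      then show "indicator T' x *\<^sub>R \<Phi> T' x = (if T' = T then \<Phi> T x else 0)"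
        using T interior_element_disjoint[of T T'] interior_subset by (auto simp: indicator_def)
    qed simp
    moreover have "x \<in> \<Omega>" using interior_element_subset T by blast
    ultimately show ?thesis using T finite_mesh F[OF T] by simp
  next
    case False
    then have "x \<notin> \<Omega>" unfolding Union_mesh using closure_subset by blast
    then show ?thesis using False by (auto simp: indicator_def intro!: sum.neutral)
  qed
  have iG: "integrable (lebesgue_on UNIV) ?G"
    by (simp only: lebesgue_on_UNIV_eq) (intro Bochner_Integration.integrable_sum i)
  have "AE x in lebesgue. indicator \<Omega> x *\<^sub>R F x = ?G x"
    using AE_notin_negligible[OF skeleton_negligible] by eventually_elim (rule eq)
  then have ae: "AE x in lebesgue_on UNIV. indicator \<Omega> x *\<^sub>R F x = ?G x"
    by (simp only: lebesgue_on_UNIV_eq)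
  note spike = integral_lebesgue_spike[OF _ iG ae, unfolded lebesgue_on_UNIV_eq]
  show "integrable (lebesgue_on \<Omega>) F"
    using spike(1) domain_measurable by (simp add: integrable_restrict_space)
  have "integral\<^sup>L (lebesgue_on \<Omega>) F = integral\<^sup>L lebesgue (\<lambda>x. indicator \<Omega> x *\<^sub>R F x)"
    using domain_measurable by (simp add: integral_restrict_space)
  also have "\<dots> = integral\<^sup>L lebesgue ?G" by (rule spike(2)) simp
  also have "\<dots> = (\<Sum>T\<in>\<T>. integral\<^sup>L lebesgue (\<lambda>x. indicator T x *\<^sub>R \<Phi> T x))"
    by (rule Bochner_Integration.integral_sum[OF i])
  also have "\<dots> = (\<Sum>T\<in>\<T>. integral\<^sup>L (lebesgue_on T) (\<Phi> T))"
    by (intro sum.cong refl) (use Ts in \<open>simp add: integral_restrict_space\<close>)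
  finally show "integral\<^sup>L (lebesgue_on \<Omega>) F = (\<Sum>T\<in>\<T>. integral\<^sup>L (lebesgue_on T) (\<Phi> T))" .
qed

lemma AE_mesh: "AE x in lebesgue_on \<Omega>. \<exists>T\<in>\<T>. x \<in> interior T"
proof -
  have "AE x in lebesgue. x \<notin> (\<Union>T\<in>\<T>. T - interior T)"
    by (rule AE_notin_negligible[OF skeleton_negligible])
  then have "AE x in lebesgue. x \<in> \<Omega> \<longrightarrow> (\<exists>T\<in>\<T>. x \<in> interior T)"
  proof eventually_elim
    case (elim x)
    have "x \<in> \<Omega> \<Longrightarrow> x \<in> \<Union>\<T>" unfolding Union_mesh using closure_subset by blast
    then show ?case using elim by blast
  qed
  then show ?thesis using domain_measurable by (subst AE_restrict_space_iff) auto
qed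

end

context mesh
begin

section \<open>Sides of the triangulation\<close>

text \<open>A face is coded by an element and the opposite vertex, so a side shared by two elements
  is represented twice; sums over \<open>vfaces\<close> run over one-sided fluxes.\<close>

definition vfaces :: "((real ^ 'd) set \<times> (real ^ 'd)) set" where
  "vfaces = (SIGMA T:\<T>. verts T)"

abbreviation side :: "(real ^ 'd) set \<times> (real ^ 'd) \<Rightarrow> (real ^ 'd) set" where
  "side p \<equiv> opp_face (fst p) (snd p)"

lemma finite_vfaces: "finite vfaces"
  unfolding vfaces_def using finite_mesh finite_verts by blast

lemma sides_eq: "sides \<T> = side ` vfaces"
proof (rule set_eqI)
  fix S
  have "S \<in> sides \<T> \<longleftrightarrow> (\<exists>T\<in>\<T>. \<exists>v\<in>verts T. S = opp_face T v)"
    unfolding sides_def mem_Collect_eq by (intro bex_cong refl facet_of_simplex element)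
  also have "\<dots> \<longleftrightarrow> S \<in> side ` vfaces" by (auto simp: vfaces_def image_iff Bex_def)
  finally show "S \<in> sides \<T> \<longleftrightarrow> S \<in> side ` vfaces" .
qed

lemma sideE:
  assumes "S \<in> sides \<T>"
  obtains T v where "T \<in> \<T>" "v \<in> verts T" "S = opp_face T v"
  using assms unfolding sides_eq vfaces_def by auto

lemma opp_face_in_sides: "T \<in> \<T> \<Longrightarrow> v \<in> verts T \<Longrightarrow> opp_face T v \<in> sides \<T>"
  unfolding sides_eq vfaces_def by force

lemma side_subset_closure:
  assumes "T \<in> \<T>" "v \<in> verts T"
  shows "opp_face T v \<subseteq> closure \<Omega>"
  using opp_face_subset[OF element] assms Union_mesh by blast

text \<open>The hypothesis says that \<open>x\<close> lies in the relative interior of the face.\<close>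

lemma face_of_neighbour:
  assumes T: "T \<in> \<T>" "v \<in> verts T" and T': "T' \<in> \<T>" "T' \<noteq> T"
    and x: "x \<in> opp_face T v" "\<And>w. w \<in> verts T \<Longrightarrow> w \<noteq> v \<Longrightarrow> 0 < bary T w x" "x \<in> T'"
  shows "\<exists>v'\<in>verts T'. opp_face T v = opp_face T' v'"
proof -
  note fs = element[OF T(1)] and fs' = element[OF T'(1)]
  note V = full_simplex_verts[OF fs]
  have F: "(T \<inter> T') face_of T" "(T' \<inter> T) face_of T'" using Int_face T(1) T'(1) by auto
  obtain c where c: "c \<subseteq> verts T" "T \<inter> T' = convex hull c"
    using F(1) face_of_convex_hull_affine_independent[OF V(3)] V(4) by metis
  have finc: "finite c" using c(1) V(1) finite_subset by blast
  have xc: "x \<in> convex hull c" using x(1,3) opp_face_subset[OF fs T(2)] c(2) by blast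
  \<comment> \<open>A vertex \<open>w \<noteq> v\<close> missing from \<open>c\<close> would put
    \<open>x\<close> on the face opposite to \<open>w\<close>, where its coordinate is 0.\<close>
  have sub: "verts T - {v} \<subseteq> c"
  proof
    fix w assume w: "w \<in> verts T - {v}"
    show "w \<in> c"
    proof (rule ccontr)
      assume "w \<notin> c"
      then have "convex hull c \<subseteq> opp_face T w" unfolding opp_face_def using c(1) by (intro hull_mono) auto
      then have "bary T w x = 0" using xc opp_face_iff[OF fs, of w] w by blast
      then show False using x(2)[of w] w by simp
    qed
  qed
  have "v \<notin> c"
  proof
    assume "v \<in> c"
    then have "c = verts T" using sub c(1) by blast
    then have "T \<inter> T' = T" using c(2) V(4) by simp
    then have "interior T \<inter> T' \<noteq> {}" using simplex_facts(4)[OF fs] interior_subset by blast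
    then show False using interior_element_disjoint T(1) T' by metis
  qed
  then have "c = verts T - {v}" using sub c(1) by blast
  then have S: "T \<inter> T' = opp_face T v" using c(2) by (simp add: opp_face_def)
  have "opp_face T v facet_of T" using facet_of_simplex[OF fs] T(2) by blast
  then have "opp_face T v \<noteq> {}" "aff_dim (opp_face T v) = aff_dim T - 1" by (auto simp: facet_of_def)
  moreover have "aff_dim T = aff_dim T'" using fs fs' aff_dim_simplex by metis
  moreover have "opp_face T v face_of T'" using F(2) S by (simp add: Int_commute)
  ultimately have "opp_face T v facet_of T'" by (simp add: facet_of_def)
  then show ?thesis using facet_of_simplex[OF fs'] by blast
qed

lemma barycenter_face_of_neighbour:
  assumes T: "T \<in> \<T>" "v \<in> verts T" and T': "T' \<in> \<T>" "barycenter (opp_face T v) \<in> T'"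
  shows "\<exists>v'\<in>verts T'. opp_face T v = opp_face T' v'"
proof (cases "T' = T")
  case False
  note fs = element[OF T(1)]
  show ?thesis
    by (rule face_of_neighbour[OF T T'(1) False barycenter_opp_face[OF fs T(2)] _ T'(2)])
      (simp add: bary_barycenter_face[OF fs T(2)])
qed (use T in blast)

text \<open>Lets one side be isolated: a neighbourhood of its barycenter can avoid all the other,
  closed, sides.\<close>

lemma barycenter_other_side:
  assumes "S \<in> sides \<T>" "S' \<in> sides \<T>" "barycenter S \<in> S'"
  shows "S' = S"
proof -
  obtain T v T' w where T: "T \<in> \<T>" "v \<in> verts T" "S = opp_face T v"
    and T': "T' \<in> \<T>" "w \<in> verts T'" "S' = opp_face T' w"
    using assms(1,2) unfolding sides_eq vfaces_def by auto
  have b: "barycenter S \<in> T'" "bary T' w (barycenter S) = 0"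
    using assms(3) opp_face_iff[OF element[OF T'(1)] T'(2)] T'(3) by auto
  then obtain v' where v': "v' \<in> verts T'" "S = opp_face T' v'"
    using barycenter_face_of_neighbour[OF T(1,2) T'(1)] T(3) by auto
  then have "w = v'" using bary_barycenter_face[OF element[OF T'(1)] v'(1) T'(2)] b(2)
    by (auto split: if_splits)
  then show ?thesis using v' T' by simp
qed

lemma closed_side: "S \<in> sides \<T> \<Longrightarrow> closed S"
  unfolding sides_eq opp_face_def using finite_verts
  by (auto simp: vfaces_def finite_imp_compact_convex_hull intro!: compact_imp_closed)

text \<open>Two elements on the same side of a common face would overlap, so they lie on opposite
  sides and cover a neighbourhood of its barycenter.\<close>

lemma shared_side_interior:
  assumes T: "T \<in> \<T>" "v \<in> verts T" and T': "T' \<in> \<T>" "v' \<in> verts T'"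
    and S: "opp_face T v = opp_face T' v'" and ne: "T \<noteq> T'"
  shows "barycenter (opp_face T v) \<in> \<Omega>"
proof -
  note fs = element[OF T(1)] and fs' = element[OF T'(1)]
  note V = full_simplex_verts[OF fs] and V' = full_simplex_verts[OF fs']
  define x0 where "x0 = barycenter (opp_face T v)"
  have x0: "x0 \<in> opp_face T v" using barycenter_opp_face[OF fs T(2)] by (simp add: x0_def)
  then have x0T': "x0 \<in> T'" using S opp_face_subset[OF fs' T'(2)] by blast
  have b: "bary T w x0 = (if w = v then 0 else 1 / DIM(real ^ 'd))" if "w \<in> verts T" for w
    using bary_barycenter_face[OF fs T(2) that] by (simp add: x0_def)
  have b': "bary T' w x0 = (if w = v' then 0 else 1 / DIM(real ^ 'd))" if "w \<in> verts T'" for w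
    using bary_barycenter_face[OF fs' T'(2) that] by (simp add: x0_def S)
  have vv: "verts T - {v} = verts T' - {v'}"
    using verts_opp_face[OF fs T(2)] verts_opp_face[OF fs' T'(2)] S by simp
  \<comment> \<open>Both \<open>bary T v\<close> and \<open>bary T' v'\<close> are affine and vanish
    at the common vertices, so they are proportional; the sign of the factor tells on which side
    \<open>T'\<close> lies.\<close>
  define k where "k = bary T v v'"
  have bv: "bary T v x = bary T' v' x * k" for x
  proof -
    have "bary T v x = bary T v (\<Sum>w\<in>verts T'. bary T' w x *\<^sub>R w)"
      by (simp add: bary_sum(2)[OF fs'])
    also have "\<dots> = (\<Sum>w\<in>verts T'. bary T' w x * bary T v w)"
      by (rule bary_affine_comb[OF bary_sum(1)[OF fs']])
    also have "\<dots> = (\<Sum>w\<in>verts T'. if w = v' then bary T' w x * k else 0)"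
    proof (rule sum.cong)
      fix w assume "w \<in> verts T'"
      moreover have "w \<in> verts T - {v}" if "w \<noteq> v'" using that \<open>w \<in> verts T'\<close> vv by blast
      ultimately show "bary T' w x * bary T v w = (if w = v' then bary T' w x * k else 0)"
        using bary_vertex[OF fs T(2), of w] by (auto simp: k_def)
    qed simp
    finally show ?thesis using T'(2) V'(1) by simp
  qed
  \<comment> \<open>In \<open>?W\<close> all coordinates except those at \<open>v\<close> and
    \<open>v'\<close> are positive, so one sign each decides membership in \<open>T\<close> and in
    \<open>T'\<close>.\<close>
  let ?W = "{x. \<forall>w\<in>verts T - {v}. 0 < bary T w x} \<inter> {x. \<forall>w\<in>verts T' - {v'}. 0 < bary T' w x}"
  have op: "open {x. \<forall>w\<in>A. 0 < bary K w x}" if "finite A" for A and K :: "(real ^ 'd) set"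
  proof -
    have "{x. \<forall>w\<in>A. 0 < bary K w x} = (\<Inter>w\<in>A. {x. 0 < bary K w x})" by auto
    then show ?thesis using that by (auto intro!: open_INT open_Collect_less continuous_intros)
  qed
  have W: "open ?W" using V(1) V'(1) by (intro open_Int op) auto
  have x0W: "x0 \<in> ?W" using b b' by (simp add: zero_less_divide_iff)
  have "k < 0"
  proof (rule ccontr)
    assume "\<not> k < 0"
    moreover have "k \<noteq> 0"
    proof
      assume "k = 0"
      then have "bary T v v = 0" using bv by simp
      then show False using bary_vertex[OF fs T(2) T(2)] by simp
    qed
    ultimately have k: "0 < k" by simp
    obtain e where e: "0 < e" "ball x0 e \<subseteq> ?W" using W x0W openE by blast
    have "x0 \<in> closure (interior T')" using x0T' simplex_facts(8)[OF fs'] by simp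
    then obtain p where p: "p \<in> interior T'" "dist p x0 < e" using e(1) closure_approachable by blast
    then have "p \<in> ball x0 e" by (simp add: dist_commute)
    then have "p \<in> ?W" using e(2) by blast
    moreover have "0 < bary T v p" using bv[of p] k p(1) simplex_bary(2)[OF fs'] T'(2) by simp
    ultimately have "p \<in> interior T" using simplex_bary(2)[OF fs] by auto
    then show False using interior_element_disjoint[OF T(1) T'(1) ne] p(1) interior_subset by blast
  qed
  have "?W \<subseteq> T \<union> T'"
  proof
    fix x assume x: "x \<in> ?W"
    show "x \<in> T \<union> T'"
    proof (cases "0 \<le> bary T v x")
      case True
      then have "\<forall>w\<in>verts T. 0 \<le> bary T w x" using x less_imp_le by (metis (no_types, lifting) DiffI IntD1 mem_Collect_eq singletonD)
      then show ?thesis using simplex_bary(1)[OF fs] by blast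
    next
      case False
      then have "0 \<le> bary T' v' x" using bv[of x] \<open>k < 0\<close> by (simp add: not_le mult_less_0_iff)
      then have "\<forall>w\<in>verts T'. 0 \<le> bary T' w x" using x less_imp_le by (metis (no_types, lifting) DiffI IntD2 mem_Collect_eq singletonD)
      then show ?thesis using simplex_bary(1)[OF fs'] by blast
    qed
  qed
  also have "\<dots> \<subseteq> closure \<Omega>" using T(1) T'(1) Union_mesh by blast
  finally have "x0 \<in> interior (closure \<Omega>)" using W x0W interiorI by blast
  then show ?thesis using lipschitz_domain_regular_open[OF lipschitz] by (simp add: x0_def)
qed

lemma boundary_side_unique:
  assumes T: "T \<in> \<T>" "v \<in> verts T" and T': "T' \<in> \<T>" "v' \<in> verts T'"
    and S: "opp_face T v = opp_face T' v'" and out: "barycenter (opp_face T v) \<notin> \<Omega>"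
  shows "T' = T \<and> v' = v"
proof -
  have "T' = T" using shared_side_interior[OF T T' S] out by blast
  moreover have "v' = v" using opp_face_inj[OF element[OF T(1)] T(2)] T'(2) S calculation by metis
  ultimately show ?thesis by simp
qed

text \<open>A point of the side in \<open>\<Omega>\<close> could be moved towards the barycenter
  into the relative interior, still in \<open>\<Omega>\<close>. No second element contains the moved
  point, since that element would share the whole side and make the barycenter interior. So
  \<open>T\<close> alone fills a neighbourhood of it, although its coordinate at \<open>v\<close> is
  0.\<close>

lemma side_subset_frontier:
  assumes T: "T \<in> \<T>" "v \<in> verts T" and out: "barycenter (opp_face T v) \<notin> \<Omega>"
  shows "opp_face T v \<subseteq> frontier \<Omega>"
proof
  note fs = element[OF T(1)]
  note V = full_simplex_verts[OF fs]
  define x0 where "x0 = barycenter (opp_face T v)"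
  have b: "bary T w x0 = (if w = v then 0 else 1 / DIM(real ^ 'd))" if "w \<in> verts T" for w
    using bary_barycenter_face[OF fs T(2) that] by (simp add: x0_def)
  have x0T: "x0 \<in> T" using barycenter_opp_face[OF fs T(2)] opp_face_subset[OF fs T(2)] by (auto simp: x0_def)
  fix x assume x: "x \<in> opp_face T v"
  then have xT: "x \<in> T" "bary T v x = 0" using opp_face_iff[OF fs T(2)] by auto
  have "x \<notin> \<Omega>"
  proof
    assume "x \<in> \<Omega>"
    then obtain e where e: "0 < e" "ball x e \<subseteq> \<Omega>" using open_domain openE by blast
    obtain s where s: "0 < s" "s \<le> 1" "s * norm (x0 - x) < e"
    proof
      show "0 < min 1 (e / (2 * (norm (x0 - x) + 1)))" using e(1) by (simp add: add_nonneg_pos)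
      have "min 1 (e / (2 * (norm (x0 - x) + 1))) * norm (x0 - x) \<le> (e / (2 * (norm (x0 - x) + 1))) * (norm (x0 - x) + 1)"
        using e(1) by (intro mult_mono) auto
      also have "\<dots> = e / 2" by (simp add: field_simps add_nonneg_eq_0_iff)
      finally show "min 1 (e / (2 * (norm (x0 - x) + 1))) * norm (x0 - x) < e" using e(1) by simp
    qed simp
    define p where "p = x + s *\<^sub>R (x0 - x)"
    have p\<Omega>: "p \<in> \<Omega>" using e(2) s by (auto simp: p_def dist_norm)
    have bp: "bary T w p = (1 - s) * bary T w x + s * bary T w x0" for w
      by (simp add: p_def bary_def inner_simps algebra_simps)
    have bx: "0 \<le> bary T w x" if "w \<in> verts T" for w using simplex_bary(1)[OF fs] xT(1) that by blast
    have pv: "bary T v p = 0" using bp xT(2) b[OF T(2)] by simp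
    have pw: "0 < bary T w p" if w: "w \<in> verts T" "w \<noteq> v" for w
      using bp[of w] b[OF w(1)] w(2) bx[OF w(1)] s(1,2)
      by (simp add: add_nonneg_pos)
    have pS: "p \<in> opp_face T v"
      using opp_face_iff[OF fs T(2)] simplex_bary(1)[OF fs] pv pw by (metis less_imp_le order_refl)
    have only: "T' = T" if T': "T' \<in> \<T>" "p \<in> T'" for T'
    proof (rule ccontr)
      assume ne: "T' \<noteq> T"
      obtain v' where "v' \<in> verts T'" "opp_face T v = opp_face T' v'"
        using face_of_neighbour[OF T T'(1) ne pS pw T'(2)] by blast
      then show False using shared_side_interior[OF T T'(1)] ne out by metis
    qed
    let ?R = "\<Union>(\<T> - {T})"
    have "closed ?R" using finite_mesh simplex_facts(3)[OF element] by (intro closed_Union) auto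
    then have "open (\<Omega> - ?R)" using open_domain by (rule open_Diff[rotated])
    moreover have "\<Omega> - ?R \<subseteq> T" using closure_subset[of \<Omega>] Union_mesh by blast
    moreover have "p \<in> \<Omega> - ?R" using p\<Omega> only by blast
    ultimately have "p \<in> interior T" using interiorI by blast
    then show False using simplex_bary(2)[OF fs] pv T(2) by force
  qed
  moreover have "x \<in> closure \<Omega>" using side_subset_closure[OF T] x by blast
  ultimately show "x \<in> frontier \<Omega>" by (simp add: frontier_def interior_open[OF open_domain])
qed

lemma boundary_side_iff:
  assumes T: "T \<in> \<T>" "v \<in> verts T"
  shows "opp_face T v \<in> boundary_sides \<Omega> \<T> \<longleftrightarrow> barycenter (opp_face T v) \<notin> \<Omega>"
proof -
  have "\<Omega> \<inter> frontier \<Omega> = {}" using open_domain by (simp add: frontier_def interior_open)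
  moreover have "barycenter (opp_face T v) \<in> opp_face T v"
    using barycenter_opp_face[OF element[OF T(1)] T(2)] .
  ultimately show ?thesis
    using side_subset_frontier[OF T] opp_face_in_sides[OF T] unfolding boundary_sides_def by blast
qed

section \<open>Raviart--Thomas fields\<close>

text \<open>The coefficient of \<open>x - v\<close> when
  \<open>a + b *\<^sub>R (x - barycenter T)\<close> is expanded in the fields \<open>x - v\<close>:
  \<open>b\<close> is shared equally by the \<open>d + 1\<close> vertices, and
  \<open>- bary_grad T v \<bullet> a\<close> produces the constant part by
  \<open>bary_grad_sum\<close>.\<close>

definition rt_coef :: "(real ^ 'd) set \<Rightarrow> real ^ 'd \<Rightarrow> real \<Rightarrow> real ^ 'd \<Rightarrow> real" where
  "rt_coef T a b v = b / (real CARD('d) + 1) - bary_grad T v \<bullet> a"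

lemma rt_coef:
  assumes T: "full_simplex T"
  shows "(\<Sum>v\<in>verts T. rt_coef T a b v) = b"
    "(\<Sum>v\<in>verts T. rt_coef T a b v *\<^sub>R (x - v)) = a + b *\<^sub>R (x - barycenter T)"
proof -
  have card: "card (verts T) = Suc CARD('d)" using full_simplex_verts(2)[OF T] by simp
  show s: "(\<Sum>v\<in>verts T. rt_coef T a b v) = b"
    using bary_grad_sum(1)[OF T] by (simp add: rt_coef_def sum_subtractf card flip: inner_sum_left) (simp add: field_simps)
  have "(\<Sum>v\<in>verts T. (b / (real CARD('d) + 1)) *\<^sub>R v) = b *\<^sub>R (\<Sum>v\<in>verts T. bary T v (barycenter T) *\<^sub>R v)"
    by (auto simp: scaleR_sum_right bary_barycenter(1)[OF T] intro!: sum.cong)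
  then have "(\<Sum>v\<in>verts T. (b / (real CARD('d) + 1)) *\<^sub>R v) = b *\<^sub>R barycenter T"
    by (simp add: bary_sum(2)[OF T])
  then have "(\<Sum>v\<in>verts T. rt_coef T a b v *\<^sub>R v) = b *\<^sub>R barycenter T - a"
    using bary_grad_sum(2)[OF T, of a] by (simp add: rt_coef_def scaleR_diff_left sum_subtractf)
  moreover have "(\<Sum>v\<in>verts T. rt_coef T a b v *\<^sub>R (x - v)) = b *\<^sub>R x - (\<Sum>v\<in>verts T. rt_coef T a b v *\<^sub>R v)"
    by (simp add: scaleR_diff_right sum_subtractf s flip: scaleR_sum_left)
  ultimately show "(\<Sum>v\<in>verts T. rt_coef T a b v *\<^sub>R (x - v)) = a + b *\<^sub>R (x - barycenter T)"
    by (simp only:) (simp add: algebra_simps)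
qed

text \<open>The left integrand is the divergence of \<open>f\<close> times the field, as
  \<open>a + b *\<^sub>R (x - barycenter T)\<close> has divergence \<open>d * b\<close>.\<close>

lemma local_integration_by_parts:
  assumes T: "full_simplex T" and f: "\<And>x. GDERIV f x :> g x" and g: "continuous_on UNIV g"
  shows "(\<integral>x. (a + b *\<^sub>R (x - barycenter T)) \<bullet> g x + real CARD('d) * b * f x \<partial>lebesgue_on T)
       = (\<Sum>v\<in>verts T. rt_coef T a b v * face_flux T v f g)"
proof -
  have fc: "continuous_on A f" for A by (rule continuous_on_GDERIV[OF f])
  have gc: "continuous_on A g" for A using g continuous_on_subset by blast
  have "(a + b *\<^sub>R (x - barycenter T)) \<bullet> g x + real CARD('d) * b * f x
      = (\<Sum>v\<in>verts T. rt_coef T a b v * (DIM(real ^ 'd) * f x + g x \<bullet> (x - v)))" for x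
  proof -
    have "(\<Sum>v\<in>verts T. rt_coef T a b v * (DIM(real ^ 'd) * f x + g x \<bullet> (x - v)))
        = (\<Sum>v\<in>verts T. rt_coef T a b v) * (real CARD('d) * f x) + (\<Sum>v\<in>verts T. rt_coef T a b v *\<^sub>R (x - v)) \<bullet> g x"
      by (simp add: sum_distrib_right inner_sum_left distrib_left sum.distrib inner_commute[of "g x"])
    then show ?thesis unfolding rt_coef[OF T] by simp
  qed
  then show ?thesis unfolding face_flux_def
    by (simp only:) (subst Bochner_Integration.integral_sum,
      auto intro!: integral_compact_lborel(1) simplex_facts(1)[OF T] continuous_intros fc gc)
qed

text \<open>The sum of the outward normal fluxes through \<open>S\<close> from the elements adjacent to \<open>S\<close>, up to a
  constant factor.\<close>

definition flux_jump :: "((real ^ 'd) set \<Rightarrow> real ^ 'd) \<Rightarrow> ((real ^ 'd) set \<Rightarrow> real) \<Rightarrow> (real ^ 'd) set \<Rightarrow> real" where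
  "flux_jump a b S = (\<Sum>(T, v) \<in> {p \<in> vfaces. side p = S}. \<mu> T * rt_coef T (a T) (b T) v)"

text \<open>\<open>\<kappa>\<close> depends on the side only, so regrouping the pairs by side leaves
  the flux jump as its factor. Test functions supply \<open>side_mean\<close> for
  \<open>\<kappa>\<close>, affine functions \<open>d\<close> times the barycenter value.\<close>

lemma sum_by_sides:
  assumes k: "\<And>T v. T \<in> \<T> \<Longrightarrow> v \<in> verts T \<Longrightarrow> K T v = \<mu> T * \<kappa> (opp_face T v)"
  shows "(\<Sum>T\<in>\<T>. \<Sum>v\<in>verts T. rt_coef T (a T) (b T) v * K T v) = (\<Sum>S\<in>sides \<T>. \<kappa> S * flux_jump a b S)"
proof -
  have "(\<Sum>T\<in>\<T>. \<Sum>v\<in>verts T. rt_coef T (a T) (b T) v * K T v)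
      = (\<Sum>(T, v)\<in>vfaces. rt_coef T (a T) (b T) v * K T v)"
    unfolding vfaces_def using finite_mesh finite_verts by (intro sum.Sigma) auto
  also have "\<dots> = (\<Sum>S\<in>sides \<T>. \<Sum>(T, v) \<in> {p \<in> vfaces. side p = S}. rt_coef T (a T) (b T) v * K T v)"
    unfolding sides_eq by (rule sum.image_gen[OF finite_vfaces])
  also have "\<dots> = (\<Sum>S\<in>sides \<T>. \<kappa> S * flux_jump a b S)"
    unfolding flux_jump_def sum_distrib_left
    by (intro sum.cong refl) (auto simp: k vfaces_def)
  finally show ?thesis .
qed

lemma flux_jump_boundary:
  assumes T: "T \<in> \<T>" "v \<in> verts T" and out: "barycenter (opp_face T v) \<notin> \<Omega>"
  shows "flux_jump a b (opp_face T v) = \<mu> T * rt_coef T (a T) (b T) v"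
proof -
  have "{p \<in> vfaces. side p = opp_face T v} = {(T, v)}"
  proof (intro equalityI subsetI)
    fix p assume "p \<in> {p \<in> vfaces. side p = opp_face T v}"
    then have "fst p \<in> \<T>" "snd p \<in> verts (fst p)" "opp_face T v = side p" by (auto simp: vfaces_def)
    from boundary_side_unique[OF T this out] show "p \<in> {(T, v)}" by (simp add: prod_eq_iff)
  qed (use T in \<open>auto simp: vfaces_def\<close>)
  then show ?thesis by (simp add: flux_jump_def)
qed

text \<open>This is \<open>d\<close> times the mean of \<open>f\<close> over \<open>S\<close>,
  computed from an arbitrary adjacent element; \<open>face_flux_common_face\<close> makes it
  independent of the choice.\<close>

definition side_mean :: "(real ^ 'd \<Rightarrow> real) \<Rightarrow> (real ^ 'd \<Rightarrow> real ^ 'd) \<Rightarrow> (real ^ 'd) set \<Rightarrow> real" where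
  "side_mean f g S = (let (T, v) = SOME p. p \<in> vfaces \<and> side p = S in face_flux T v f g / \<mu> T)"

lemma face_flux_side_mean:
  assumes T: "T \<in> \<T>" "v \<in> verts T" and f: "\<And>x. GDERIV f x :> g x" and g: "continuous_on UNIV g"
  shows "face_flux T v f g = \<mu> T * side_mean f g (opp_face T v)"
proof -
  define p where "p = (SOME p. p \<in> vfaces \<and> side p = opp_face T v)"
  have "\<exists>p. p \<in> vfaces \<and> side p = opp_face T v"
    using T by (intro exI[of _ "(T, v)"]) (auto simp: vfaces_def)
  from someI_ex[OF this] have p: "p \<in> vfaces" "side p = opp_face T v" unfolding p_def by blast+
  have fp: "fst p \<in> \<T>" "snd p \<in> verts (fst p)" using p(1) by (auto simp: vfaces_def)
  have "side_mean f g (opp_face T v) = face_flux (fst p) (snd p) f g / \<mu> (fst p)"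
    unfolding side_mean_def p_def[symmetric] by (simp add: case_prod_beta)
  moreover have "\<mu> T * face_flux (fst p) (snd p) f g = \<mu> (fst p) * face_flux T v f g"
    by (rule face_flux_common_face[OF element[OF T(1)] T(2) element[OF fp(1)] fp(2) p(2)[symmetric] f g])
  ultimately have "\<mu> (fst p) * (\<mu> T * side_mean f g (opp_face T v))
      = \<mu> (fst p) * face_flux T v f g"
    using measure_pos[OF fp(1)] by simp
  then show ?thesis using measure_pos[OF fp(1)] by simp
qed

section \<open>Weak divergence of piecewise Raviart--Thomas fields\<close>

definition is_RT :: "(real ^ 'd \<Rightarrow> real ^ 'd) \<Rightarrow> ((real ^ 'd) set \<Rightarrow> real ^ 'd) \<Rightarrow> ((real ^ 'd) set \<Rightarrow> real) \<Rightarrow> bool" where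
  "is_RT y a b \<longleftrightarrow> (\<forall>T\<in>\<T>. \<forall>x\<in>interior T. y x = a T + b T *\<^sub>R (x - barycenter T))"

definition div_h :: "((real ^ 'd) set \<Rightarrow> real) \<Rightarrow> real ^ 'd \<Rightarrow> real" where
  "div_h b = elementwise_const \<T> (\<lambda>T. real CARD('d) * b T)"

lemma integrable_div_h: "integrable (lebesgue_on \<Omega>) (div_h b)"
  unfolding div_h_def
  by (rule integral_mesh(1)[where \<Phi>="\<lambda>T x. real CARD('d) * b T"]) (auto simp: elementwise_const_eq)

lemma integrable_is_RT: "is_RT y a b \<Longrightarrow> integrable (lebesgue_on \<Omega>) y"
  unfolding is_RT_def
  by (rule integral_mesh(1)[where \<Phi>="\<lambda>T x. a T + b T *\<^sub>R (x - barycenter T)"]) (auto intro!: continuous_intros)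

lemma integral_RT_test:
  assumes y: "is_RT y a b" and \<eta>: "\<eta> \<in> test_functions U"
  shows "integrable (lebesgue_on \<Omega>) (\<lambda>x. y x \<bullet> gradient \<eta> x)"
    "integrable (lebesgue_on \<Omega>) (\<lambda>x. div_h b x * \<eta> x)"
    "(\<integral>x. y x \<bullet> gradient \<eta> x \<partial>lebesgue_on \<Omega>) + (\<integral>x. div_h b x * \<eta> x \<partial>lebesgue_on \<Omega>)
     = (\<Sum>S\<in>sides \<T>. side_mean \<eta> (gradient \<eta>) S * flux_jump a b S)"
proof -
  note C1 = test_function_C1[OF \<eta>]
  have c: "continuous_on A \<eta>" for A by (rule continuous_on_GDERIV[OF C1(1)])
  show i: "integrable (lebesgue_on \<Omega>) (\<lambda>x. y x \<bullet> gradient \<eta> x)"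
    by (rule integral_mesh(1)[where \<Phi>="\<lambda>T x. (a T + b T *\<^sub>R (x - barycenter T)) \<bullet> gradient \<eta> x"])
      (use y in \<open>auto simp: is_RT_def intro!: continuous_intros C1\<close>)
  show i': "integrable (lebesgue_on \<Omega>) (\<lambda>x. div_h b x * \<eta> x)"
    by (rule integral_mesh(1)[where \<Phi>="\<lambda>T x. real CARD('d) * b T * \<eta> x"])
      (auto simp: elementwise_const_eq div_h_def intro!: continuous_intros c)
  have "(\<integral>x. y x \<bullet> gradient \<eta> x \<partial>lebesgue_on \<Omega>) + (\<integral>x. div_h b x * \<eta> x \<partial>lebesgue_on \<Omega>)
      = (\<integral>x. y x \<bullet> gradient \<eta> x + div_h b x * \<eta> x \<partial>lebesgue_on \<Omega>)"
    by (rule Bochner_Integration.integral_add[OF i i', symmetric])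
  also have "\<dots> = (\<Sum>T\<in>\<T>. \<integral>x. (a T + b T *\<^sub>R (x - barycenter T)) \<bullet> gradient \<eta> x + real CARD('d) * b T * \<eta> x \<partial>lebesgue_on T)"
    by (rule integral_mesh(2)) (use y in \<open>auto simp: is_RT_def elementwise_const_eq div_h_def intro!: continuous_intros C1 c\<close>)
  also have "\<dots> = (\<Sum>T\<in>\<T>. \<Sum>v\<in>verts T. rt_coef T (a T) (b T) v * face_flux T v \<eta> (gradient \<eta>))"
    by (intro sum.cong refl local_integration_by_parts element C1)
  also have "\<dots> = (\<Sum>S\<in>sides \<T>. side_mean \<eta> (gradient \<eta>) S * flux_jump a b S)"
    by (rule sum_by_sides) (rule face_flux_side_mean[OF _ _ C1])
  finally show "(\<integral>x. y x \<bullet> gradient \<eta> x \<partial>lebesgue_on \<Omega>) + (\<integral>x. div_h b x * \<eta> x \<partial>lebesgue_on \<Omega>)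
     = (\<Sum>S\<in>sides \<T>. side_mean \<eta> (gradient \<eta>) S * flux_jump a b S)" .
qed

lemma side_mean_eq_0:
  assumes S: "S \<in> sides \<T>" and \<eta>: "\<eta> \<in> test_functions U" "\<And>x. x \<in> S \<Longrightarrow> \<eta> x = 0"
  shows "side_mean \<eta> (gradient \<eta>) S = 0"
proof -
  obtain T v where T: "T \<in> \<T>" "v \<in> verts T" "S = opp_face T v" using sideE[OF S] by blast
  have "face_flux T v \<eta> (gradient \<eta>) = 0"
    by (rule face_flux_eq_0[OF element[OF T(1)] T(2) test_function_C1[OF \<eta>(1)]]) (use \<eta>(2) T(3) in simp)
  then show ?thesis using face_flux_side_mean[OF T(1,2) test_function_C1[OF \<eta>(1)]] measure_pos[OF T(1)] T(3) by simp
qed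

text \<open>Test functions vanish on boundary sides and the jump vanishes on the others, so no side
  contributes to the integration by parts.\<close>

lemma has_weak_div_RT:
  assumes y: "is_RT y a b" and j: "\<And>S. S \<in> sides \<T> \<Longrightarrow> barycenter S \<in> \<Omega> \<Longrightarrow> flux_jump a b S = 0"
  shows "has_weak_div \<Omega> y (div_h b)"
  unfolding has_weak_div_def
proof (intro conjI ballI integrable_div_h)
  fix \<eta> assume \<eta>: "\<eta> \<in> test_functions \<Omega>"
  have "side_mean \<eta> (gradient \<eta>) S * flux_jump a b S = 0" if S: "S \<in> sides \<T>" for S
  proof (cases "barycenter S \<in> \<Omega>")
    case False
    obtain T v where T: "T \<in> \<T>" "v \<in> verts T" "S = opp_face T v" using sideE[OF S] by blast
    have "S \<inter> \<Omega> = {}"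
      using side_subset_frontier[OF T(1,2)] False T(3) by (auto simp: frontier_def interior_open[OF open_domain])
    then have "side_mean \<eta> (gradient \<eta>) S = 0"
      using test_function_eq_0[OF \<eta>] by (intro side_mean_eq_0[OF S \<eta>]) blast
    then show ?thesis by simp
  qed (simp add: j[OF S])
  then have "(\<Sum>S\<in>sides \<T>. side_mean \<eta> (gradient \<eta>) S * flux_jump a b S) = 0" by (rule sum.neutral[rule_format])
  then show "(\<integral>x. y x \<bullet> gradient \<eta> x \<partial>lebesgue_on \<Omega>) = - (\<integral>x. div_h b x * \<eta> x \<partial>lebesgue_on \<Omega>)"
    using integral_RT_test(3)[OF y \<eta>] by linarith
qed

text \<open>For test functions supported in the interior of one element the side terms disappear, so
  any weak divergence must equal the elementwise one. This fixes the arbitrary choice in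
  \<open>weak_div\<close> up to a null set.\<close>

lemma weak_div_RT_unique:
  assumes y: "is_RT y a b" and g: "has_weak_div \<Omega> y g"
  shows "AE x in lebesgue_on \<Omega>. g x = div_h b x"
proof -
  have gi: "integrable (lebesgue_on \<Omega>) g" using g unfolding has_weak_div_def by blast
  have neg: "negligible {x \<in> interior T. g x - div_h b x \<noteq> 0}" if T: "T \<in> \<T>" for T
  proof (rule AE_0_of_test_functions[OF domain_measurable open_interior interior_element_subset[OF T]])
    show "integrable (lebesgue_on \<Omega>) (\<lambda>x. g x - div_h b x)"
      using gi integrable_div_h by (rule Bochner_Integration.integrable_diff)
    fix \<eta> assume \<eta>: "\<eta> \<in> test_functions (interior T)"
    then have \<eta>\<Omega>: "\<eta> \<in> test_functions \<Omega>" using test_functions_mono[OF interior_element_subset[OF T]] by blast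
    have "side_mean \<eta> (gradient \<eta>) S = 0" if S: "S \<in> sides \<T>" for S
    proof (rule side_mean_eq_0[OF S \<eta>])
      fix x assume x: "x \<in> S"
      obtain T' v where T': "T' \<in> \<T>" "v \<in> verts T'" "S = opp_face T' v" using sideE[OF S] by blast
      have xx: "x \<in> T'" "bary T' v x = 0" using x opp_face_iff[OF element[OF T'(1)] T'(2)] T'(3) by auto
      have "x \<notin> interior T"
      proof
        assume "x \<in> interior T"
        then have "T' = T" using interior_element_disjoint[OF T T'(1)] xx(1) by blast
        then show False using simplex_bary(2)[OF element[OF T]] xx(2) T'(2) \<open>x \<in> interior T\<close> by force
      qed
      then show "\<eta> x = 0" by (rule test_function_eq_0[OF \<eta>])
    qed
    then have "(\<integral>x. div_h b x * \<eta> x \<partial>lebesgue_on \<Omega>) = - (\<integral>x. y x \<bullet> gradient \<eta> x \<partial>lebesgue_on \<Omega>)"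
      using integral_RT_test(3)[OF y \<eta>] by (simp add: eq_neg_iff_add_eq_0 add.commute)
    also have "\<dots> = (\<integral>x. g x * \<eta> x \<partial>lebesgue_on \<Omega>)" using g \<eta>\<Omega> unfolding has_weak_div_def by simp
    finally have eq: "(\<integral>x. div_h b x * \<eta> x \<partial>lebesgue_on \<Omega>) = (\<integral>x. g x * \<eta> x \<partial>lebesgue_on \<Omega>)" .
    \<comment> \<open>Boundedness of the test function makes \<open>g x * \<eta> x\<close>
      integrable, which allows the integral of the difference to be split.\<close>
    obtain B where B: "\<And>x. \<bar>\<eta> x\<bar> \<le> B"
    proof -
      have K: "compact (closure {x. \<eta> x \<noteq> 0})" using \<eta> unfolding test_functions_def by blast
      have "bounded (\<eta> ` closure {x. \<eta> x \<noteq> 0})"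
        by (intro compact_imp_bounded compact_continuous_image K continuous_on_GDERIV[OF test_function_C1(1)[OF \<eta>]])
      then obtain B where B: "\<And>x. x \<in> closure {x. \<eta> x \<noteq> 0} \<Longrightarrow> \<bar>\<eta> x\<bar> \<le> B"
        unfolding bounded_iff by auto
      have "\<bar>\<eta> x\<bar> \<le> max B 0" for x
      proof (cases "\<eta> x = 0")
        case False
        then have "x \<in> closure {x. \<eta> x \<noteq> 0}" using closure_subset[of "{x. \<eta> x \<noteq> 0}"] by auto
        then show ?thesis using B by force
      qed simp
      then show ?thesis using that by blast
    qed
    have \<eta>m: "\<eta> \<in> borel_measurable (lebesgue_on \<Omega>)"
      by (rule continuous_imp_measurable_on_sets_lebesgue[OF continuous_on_GDERIV[OF test_function_C1(1)[OF \<eta>]] domain_measurable])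
    have gi\<eta>: "integrable (lebesgue_on \<Omega>) (\<lambda>x. g x * \<eta> x)"
    proof (rule Bochner_Integration.integrable_bound)
      show "integrable (lebesgue_on \<Omega>) (\<lambda>x. B * g x)" using gi by simp
      show "(\<lambda>x. g x * \<eta> x) \<in> borel_measurable (lebesgue_on \<Omega>)"
        by (rule borel_measurable_times[OF borel_measurable_integrable[OF gi] \<eta>m])
      have "\<bar>g x * \<eta> x\<bar> \<le> \<bar>B * g x\<bar>" for x
        using B[of x] by (simp add: abs_mult mult.commute mult_right_mono)
      then show "AE x in lebesgue_on \<Omega>. norm (g x * \<eta> x) \<le> norm (B * g x)" by simp
    qed
    show "(\<integral>x. (g x - div_h b x) * \<eta> x \<partial>lebesgue_on \<Omega>) = 0"
      using eq Bochner_Integration.integral_diff[OF gi\<eta> integral_RT_test(2)[OF y \<eta>]]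
      by (simp add: left_diff_distrib)
  qed
  let ?N = "\<Union>T\<in>\<T>. {x \<in> interior T. g x - div_h b x \<noteq> 0}"
  have "negligible ?N" using finite_mesh neg by (intro negligible_Union) auto
  then have "AE x in lebesgue. x \<notin> ?N"
    by (rule AE_notin_negligible)
  then have "AE x in lebesgue. x \<in> \<Omega> \<longrightarrow> x \<notin> ?N" by eventually_elim (rule impI)
  then have "AE x in lebesgue_on \<Omega>. x \<notin> ?N"
    by (subst AE_restrict_space_iff) (use domain_measurable in simp_all)
  with AE_mesh show ?thesis by eventually_elim auto
qed

lemma weak_div_RT:
  assumes y: "is_RT y a b" and g: "\<exists>g. has_weak_div \<Omega> y g"
  shows "AE x in lebesgue_on \<Omega>. weak_div \<Omega> y x = div_h b x"
  using weak_div_RT_unique[OF y] someI_ex[OF g] unfolding weak_div_def by blast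

text \<open>A test function supported in \<open>\<Omega>\<close> away from all other sides leaves
  the single term of \<open>S\<close>. By \<open>positive_face_flux\<close> it can be chosen with
  nonzero mean over \<open>S\<close>, so the jump must vanish.\<close>

lemma flux_jump_RT:
  assumes y: "is_RT y a b" and g: "has_weak_div \<Omega> y g"
    and S: "S \<in> sides \<T>" "barycenter S \<in> \<Omega>"
  shows "flux_jump a b S = 0"
proof -
  obtain T v where T: "T \<in> \<T>" "v \<in> verts T" "S = opp_face T v" using sideE[OF S(1)] by blast
  let ?U = "\<Omega> - \<Union>(sides \<T> - {S})"
  have fin: "finite (sides \<T>)" unfolding sides_eq using finite_vfaces by blast
  have "closed (\<Union>(sides \<T> - {S}))" using fin closed_side by (intro closed_Union) auto
  then have U: "open ?U" using open_domain by (rule open_Diff[rotated])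
  have "barycenter S \<in> ?U" using S barycenter_other_side by blast
  then obtain \<eta> where \<eta>: "\<eta> \<in> test_functions ?U" "0 < face_flux T v \<eta> (gradient \<eta>)"
    using positive_face_flux[OF element[OF T(1)] T(2) _ U] barycenter_opp_face[OF element[OF T(1)] T(2)] T(3) by metis
  have \<eta>\<Omega>: "\<eta> \<in> test_functions \<Omega>" using test_functions_mono[of ?U \<Omega>] \<eta>(1) by blast
  have div: "AE x in lebesgue_on \<Omega>. g x = div_h b x" by (rule weak_div_RT_unique[OF y g])
  have "(\<integral>x. g x * \<eta> x \<partial>lebesgue_on \<Omega>) = (\<integral>x. div_h b x * \<eta> x \<partial>lebesgue_on \<Omega>)"
  proof (rule integral_cong_AE)
    have \<eta>m: "\<eta> \<in> borel_measurable (lebesgue_on \<Omega>)"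
      by (rule continuous_imp_measurable_on_sets_lebesgue[OF continuous_on_GDERIV[OF test_function_C1(1)[OF \<eta>(1)]] domain_measurable])
    show "(\<lambda>x. g x * \<eta> x) \<in> borel_measurable (lebesgue_on \<Omega>)"
      using g borel_measurable_times[OF borel_measurable_integrable \<eta>m, of g] unfolding has_weak_div_def by blast
    show "(\<lambda>x. div_h b x * \<eta> x) \<in> borel_measurable (lebesgue_on \<Omega>)"
      using integral_RT_test(2)[OF y \<eta>\<Omega>] by blast
    show "AE x in lebesgue_on \<Omega>. g x * \<eta> x = div_h b x * \<eta> x" using div by eventually_elim simp
  qed
  moreover have "(\<integral>x. y x \<bullet> gradient \<eta> x \<partial>lebesgue_on \<Omega>) = - (\<integral>x. g x * \<eta> x \<partial>lebesgue_on \<Omega>)"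
    using g \<eta>\<Omega> unfolding has_weak_div_def by blast
  ultimately have "(\<Sum>S\<in>sides \<T>. side_mean \<eta> (gradient \<eta>) S * flux_jump a b S) = 0"
    using integral_RT_test(3)[OF y \<eta>\<Omega>] by linarith
  moreover have "side_mean \<eta> (gradient \<eta>) S' = 0" if "S' \<in> sides \<T> - {S}" for S'
  proof (rule side_mean_eq_0[OF _ \<eta>(1)])
    show "S' \<in> sides \<T>" using that by simp
    show "\<eta> x = 0" if "x \<in> S'" for x
      by (rule test_function_eq_0[OF \<eta>(1)]) (use that \<open>S' \<in> sides \<T> - {S}\<close> in blast)
  qed
  then have "(\<Sum>S\<in>sides \<T>. side_mean \<eta> (gradient \<eta>) S * flux_jump a b S) = side_mean \<eta> (gradient \<eta>) S * flux_jump a b S"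
    using sum.remove[OF fin S(1), of "\<lambda>S. side_mean \<eta> (gradient \<eta>) S * flux_jump a b S"] by simp
  moreover have "side_mean \<eta> (gradient \<eta>) S \<noteq> 0"
    using \<eta>(2) face_flux_side_mean[OF T(1,2) test_function_C1[OF \<eta>(1)]] T(3) by auto
  ultimately show ?thesis by simp
qed

end

section \<open>Convex conjugates\<close>

text \<open>Along the direction \<open>D - q\<close>, the difference of \<open>f\<close> and its
  affine minorant has a local minimum at \<open>x\<close>. The inequality is local because a
  conjugate may be infinite away from \<open>x\<close>.\<close>

lemma local_subgradient_eq_gradient:
  assumes f: "GDERIV f x :> D" and q: "\<forall>\<^sub>F t in nhds x. f x + q \<bullet> (t - x) \<le> f t"
  shows "q = D"
proof -
  obtain e where e: "0 < e" "\<And>t. dist t x < e \<Longrightarrow> f x + q \<bullet> (t - x) \<le> f t"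
    using q unfolding eventually_nhds_metric by blast
  define h where "h = D - q"
  have "((\<lambda>r. f (x + r *\<^sub>R h) - r * (q \<bullet> h)) has_real_derivative D \<bullet> h - q \<bullet> h) (at 0)"
  proof (rule derivative_intros)
    show "((\<lambda>r. f (x + r *\<^sub>R h)) has_real_derivative D \<bullet> h) (at 0)"
      by (rule GDERIV_line) (simp add: f)
    show "((\<lambda>r. r * (q \<bullet> h)) has_real_derivative q \<bullet> h) (at 0)"
      by (auto intro!: derivative_eq_intros)
  qed
  moreover have "\<forall>y. \<bar>0 - y\<bar> < e / (norm h + 1) \<longrightarrow>
      f (x + 0 *\<^sub>R h) - 0 * (q \<bullet> h) \<le> f (x + y *\<^sub>R h) - y * (q \<bullet> h)"
  proof (intro allI impI)
    fix y assume "\<bar>0 - y\<bar> < e / (norm h + 1)"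
    then have "\<bar>y\<bar> * (norm h + 1) < e" by (simp add: pos_less_divide_eq add_nonneg_pos)
    moreover have "\<bar>y\<bar> * norm h \<le> \<bar>y\<bar> * (norm h + 1)" by (intro mult_left_mono) auto
    ultimately have "dist (x + y *\<^sub>R h) x < e" by (simp add: dist_norm)
    from e(2)[OF this] show "f (x + 0 *\<^sub>R h) - 0 * (q \<bullet> h) \<le> f (x + y *\<^sub>R h) - y * (q \<bullet> h)" by simp
  qed
  moreover have "0 < e / (norm h + 1)" using e(1) by (simp add: add_nonneg_pos)
  ultimately have "D \<bullet> h - q \<bullet> h = 0" using DERIV_local_min by blast
  then have "h \<bullet> h = 0" by (simp add: h_def inner_simps)
  then show ?thesis by (simp add: h_def)
qed

lemma convex_above_tangent:
  assumes f: "convex_on UNIV f" and D: "GDERIV f x :> D"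
  shows "f x + D \<bullet> (t - x) \<le> f t"
proof -
  let ?\<phi> = "\<lambda>r::real. f (x + r *\<^sub>R (t - x))"
  have "convex_on UNIV ?\<phi>"
  proof (rule convex_onI)
    fix l r s :: real assume l: "0 < l" "l < 1"
    have "x + ((1 - l) *\<^sub>R r + l *\<^sub>R s) *\<^sub>R (t - x)
        = (1 - l) *\<^sub>R (x + r *\<^sub>R (t - x)) + l *\<^sub>R (x + s *\<^sub>R (t - x))"
      by (simp add: algebra_simps)
    then show "?\<phi> ((1 - l) *\<^sub>R r + l *\<^sub>R s) \<le> (1 - l) * ?\<phi> r + l * ?\<phi> s"
      using convex_onD[OF f, of l "x + r *\<^sub>R (t - x)" "x + s *\<^sub>R (t - x)"] l by simp
  qed simp
  moreover have "(?\<phi> has_real_derivative D \<bullet> (t - x)) (at 0)"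
    by (rule GDERIV_line) (simp add: D)
  ultimately have "D \<bullet> (t - x) * (1 - 0) \<le> ?\<phi> 1 - ?\<phi> 0"
    by (intro convex_on_imp_above_tangent[where A=UNIV]) auto
  then show ?thesis by simp
qed

lemma fenchel_young: "ereal (t \<bullet> s) - f s \<le> convex_conjugate f t"
  unfolding convex_conjugate_def by (rule SUP_upper) simp

lemma conjugate_eqI:
  assumes "\<And>t. f s + a \<bullet> (t - s) \<le> f t"
  shows "convex_conjugate (\<lambda>s. ereal (f s)) a = ereal (a \<bullet> s - f s)"
proof (rule antisym)
  show "convex_conjugate (\<lambda>s. ereal (f s)) a \<le> ereal (a \<bullet> s - f s)"
    unfolding convex_conjugate_def
  proof (rule SUP_least)
    fix t show "ereal (a \<bullet> t) - ereal (f t) \<le> ereal (a \<bullet> s - f s)"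
      using assms[of t] by (simp add: inner_diff_right)
  qed
  show "ereal (a \<bullet> s - f s) \<le> convex_conjugate (\<lambda>s. ereal (f s)) a"
    using fenchel_young[of a s "\<lambda>s. ereal (f s)"] by simp
qed

lemma conjugate_eqD:
  assumes "convex_conjugate (\<lambda>s. ereal (f s)) a = ereal (a \<bullet> s - f s)"
  shows "f s + a \<bullet> (t - s) \<le> f t"
  using fenchel_young[of a t "\<lambda>s. ereal (f s)"] unfolding assms by (simp add: inner_diff_right)

lemma conjugate_eq_gradient:
  assumes eq: "convex_conjugate (\<lambda>s. ereal (f s)) a = ereal (a \<bullet> s - f s)" and D: "GDERIV f s :> D"
  shows "a = D"
  by (rule local_subgradient_eq_gradient[OF D]) (use conjugate_eqD[OF eq] in simp)

text \<open>Equality in Fenchel--Young at \<open>a\<close> and \<open>s\<close> makes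
  \<open>s\<close> a subgradient of the conjugate at \<open>a\<close>. Where the conjugate is
  differentiable its gradient is the only subgradient, so both branches of
  \<open>generalized_derivative\<close> are covered.\<close>

lemma conjugate_generalized_derivative:
  fixes a s :: "'a::euclidean_space"
  assumes eq: "convex_conjugate (\<lambda>s. ereal (f s)) a = ereal (a \<bullet> s - f s)"
  shows "s \<in> generalized_derivative (convex_conjugate (\<lambda>s. ereal (f s))) a"
proof -
  let ?g = "convex_conjugate (\<lambda>s. ereal (f s))"
  have le: "ereal (a \<bullet> s - f s) + ereal (s \<bullet> (t - a)) \<le> ?g t" for t
    using fenchel_young[of t s "\<lambda>s. ereal (f s)"] by (simp add: inner_diff_right inner_commute)
  show ?thesis
  proof (cases "ereal_differentiable_at ?g a")
    case False
    then show ?thesis using le by (simp add: generalized_derivative_def subdifferential_def eq)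
  next
    case True
    then have fin: "\<forall>\<^sub>F t in nhds a. \<bar>?g t\<bar> \<noteq> \<infinity>"
      and "(\<lambda>t. real_of_ereal (?g t)) differentiable (at a)"
      unfolding ereal_differentiable_at_def by auto
    then have "GDERIV (\<lambda>t. real_of_ereal (?g t)) a :> ereal_gradient ?g a"
      unfolding ereal_gradient_def by (intro differentiable_GDERIV)
    moreover have "\<forall>\<^sub>F t in nhds a. real_of_ereal (?g a) + s \<bullet> (t - a) \<le> real_of_ereal (?g t)"
      using fin
    proof (eventually_elim)
      case (elim t)
      then obtain r where "?g t = ereal r" by (cases "?g t") auto
      then show ?case using le[of t] by (simp add: eq)
    qed
    ultimately have "s = ereal_gradient ?g a" by (rule local_subgradient_eq_gradient)
    then show ?thesis using True by (simp add: generalized_derivative_def)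
  qed
qed

lemma ereal_differentiable_finite:
  assumes "\<And>s. ereal_differentiable_at f s"
  shows "f s = ereal (real_of_ereal (f s))" "GDERIV (\<lambda>s. real_of_ereal (f s)) (s::real) :> ereal_gradient f s"
proof -
  have "\<forall>\<^sub>F s in nhds s. \<bar>f s\<bar> \<noteq> \<infinity>" using assms[of s] by (simp add: ereal_differentiable_at_def)
  from eventually_nhds_x_imp_x[OF this] have "\<bar>f s\<bar> \<noteq> \<infinity>" .
  then show "f s = ereal (real_of_ereal (f s))" by (simp add: ereal_real)
  show "GDERIV (\<lambda>s. real_of_ereal (f s)) s :> ereal_gradient f s"
    using assms[of s] unfolding ereal_differentiable_at_def ereal_gradient_def by (intro differentiable_GDERIV) blast
qed

lemma ereal_convex_real:
  assumes "ereal_convex (\<lambda>s. ereal (f s))"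
  shows "convex_on UNIV f"
proof (rule convex_onI)
  fix l s t assume "0 < (l::real)" "l < 1"
  then have "ereal (f ((1 - l) *\<^sub>R s + l *\<^sub>R t)) \<le> ereal (1 - l) * ereal (f s) + ereal l * ereal (f t)"
    using assms unfolding ereal_convex_def by blast
  then show "f ((1 - l) *\<^sub>R s + l *\<^sub>R t) \<le> (1 - l) * f s + l * f t" by simp
qed simp

text \<open>All slacks are nonnegative and the total is finite, so no term can exceed its bound.
  This turns one global equality into an equality on every element.\<close>

lemma ereal_sum_mono_eqD:
  fixes X :: "'a \<Rightarrow> ereal" and p :: "'a \<Rightarrow> real"
  assumes A: "finite A" and le: "\<And>i. i \<in> A \<Longrightarrow> ereal (p i) \<le> X i"
    and eq: "(\<Sum>i\<in>A. X i) = ereal (\<Sum>i\<in>A. p i)" and i: "i \<in> A"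
  shows "X i = ereal (p i)"
proof -
  have "(\<Sum>j\<in>A - {i}. ereal (p j)) \<le> (\<Sum>j\<in>A - {i}. X j)" using le by (intro sum_mono) auto
  then have 1: "ereal (\<Sum>j\<in>A - {i}. p j) \<le> (\<Sum>j\<in>A - {i}. X j)" by simp
  have 2: "X i + (\<Sum>j\<in>A - {i}. X j) = ereal (p i + (\<Sum>j\<in>A - {i}. p j))"
    using eq sum.remove[OF A i, of X] sum.remove[OF A i, of p] by simp
  show ?thesis
    using 1 2 le[OF i] by (cases "X i"; cases "\<Sum>j\<in>A - {i}. X j") auto
qed

section \<open>Affine and constant polynomials\<close>

lemma polynomial_degree_le_0:
  fixes p :: "real ^ 'd \<Rightarrow> 'b::real_vector"
  shows "polynomial_degree_le 0 p \<longleftrightarrow> (\<exists>c. \<forall>x. p x = c)"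
proof -
  have "{\<alpha> :: 'd \<Rightarrow> nat. (\<Sum>i\<in>UNIV. \<alpha> i) \<le> 0} = {\<lambda>_. 0}" by (auto simp: fun_eq_iff)
  then have "polynomial_degree_le 0 p \<longleftrightarrow> (\<exists>c :: ('d \<Rightarrow> nat) \<Rightarrow> 'b. \<forall>x. p x = c (\<lambda>_. 0))"
    unfolding polynomial_degree_le_def by simp
  also have "\<dots> \<longleftrightarrow> (\<exists>c. \<forall>x. p x = c)" by (metis (full_types))
  finally show ?thesis .
qed

lemma polynomial_degree_le_1:
  fixes p :: "real ^ 'd \<Rightarrow> real"
  shows "polynomial_degree_le 1 p \<longleftrightarrow> (\<exists>a b. \<forall>x. p x = a + b \<bullet> x)"
proof -
  \<comment> \<open>\<open>e i\<close> is the multi-index of the monomial \<open>x $ i\<close>;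
    together with the zero index these are all indices of total degree at most 1.\<close>
  define e where "e i = (\<lambda>j. if j = i then 1 else 0 :: nat)" for i :: 'd
  let ?A = "{\<alpha> :: 'd \<Rightarrow> nat. (\<Sum>i\<in>UNIV. \<alpha> i) \<le> 1}"
  have inj: "inj e"
  proof (rule injI)
    fix i j assume "e i = e j"
    then have "e i i = e j i" by simp
    then show "i = j" by (simp add: e_def split: if_splits)
  qed
  have A: "?A = insert (\<lambda>_. 0) (range e)"
  proof (intro equalityI subsetI)
    fix \<alpha> :: "'d \<Rightarrow> nat" assume a: "\<alpha> \<in> ?A"
    show "\<alpha> \<in> insert (\<lambda>_. 0) (range e)"
    proof (cases "\<alpha> = (\<lambda>_. 0)")
      case False
      then obtain i where i: "\<alpha> i \<noteq> 0" by (auto simp: fun_eq_iff)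
      have "\<alpha> i + (\<Sum>j\<in>UNIV - {i}. \<alpha> j) \<le> 1" using a by (simp add: sum.remove[of UNIV i])
      then have "\<alpha> i = 1" "(\<Sum>j\<in>UNIV - {i}. \<alpha> j) = 0" using i by linarith+
      then have "\<forall>j\<in>UNIV - {i}. \<alpha> j = 0" by simp
      then have "\<alpha> = e i" using \<open>\<alpha> i = 1\<close> by (auto simp: e_def fun_eq_iff)
      then show ?thesis by blast
    qed simp
  next
    fix \<alpha> assume "\<alpha> \<in> insert (\<lambda>_. 0) (range e)"
    then show "\<alpha> \<in> ?A" by (auto simp: e_def)
  qed
  have ne: "(\<lambda>_. 0) \<notin> range e"
  proof
    assume "(\<lambda>_. 0) \<in> range e"
    then obtain i where "(\<lambda>_. 0) = e i" by blast
    then have "e i i = 0" by metis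
    then show False by (simp add: e_def)
  qed
  have mono: "(\<Prod>j\<in>UNIV. (x $ j) ^ e i j) = x $ i" for x :: "real ^ 'd" and i
  proof -
    have "(\<Prod>j\<in>UNIV. (x $ j) ^ e i j) = (\<Prod>j\<in>UNIV. if j = i then x $ j else 1)"
      by (intro prod.cong) (auto simp: e_def)
    then show ?thesis by simp
  qed
  have S: "(\<Sum>\<alpha>\<in>?A. (\<Prod>i\<in>UNIV. (x $ i) ^ \<alpha> i) *\<^sub>R c \<alpha>) = c (\<lambda>_. 0) + (\<Sum>i\<in>UNIV. x $ i * c (e i))"
    for x :: "real ^ 'd" and c :: "('d \<Rightarrow> nat) \<Rightarrow> real"
    unfolding A using ne by (simp add: sum.reindex[OF inj] mono)
  show ?thesis
  proof
    assume "polynomial_degree_le 1 p"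
    then obtain c where "\<forall>x. p x = c (\<lambda>_. 0) + (\<Sum>i\<in>UNIV. x $ i * c (e i))"
      unfolding polynomial_degree_le_def S by blast
    then have "\<forall>x. p x = c (\<lambda>_. 0) + (\<chi> i. c (e i)) \<bullet> x"
      by (simp add: inner_vec_def mult.commute)
    then show "\<exists>a b. \<forall>x. p x = a + b \<bullet> x" by blast
  next
    assume "\<exists>a b. \<forall>x. p x = a + b \<bullet> x"
    then obtain a b where ab: "\<forall>x. p x = a + b \<bullet> x" by blast
    \<comment> \<open>On the multi-index \<open>e i\<close> the sum reduces to
      \<open>b $ i\<close>.\<close>
    define c where "c \<alpha> = (if \<alpha> = (\<lambda>_. 0) then a else \<Sum>i\<in>UNIV. real (\<alpha> i) * (b $ i))" for \<alpha> :: "'d \<Rightarrow> nat"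
    have "c (e i) = b $ i" for i
    proof -
      have "(\<Sum>j\<in>UNIV. real (e i j) * (b $ j)) = (\<Sum>j\<in>UNIV. if j = i then b $ j else 0)"
        by (intro sum.cong) (auto simp: e_def)
      moreover have "e i \<noteq> (\<lambda>_. 0)" using ne by (metis rangeI)
      ultimately show ?thesis by (simp add: c_def)
    qed
    then have "\<forall>x. p x = c (\<lambda>_. 0) + (\<Sum>i\<in>UNIV. x $ i * c (e i))"
      using ab by (simp add: c_def inner_vec_def mult.commute)
    then show "polynomial_degree_le 1 p" unfolding polynomial_degree_le_def S by blast
  qed
qed

section \<open>Integrals of elementwise constant functions\<close>

lemma integral_element_interior:
  fixes F :: "'a::euclidean_space \<Rightarrow> 'b::euclidean_space"
  assumes T: "full_simplex T" and F: "\<And>x. x \<in> interior T \<Longrightarrow> F x = \<Phi> x" and \<Phi>: "continuous_on T \<Phi>"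
  shows "integral\<^sup>L (lebesgue_on T) F = integral\<^sup>L (lebesgue_on T) \<Phi>"
proof (rule integral_lebesgue_spike(2))
  show Ts: "T \<in> sets lebesgue" using simplex_facts(6)[OF T] by blast
  show "integrable (lebesgue_on T) \<Phi>" by (rule integral_compact_lborel(1)[OF simplex_facts(1)[OF T] \<Phi>])
  have "AE x in lebesgue. x \<in> T \<longrightarrow> F x = \<Phi> x"
    using AE_notin_negligible[OF simplex_facts(5)[OF T]] by eventually_elim (use F in auto)
  then show "AE x in lebesgue_on T. F x = \<Phi> x"
    by (subst AE_restrict_space_iff) (use Ts in simp_all)
qed

text \<open>Excluding \<open>- \<infinity>\<close> keeps the negative part finite, so the difference
  is never \<open>\<infinity> - \<infinity>\<close>.\<close>

lemma ereal_positive_negative_part: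
  fixes c :: ereal
  assumes c: "c \<noteq> - \<infinity>" and m: "0 < m"
  shows "enn2ereal (e2ennreal c * ennreal m) - enn2ereal (e2ennreal (- c) * ennreal m) = ereal m * c"
    "e2ennreal (- c) * ennreal m < top"
proof -
  have "enn2ereal (e2ennreal c * ennreal m) - enn2ereal (e2ennreal (- c) * ennreal m) = ereal m * c
      \<and> e2ennreal (- c) * ennreal m < top"
  proof (cases c)
    case (real r)
    show ?thesis
    proof (cases "0 \<le> r")
      case True
      then show ?thesis using m real
        by (simp add: ennreal_neg ennreal_mult[symmetric] mult.commute zero_ennreal.rep_eq)
    next
      case False
      then have "m * r < 0" using m by (simp add: mult_pos_neg)
      then show ?thesis using m real False
        by (simp add: ennreal_neg ennreal_mult[symmetric] ennreal_mult_less_top mult.commute zero_ennreal.rep_eq)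
    qed
  next
    case PInf
    then show ?thesis using m by (simp add: ennreal_top_mult e2ennreal_neg zero_ennreal.rep_eq)
  qed (use c in simp)
  then show "enn2ereal (e2ennreal c * ennreal m) - enn2ereal (e2ennreal (- c) * ennreal m) = ereal m * c"
    "e2ennreal (- c) * ennreal m < top" by blast+
qed

lemma ereal_sum_positive_negative_part:
  fixes c :: "'i \<Rightarrow> ereal"
  assumes A: "finite A" and c: "\<And>i. i \<in> A \<Longrightarrow> c i \<noteq> - \<infinity>" and m: "\<And>i. i \<in> A \<Longrightarrow> 0 < m i"
  shows "enn2ereal (\<Sum>i\<in>A. e2ennreal (c i) * ennreal (m i)) - enn2ereal (\<Sum>i\<in>A. e2ennreal (- c i) * ennreal (m i))
      = (\<Sum>i\<in>A. ereal (m i) * c i)"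
proof -
  have fin: "(\<Sum>i\<in>B. e2ennreal (- c i) * ennreal (m i)) < top" if "B \<subseteq> A" for B
    using that ereal_positive_negative_part(2)[OF c m] finite_subset[OF that A] by (auto simp: less_top)
  have "enn2ereal (\<Sum>i\<in>B. e2ennreal (c i) * ennreal (m i)) - enn2ereal (\<Sum>i\<in>B. e2ennreal (- c i) * ennreal (m i))
      = (\<Sum>i\<in>B. ereal (m i) * c i)" if "B \<subseteq> A" for B
    using finite_subset[OF that A] that
  proof (induction B rule: finite_induct)
    case (insert i B)
    let ?p = "e2ennreal (c i) * ennreal (m i)" and ?n = "e2ennreal (- c i) * ennreal (m i)"
    let ?P = "\<Sum>i\<in>B. e2ennreal (c i) * ennreal (m i)" and ?N = "\<Sum>i\<in>B. e2ennreal (- c i) * ennreal (m i)"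
    \<comment> \<open>Finiteness of the negative parts lets the difference of sums be rearranged
      into a sum of differences.\<close>
    have split: "enn2ereal (p + P) - enn2ereal (n + N) = (enn2ereal p - enn2ereal n) + (enn2ereal P - enn2ereal N)"
      if nN: "n < top" "N < top" for p P n N
    proof -
      obtain n' N' where "n = ennreal n'" "0 \<le> n'" "N = ennreal N'" "0 \<le> N'"
        using nN by (cases n; cases N) auto
      then show ?thesis by (cases p; cases P) (auto simp: plus_ennreal.rep_eq)
    qed
    show ?case
      using insert split[of ?n ?N ?p ?P] fin[of B] ereal_positive_negative_part[OF c m, of i] by simp
  qed simp
  then show ?thesis by blast
qed

context mesh
begin

lemma ereal_integral_mesh:
  assumes F: "AE x in lebesgue_on \<Omega>. \<forall>T\<in>\<T>. x \<in> interior T \<longrightarrow> F x = c T"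
    and c: "\<And>T. T \<in> \<T> \<Longrightarrow> c T \<noteq> - \<infinity>"
  shows "ereal_integral (lebesgue_on \<Omega>) F = (\<Sum>T\<in>\<T>. ereal (\<mu> T) * c T)"
proof -
  have em: "emeasure (lebesgue_on \<Omega>) (interior T) = ennreal (\<mu> T)" if T: "T \<in> \<T>" for T
  proof -
    note S = simplex_facts[OF element[OF T]]
    have i: "interior T \<in> lmeasurable" using S(1) by (simp add: compact_imp_bounded bounded_interior lmeasurable_open)
    have "\<mu> (interior T) = \<mu> T"
      by (rule measure_interior) (use S(1,2) in \<open>simp_all add: compact_imp_bounded negligible_convex_frontier\<close>)
    moreover have "emeasure lebesgue (interior T) = ennreal (\<mu> (interior T))"
      using i emeasure_eq_measure2 by blast
    ultimately show ?thesis
      using domain_measurable interior_element_subset[OF T] by (simp add: emeasure_restrict_space)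
  qed
  \<comment> \<open>Proved for arbitrary \<open>k\<close>, to serve the positive and the negative
    part of the integral alike.\<close>
  have main: "(\<integral>\<^sup>+x. k (F x) \<partial>lebesgue_on \<Omega>) = (\<Sum>T\<in>\<T>. k (c T) * ennreal (\<mu> T))"
    for k :: "ereal \<Rightarrow> ennreal"
  proof -
    have "(\<integral>\<^sup>+x. k (F x) \<partial>lebesgue_on \<Omega>) = (\<integral>\<^sup>+x. (\<Sum>T\<in>\<T>. k (c T) * indicator (interior T) x) \<partial>lebesgue_on \<Omega>)"
    proof (rule nn_integral_cong_AE)
      show "AE x in lebesgue_on \<Omega>. k (F x) = (\<Sum>T\<in>\<T>. k (c T) * indicator (interior T) x)"
        using F AE_mesh
      proof eventually_elim
        case (elim x)
        then obtain T where T: "T \<in> \<T>" "x \<in> interior T" by blast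
        have "(\<Sum>T\<in>\<T>. k (c T) * indicator (interior T) x) = (\<Sum>T'\<in>\<T>. if T' = T then k (c T) else 0)"
        proof (rule sum.cong)
          fix T' assume "T' \<in> \<T>"
          then show "k (c T') * indicator (interior T') x = (if T' = T then k (c T) else 0)"
            using T interior_element_disjoint[of T' T] interior_subset by (auto simp: indicator_def)
        qed simp
        then show ?case using elim T finite_mesh by simp
      qed
    qed
    also have "\<dots> = (\<Sum>T\<in>\<T>. \<integral>\<^sup>+x. k (c T) * indicator (interior T) x \<partial>lebesgue_on \<Omega>)"
    proof (rule nn_integral_sum)
      fix T assume T: "T \<in> \<T>"
      have "interior T \<in> sets (lebesgue_on \<Omega>)"
        using interior_element_subset[OF T] domain_measurable by (auto simp: sets_restrict_space_iff)
      then show "(\<lambda>x. k (c T) * indicator (interior T) x) \<in> borel_measurable (lebesgue_on \<Omega>)"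
        by (intro borel_measurable_times_ennreal borel_measurable_const borel_measurable_indicator)
    qed
    also have "\<dots> = (\<Sum>T\<in>\<T>. k (c T) * ennreal (\<mu> T))"
    proof (rule sum.cong)
      fix T assume T: "T \<in> \<T>"
      have "interior T \<in> sets (lebesgue_on \<Omega>)"
        using interior_element_subset[OF T] domain_measurable by (auto simp: sets_restrict_space_iff)
      then show "(\<integral>\<^sup>+x. k (c T) * indicator (interior T) x \<partial>lebesgue_on \<Omega>) = k (c T) * ennreal (\<mu> T)"
        by (simp add: nn_integral_cmult_indicator em[OF T])
    qed simp
    finally show ?thesis .
  qed
  show ?thesis
    unfolding ereal_integral_def main[of e2ennreal] main[of "\<lambda>r. e2ennreal (- r)"]
    by (rule ereal_sum_positive_negative_part[OF finite_mesh c measure_pos])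
qed

lemma integral_mesh_const:
  fixes F :: "real ^ 'd \<Rightarrow> real"
  assumes F: "AE x in lebesgue_on \<Omega>. \<forall>T\<in>\<T>. x \<in> interior T \<longrightarrow> F x = c T"
  shows "integral\<^sup>L (lebesgue_on \<Omega>) F = (\<Sum>T\<in>\<T>. \<mu> T * c T)"
proof -
  have e: "elementwise_const \<T> c x = c T" if "T \<in> \<T>" "x \<in> interior T" for T x
    using elementwise_const_eq that .
  have "integral\<^sup>L (lebesgue_on \<Omega>) F = integral\<^sup>L (lebesgue_on \<Omega>) (elementwise_const \<T> c)"
  proof (rule integral_lebesgue_spike(2)[OF domain_measurable])
    show "integrable (lebesgue_on \<Omega>) (elementwise_const \<T> c)"
      by (rule integral_mesh(1)[where \<Phi>="\<lambda>T x. c T"]) (auto simp: e)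
    show "AE x in lebesgue_on \<Omega>. F x = elementwise_const \<T> c x"
      using F AE_mesh by eventually_elim (auto simp: e)
  qed
  also have "\<dots> = (\<Sum>T\<in>\<T>. \<integral>x. c T \<partial>lebesgue_on T)"
    by (rule integral_mesh(2)) (auto simp: e)
  also have "\<dots> = (\<Sum>T\<in>\<T>. \<mu> T * c T)"
    by (intro sum.cong refl) (simp only: integral_const_simplex[OF element] real_scaleR_def)
  finally show ?thesis .
qed

lemma L2_proj0_eq:
  fixes F :: "real ^ 'd \<Rightarrow> 'b::euclidean_space"
  assumes T: "T \<in> \<T>" "x \<in> interior T" and F: "\<And>x. x \<in> interior T \<Longrightarrow> F x = \<Phi> x"
    and \<Phi>: "continuous_on T \<Phi>" "integral\<^sup>L (lebesgue_on T) \<Phi> = \<mu> T *\<^sub>R c"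
  shows "L2_proj0 \<T> F x = c"
proof -
  have "integral\<^sup>L (lebesgue_on T) F = integral\<^sup>L (lebesgue_on T) \<Phi>"
    by (rule integral_element_interior[OF element[OF T(1)] F \<Phi>(1)])
  then show ?thesis
    unfolding L2_proj0_def elementwise_const_eq[OF T] \<Phi>(2) using measure_pos[OF T(1)] by simp
qed

lemma L2_proj0_RT:
  assumes "is_RT y a b" "T \<in> \<T>" "x \<in> interior T"
  shows "L2_proj0 \<T> y x = a T"
  by (rule L2_proj0_eq[OF assms(2,3), where \<Phi>="\<lambda>x. a T + b T *\<^sub>R (x - barycenter T)"])
    (use assms integral_affine_simplex(2)[OF element] in \<open>auto simp: is_RT_def intro!: continuous_intros\<close>)

lemma at_within_interior_element:
  assumes T: "T \<in> \<T>" "x \<in> T"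
  shows "at x within interior T \<noteq> bot"
proof -
  have "x \<in> closure (interior T)" using simplex_facts(8)[OF element[OF T(1)]] T(2) by simp
  then have "x islimpt interior T"
    using interior_limit_point[of x "interior T"] by (auto simp: closure_def)
  then show ?thesis by (simp add: trivial_limit_within)
qed

lemma on_element_eq:
  assumes T: "T \<in> \<T>" "x \<in> T" and F: "\<And>x. x \<in> interior T \<Longrightarrow> F x = \<Phi> x" and \<Phi>: "continuous_on UNIV \<Phi>"
  shows "on_element T F x = \<Phi> x"
  unfolding on_element_def
proof (rule tendsto_Lim[OF at_within_interior_element[OF T]])
  have "(\<Phi> \<longlongrightarrow> \<Phi> x) (at x within interior T)"
    using \<Phi> by (metis UNIV_I continuous_on_def subset_UNIV tendsto_within_subset)
  moreover have "\<forall>\<^sub>F x in at x within interior T. \<Phi> x = F x"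
    by (simp add: eventually_at_filter F)
  ultimately show "(F \<longlongrightarrow> \<Phi> x) (at x within interior T)" by (rule Lim_transform_eventually)
qed

section \<open>Crouzeix--Raviart functions\<close>

definition is_P1 :: "(real ^ 'd \<Rightarrow> real) \<Rightarrow> ((real ^ 'd) set \<Rightarrow> real) \<Rightarrow> ((real ^ 'd) set \<Rightarrow> real ^ 'd) \<Rightarrow> bool" where
  "is_P1 u \<alpha> \<beta> \<longleftrightarrow> (\<forall>T\<in>\<T>. \<forall>x\<in>interior T. u x = \<alpha> T + \<beta> T \<bullet> x)"

lemma piecewise_polynomials_1: "u \<in> piecewise_polynomials 1 \<T> \<longleftrightarrow> (\<exists>\<alpha> \<beta>. is_P1 u \<alpha> \<beta>)"
proof
  assume "u \<in> piecewise_polynomials 1 \<T>"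
  then have "\<forall>T\<in>\<T>. \<exists>a b. \<forall>x\<in>interior T. u x = a + b \<bullet> x"
    unfolding piecewise_polynomials_def polynomial_degree_le_1 by fastforce
  then obtain \<alpha> where "\<forall>T\<in>\<T>. \<exists>b. \<forall>x\<in>interior T. u x = \<alpha> T + b \<bullet> x" by metis
  then obtain \<beta> where "\<forall>T\<in>\<T>. \<forall>x\<in>interior T. u x = \<alpha> T + \<beta> T \<bullet> x" by metis
  then show "\<exists>\<alpha> \<beta>. is_P1 u \<alpha> \<beta>" unfolding is_P1_def by blast
next
  assume "\<exists>\<alpha> \<beta>. is_P1 u \<alpha> \<beta>"
  then obtain \<alpha> \<beta> where P: "is_P1 u \<alpha> \<beta>" by blast
  show "u \<in> piecewise_polynomials 1 \<T>"
    unfolding piecewise_polynomials_def polynomial_degree_le_1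
  proof (intro CollectI ballI exI conjI)
    fix T assume "T \<in> \<T>"
    show "\<forall>x. (\<lambda>x. \<alpha> T + \<beta> T \<bullet> x) x = \<alpha> T + \<beta> T \<bullet> x" by simp
    show "u x = \<alpha> T + \<beta> T \<bullet> x" if "x \<in> interior T" for x
      using P \<open>T \<in> \<T>\<close> that unfolding is_P1_def by blast
  qed
qed

lemma grad_h_P1:
  assumes u: "is_P1 u \<alpha> \<beta>" and T: "T \<in> \<T>" "x \<in> interior T"
  shows "grad_h \<T> u x = \<beta> T"
proof -
  have "GDERIV u x :> \<beta> T"
    unfolding gderiv_def
  proof (rule has_derivative_transform_within_open[OF _ open_interior T(2)])
    show "((\<lambda>x. \<alpha> T + \<beta> T \<bullet> x) has_derivative (\<lambda>h. h \<bullet> \<beta> T)) (at x)"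
      using GDERIV_affine unfolding gderiv_def by blast
  qed (use u T in \<open>auto simp: is_P1_def\<close>)
  then show ?thesis using T by (auto simp: grad_h_def gradient_eq)
qed

lemma L2_proj0_P1:
  assumes "is_P1 u \<alpha> \<beta>" "T \<in> \<T>" "x \<in> interior T"
  shows "L2_proj0 \<T> u x = \<alpha> T + \<beta> T \<bullet> barycenter T"
  by (rule L2_proj0_eq[OF assms(2,3), where \<Phi>="\<lambda>x. \<alpha> T + \<beta> T \<bullet> x"])
    (use assms integral_affine_simplex(1)[OF element] in \<open>auto simp: is_P1_def intro!: continuous_intros\<close>)

abbreviation skeleton_compl :: "(real ^ 'd) set" where
  "skeleton_compl \<equiv> \<Union>T\<in>\<T>. interior T"

text \<open>The limit is taken through all element interiors at once, so it restricts to each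
  adjacent element, where it is the value of the affine piece. Hence all pieces meeting at the side
  share it.\<close>

lemma P1_side_value:
  assumes u: "is_P1 u \<alpha> \<beta>" and T: "T \<in> \<T>" "v \<in> verts T"
    and l: "(u \<longlongrightarrow> l) (at (barycenter (opp_face T v)) within skeleton_compl)"
  shows "\<alpha> T + \<beta> T \<bullet> barycenter (opp_face T v) = l"
proof -
  let ?x = "barycenter (opp_face T v)"
  have x: "?x \<in> T" using barycenter_opp_face[OF element[OF T(1)] T(2)] opp_face_subset[OF element[OF T(1)] T(2)] by blast
  have "(u \<longlongrightarrow> l) (at ?x within interior T)"
    by (rule tendsto_within_subset[OF l]) (use T in blast)
  then have "on_element T u ?x = l"
    unfolding on_element_def by (rule tendsto_Lim[OF at_within_interior_element[OF T(1) x]])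
  moreover have "on_element T u ?x = \<alpha> T + \<beta> T \<bullet> ?x"
    by (rule on_element_eq[OF T(1) x]) (use u T in \<open>auto simp: is_P1_def intro!: continuous_intros\<close>)
  ultimately show ?thesis by simp
qed

text \<open>Discrete integration by parts before boundary conditions: by
  \<open>face_flux_affine\<close> the flux of an affine function is governed by its barycenter
  value, which here depends on the side only.\<close>

lemma RT_P1_pairing:
  assumes l: "\<And>T v. T \<in> \<T> \<Longrightarrow> v \<in> verts T \<Longrightarrow> \<alpha> T + \<beta> T \<bullet> barycenter (opp_face T v) = l (opp_face T v)"
  shows "(\<Sum>T\<in>\<T>. \<mu> T * (a T \<bullet> \<beta> T + real CARD('d) * b T * (\<alpha> T + \<beta> T \<bullet> barycenter T)))
       = (\<Sum>S\<in>sides \<T>. (real CARD('d) * l S) * flux_jump a b S)"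
proof -
  have "\<mu> T * (a T \<bullet> \<beta> T + real CARD('d) * b T * (\<alpha> T + \<beta> T \<bullet> barycenter T))
      = (\<Sum>v\<in>verts T. rt_coef T (a T) (b T) v * face_flux T v (\<lambda>x. \<alpha> T + \<beta> T \<bullet> x) (\<lambda>_. \<beta> T))" if T: "T \<in> \<T>" for T
  proof -
    let ?k = "real CARD('d) * b T"
    have "(a T + b T *\<^sub>R (x - barycenter T)) \<bullet> \<beta> T + ?k * (\<alpha> T + \<beta> T \<bullet> x)
        = (a T \<bullet> \<beta> T - b T * (barycenter T \<bullet> \<beta> T) + ?k * \<alpha> T) + ((b T + ?k) *\<^sub>R \<beta> T) \<bullet> x" for x
      by (simp add: inner_simps inner_commute algebra_simps)
    then have "(\<integral>x. (a T + b T *\<^sub>R (x - barycenter T)) \<bullet> \<beta> T + ?k * (\<alpha> T + \<beta> T \<bullet> x) \<partial>lebesgue_on T)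
        = \<mu> T * ((a T \<bullet> \<beta> T - b T * (barycenter T \<bullet> \<beta> T) + ?k * \<alpha> T) + ((b T + ?k) *\<^sub>R \<beta> T) \<bullet> barycenter T)"
      by (simp only: integral_affine_simplex(1)[OF element[OF T]])
    also have "\<dots> = \<mu> T * (a T \<bullet> \<beta> T + ?k * (\<alpha> T + \<beta> T \<bullet> barycenter T))"
      by (simp add: inner_commute algebra_simps)
    finally show ?thesis
      using local_integration_by_parts[OF element[OF T], of "\<lambda>x. \<alpha> T + \<beta> T \<bullet> x" "\<lambda>_. \<beta> T" "a T" "b T"] GDERIV_affine
      by auto
  qed
  then have "(\<Sum>T\<in>\<T>. \<mu> T * (a T \<bullet> \<beta> T + real CARD('d) * b T * (\<alpha> T + \<beta> T \<bullet> barycenter T)))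
      = (\<Sum>T\<in>\<T>. \<Sum>v\<in>verts T. rt_coef T (a T) (b T) v * face_flux T v (\<lambda>x. \<alpha> T + \<beta> T \<bullet> x) (\<lambda>_. \<beta> T))"
    by (intro sum.cong refl)
  also have "\<dots> = (\<Sum>S\<in>sides \<T>. (real CARD('d) * l S) * flux_jump a b S)"
    by (rule sum_by_sides) (simp add: face_flux_affine[OF element] l)
  finally show ?thesis .
qed

text \<open>The local Crouzeix--Raviart basis function \<open>1 - d * bary T v\<close> with
  \<open>v\<close> opposite to \<open>S\<close>. At the barycenters of the other faces the
  coordinate is \<open>1 / d\<close>, so the value is 0. The sum over vertices spares naming
  \<open>v\<close> and gives 0 if \<open>S\<close> is no face of \<open>T\<close>.\<close>

definition cr_hat :: "(real ^ 'd) set \<Rightarrow> (real ^ 'd) set \<Rightarrow> real ^ 'd \<Rightarrow> real" where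
  "cr_hat S T x = (\<Sum>v\<in>verts T. if opp_face T v = S then 1 - CARD('d) * bary T v x else 0)"

definition cr_basis :: "(real ^ 'd) set \<Rightarrow> real ^ 'd \<Rightarrow> real" where
  "cr_basis S x = elementwise_const \<T> (\<lambda>T. cr_hat S T x) x"

lemma cr_basis_eq: "T \<in> \<T> \<Longrightarrow> x \<in> interior T \<Longrightarrow> cr_basis S x = cr_hat S T x"
  unfolding cr_basis_def by (rule elementwise_const_eq)

lemma continuous_cr_hat: "continuous_on A (cr_hat S T)"
proof -
  have "continuous_on A (\<lambda>x. if opp_face T v = S then 1 - CARD('d) * bary T v x else 0)" for v
    by (cases "opp_face T v = S") (auto intro!: continuous_intros)
  then show ?thesis unfolding cr_hat_def[abs_def] by (intro continuous_on_sum)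
qed

lemma cr_hat_barycenter:
  assumes T: "T \<in> \<T>" "w \<in> verts T"
  shows "cr_hat S T (barycenter (opp_face T w)) = (if opp_face T w = S then 1 else 0)"
proof -
  note fs = element[OF T(1)]
  define x0 where "x0 = barycenter (opp_face T w)"
  have "cr_hat S T x0 = (\<Sum>v\<in>verts T. if v = w then (if opp_face T w = S then 1 else 0) else 0)"
    unfolding cr_hat_def
  proof (rule sum.cong)
    fix v assume v: "v \<in> verts T"
    have "bary T v x0 = (if v = w then 0 else 1 / real CARD('d))"
      using bary_barycenter_face[OF fs T(2) v] by (auto simp: x0_def)
    then show "(if opp_face T v = S then 1 - CARD('d) * bary T v x0 else 0)
        = (if v = w then (if opp_face T w = S then 1 else 0) else 0)"
      by (cases "v = w") auto
  qed simp
  then show ?thesis using T finite_verts by (simp add: x0_def)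
qed

lemma is_P1_cr_basis: "\<exists>\<alpha> \<beta>. is_P1 (cr_basis S) \<alpha> \<beta>"
proof -
  define \<beta> where "\<beta> T = (\<Sum>v\<in>verts T. if opp_face T v = S then - CARD('d) *\<^sub>R bary_grad T v else 0)" for T
  have "cr_hat S T x = cr_hat S T 0 + \<beta> T \<bullet> x" for T x
    unfolding cr_hat_def \<beta>_def inner_sum_left sum.distrib[symmetric]
    by (intro sum.cong refl) (simp add: bary_def inner_simps algebra_simps)
  then have "is_P1 (cr_basis S) (\<lambda>T. cr_hat S T 0) \<beta>" unfolding is_P1_def using cr_basis_eq by metis
  then show ?thesis by blast
qed

text \<open>There are finitely many elements. Those containing the barycenter have \<open>S\<close>
  as a face, and their continuous local functions take the same value there; the others are closed
  and stay away.\<close>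

lemma cr_basis_limit:
  assumes S: "S \<in> sides \<T>"
  shows "(cr_basis S0 \<longlongrightarrow> (if S = S0 then 1 else 0)) (at (barycenter S) within skeleton_compl)"
proof (rule topological_tendstoI)
  let ?x = "barycenter S" and ?l = "if S = S0 then 1 else 0 :: real"
  fix O' :: "real set" assume O': "open O'" "?l \<in> O'"
  obtain T0 v0 where T0: "T0 \<in> \<T>" "v0 \<in> verts T0" "S = opp_face T0 v0" using sideE[OF S] by blast
  have "\<forall>\<^sub>F x in nhds ?x. x \<in> interior T \<longrightarrow> cr_basis S0 x \<in> O'" if T: "T \<in> \<T>" for T
  proof (cases "?x \<in> T")
    case True
    then obtain v where v: "v \<in> verts T" "S = opp_face T v"
      using barycenter_face_of_neighbour[OF T0(1,2) T] T0(3) by auto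
    have "isCont (cr_hat S0 T) ?x"
      using continuous_cr_hat[of UNIV] by (simp add: continuous_on_eq_continuous_at)
    then have "(cr_hat S0 T \<longlongrightarrow> cr_hat S0 T ?x) (nhds ?x)" by (simp add: continuous_at tendsto_at_iff_tendsto_nhds)
    moreover have "cr_hat S0 T ?x \<in> O'" using cr_hat_barycenter[OF T v(1)] v(2) O'(2) by simp
    ultimately have "\<forall>\<^sub>F x in nhds ?x. cr_hat S0 T x \<in> O'" using O'(1) topological_tendstoD by blast
    then show ?thesis by eventually_elim (simp add: cr_basis_eq[OF T])
  next
    case False
    have "open (- T)" using simplex_facts(3)[OF element[OF T]] by (simp add: open_Compl)
    then have "\<forall>\<^sub>F x in nhds ?x. x \<in> - T" by (rule eventually_nhds_in_open) (use False in simp)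
    then show ?thesis by eventually_elim (use interior_subset in auto)
  qed
  then have "\<forall>\<^sub>F x in nhds ?x. \<forall>T\<in>\<T>. x \<in> interior T \<longrightarrow> cr_basis S0 x \<in> O'"
    by (intro eventually_ball_finite finite_mesh) blast
  then show "\<forall>\<^sub>F x in at ?x within skeleton_compl. cr_basis S0 x \<in> O'"
    unfolding eventually_at_filter by eventually_elim blast
qed

lemma cr_basis_CR_D:
  assumes S: "\<not> (S0 \<in> boundary_sides \<Omega> \<T> \<and> side_within S0 \<Gamma>D)"
  shows "cr_basis S0 \<in> CR_D \<Omega> \<Gamma>D \<T>"
proof -
  have "(cr_basis S0 \<longlongrightarrow> 0) (at (barycenter S) within skeleton_compl)"
    if "S \<in> boundary_sides \<Omega> \<T>" "side_within S \<Gamma>D" for S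
  proof -
    have "S \<noteq> S0" "S \<in> sides \<T>" using that S by (auto simp: boundary_sides_def)
    then show ?thesis using cr_basis_limit[of S S0] by simp
  qed
  moreover have "\<exists>l. (cr_basis S0 \<longlongrightarrow> l) (at (barycenter S) within skeleton_compl)" if "S \<in> sides \<T>" for S
    using cr_basis_limit[OF that] by blast
  moreover have "cr_basis S0 \<in> piecewise_polynomials 1 \<T>"
    unfolding piecewise_polynomials_1 by (rule is_P1_cr_basis)
  ultimately show ?thesis unfolding CR_D_def CR_def by blast
qed

lemma is_P1_add: "is_P1 u \<alpha> \<beta> \<Longrightarrow> is_P1 w \<alpha>' \<beta>' \<Longrightarrow>
    is_P1 (\<lambda>x. u x + t * w x) (\<lambda>T. \<alpha> T + t * \<alpha>' T) (\<lambda>T. \<beta> T + t *\<^sub>R \<beta>' T)"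
  unfolding is_P1_def by (simp add: inner_simps algebra_simps)

lemma CR_D_add:
  assumes u: "u \<in> CR_D \<Omega> \<Gamma>D \<T>" and w: "w \<in> CR_D \<Omega> \<Gamma>D \<T>"
  shows "(\<lambda>x. u x + t * w x) \<in> CR_D \<Omega> \<Gamma>D \<T>"
proof -
  have lim: "((\<lambda>x. u x + t * w x) \<longlongrightarrow> l + t * m) F"
    if "(u \<longlongrightarrow> l) F" "(w \<longlongrightarrow> m) F" for l m F by (intro tendsto_intros that)
  have "(\<lambda>x. u x + t * w x) \<in> piecewise_polynomials 1 \<T>"
    using u w is_P1_add unfolding CR_D_def CR_def piecewise_polynomials_1 by blast
  moreover have "\<exists>l. ((\<lambda>x. u x + t * w x) \<longlongrightarrow> l) (at (barycenter S) within skeleton_compl)" if "S \<in> sides \<T>" for S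
    using u w lim that unfolding CR_D_def CR_def by blast
  moreover have "((\<lambda>x. u x + t * w x) \<longlongrightarrow> 0) (at (barycenter S) within skeleton_compl)"
    if "S \<in> boundary_sides \<Omega> \<T>" "side_within S \<Gamma>D" for S
    using u w lim[of 0 _ 0] that unfolding CR_D_def by auto
  ultimately show ?thesis unfolding CR_D_def CR_def by blast
qed

lemma CR_D_P1: "u \<in> CR_D \<Omega> \<Gamma>D \<T> \<Longrightarrow> \<exists>\<alpha> \<beta>. is_P1 u \<alpha> \<beta>"
  unfolding CR_D_def CR_def piecewise_polynomials_1 by blast

end

section \<open>Duality\<close>

lemma surface_null_subset: "surface_null N \<Longrightarrow> M \<subseteq> N \<Longrightarrow> surface_null M"
  unfolding surface_null_def
proof
  fix v
  assume N: "\<forall>v. negligible {x + t *\<^sub>R v |x t. x \<in> N \<and> t \<in> {0..1::real}}" and "M \<subseteq> N"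
  from N have "negligible {x + t *\<^sub>R v |x t. x \<in> N \<and> t \<in> {0..1::real}}" by (rule spec)
  then show "negligible {x + t *\<^sub>R v |x t. x \<in> M \<and> t \<in> {0..1::real}}"
    by (rule negligible_subset) (use \<open>M \<subseteq> N\<close> in blast)
qed

lemma surface_null_Un:
  assumes "surface_null M" "surface_null N"
  shows "surface_null (M \<union> N)"
  unfolding surface_null_def
proof
  fix v
  have "negligible ({x + t *\<^sub>R v | x t. x \<in> M \<and> t \<in> {0..1::real}} \<union> {x + t *\<^sub>R v | x t. x \<in> N \<and> t \<in> {0..1::real}})"
    using assms unfolding surface_null_def by (intro negligible_Un) auto
  then show "negligible {x + t *\<^sub>R v | x t. x \<in> M \<union> N \<and> t \<in> {0..1::real}}"
    by (rule negligible_subset) blast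
qed

lemma surface_null_empty: "surface_null {}"
  by (simp add: surface_null_def)

text \<open>The prism over a face towards the opposite vertex contains the simplex.\<close>

lemma face_not_surface_null:
  fixes T :: "'a::euclidean_space set"
  assumes T: "full_simplex T" and v: "v \<in> verts T"
  shows "\<not> surface_null (opp_face T v)"
proof
  assume sn: "surface_null (opp_face T v)"
  define x0 where "x0 = barycenter (opp_face T v)"
  define e where "e = v - x0"
  have be: "bary_grad T w \<bullet> e = (if w = v then 1 else - (1 / DIM('a)))" if w: "w \<in> verts T" for w
    using bary_diff[of T w v x0] bary_vertex[OF T w v] bary_barycenter_face[OF T v w]
    by (auto simp: e_def x0_def split: if_splits)
  have "T \<subseteq> {x + t *\<^sub>R e | x t. x \<in> opp_face T v \<and> t \<in> {0..1::real}}"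
  proof
    fix p assume p: "p \<in> T"
    define t where "t = bary T v p"
    have b0: "0 \<le> bary T w p" if "w \<in> verts T" for w using simplex_bary(1)[OF T] p that by blast
    have "(\<Sum>w\<in>{v}. bary T w p) \<le> (\<Sum>w\<in>verts T. bary T w p)"
      using v b0 full_simplex_verts(1)[OF T] by (intro sum_mono2) auto
    then have t: "0 \<le> t" "t \<le> 1" using b0[OF v] bary_sum(1)[OF T] by (auto simp: t_def)
    define x where "x = p - t *\<^sub>R e"
    have bx: "bary T w x = bary T w p - t * (bary_grad T w \<bullet> e)" for w
      by (simp add: x_def bary_def inner_simps)
    have "bary T w x = (if w = v then 0 else bary T w p + t / DIM('a))" if "w \<in> verts T" for w
      unfolding bx be[OF that] by (simp add: t_def)
    then have "x \<in> opp_face T v"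
      unfolding opp_face_iff[OF T v] simplex_bary(1)[OF T] using b0 t v by simp
    moreover have "p = x + t *\<^sub>R e" by (simp add: x_def)
    ultimately show "p \<in> {x + t *\<^sub>R e | x t. x \<in> opp_face T v \<and> t \<in> {0..1::real}}" using t by auto
  qed
  then have "negligible T" using sn negligible_subset unfolding surface_null_def by blast
  then have "measure lebesgue T = 0" using negligible_iff_measure by blast
  then show False using simplex_facts(7)[OF T] by simp
qed

lemma outer_normal_exists:
  fixes T :: "'a::euclidean_space set"
  assumes T: "full_simplex T" and v: "v \<in> verts T"
  obtains n where "outer_unit_normal T (opp_face T v) n" "\<And>x. x \<in> opp_face T v \<Longrightarrow> 0 < (x - v) \<bullet> n"
proof
  define \<gamma> where "\<gamma> = bary_grad T v"
  define n where "n = - (1 / norm \<gamma>) *\<^sub>R \<gamma>"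
  have b: "\<gamma> \<bullet> (x - y) = bary T v x - bary T v y" for x y
    using bary_diff[of T v x y] by (simp add: \<gamma>_def)
  have "\<gamma> \<bullet> (barycenter (opp_face T v) - v) = - 1"
    unfolding b using bary_vertex[OF T v v] bary_barycenter_face[OF T v v] by simp
  then have \<gamma>: "\<gamma> \<noteq> 0" by auto
  have nn: "n \<bullet> (x - y) = - (1 / norm \<gamma>) * (bary T v x - bary T v y)" for x y
    unfolding b[symmetric] by (simp add: n_def)
  show "outer_unit_normal T (opp_face T v) n"
    unfolding outer_unit_normal_def
  proof (intro conjI ballI)
    show "norm n = 1" using \<gamma> by (simp add: n_def)
    show "n \<bullet> (x - y) = 0" if "x \<in> opp_face T v" "y \<in> opp_face T v" for x y
      unfolding nn using that opp_face_iff[OF T v] by simp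
    show "n \<bullet> (x - y) \<le> 0" if "x \<in> T" "y \<in> opp_face T v" for x y
      unfolding nn using that opp_face_iff[OF T v] simplex_bary(1)[OF T] v by simp
  qed
  show "0 < (x - v) \<bullet> n" if "x \<in> opp_face T v" for x
    using nn[of x v] that opp_face_iff[OF T v] bary_vertex[OF T v v] \<gamma> by (simp add: inner_commute)
qed

section \<open>Boundary conditions, discrete integration by parts and weak duality\<close>

locale cr_rt_duality = mesh \<Omega> \<T>
  for \<Omega> :: "(real ^ 'd) set" and \<T> +
  fixes \<Gamma>D \<Gamma>N :: "(real ^ 'd) set" and \<phi> :: "real ^ 'd \<Rightarrow> real" and \<psi> :: "real ^ 'd \<Rightarrow> real \<Rightarrow> ereal"
  assumes Gamma: "\<Gamma>N = frontier \<Omega> - \<Gamma>D"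
    and bdry: "\<forall>S \<in> boundary_sides \<Omega> \<T>. side_within S \<Gamma>D \<or> side_within S \<Gamma>N"
    and phi: "convex_on UNIV \<phi>"
    and psi: "\<forall>x \<in> \<Omega>. ereal_proper (\<psi> x) \<and> ereal_convex (\<psi> x)"
    and psi_const: "\<forall>T \<in> \<T>. \<forall>x \<in> interior T. \<forall>y \<in> interior T. \<psi> x = \<psi> y"
begin

abbreviation "primal \<equiv> I_h \<Omega> \<T> \<phi> \<psi>"

abbreviation "dual \<equiv> D_h \<Omega> \<T> \<phi> \<psi>"

abbreviation "CR0 \<equiv> CR_D \<Omega> \<Gamma>D \<T>"

abbreviation "RT0N \<equiv> RT0_N \<Omega> \<Gamma>N \<T>"

abbreviation "phi_conj \<equiv> convex_conjugate (\<lambda>s. ereal (\<phi> s))"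

abbreviation dirichlet_side :: "(real ^ 'd) set \<Rightarrow> bool" where
  "dirichlet_side S \<equiv> S \<in> boundary_sides \<Omega> \<T> \<and> side_within S \<Gamma>D"

abbreviation mid :: "((real ^ 'd) set \<Rightarrow> real) \<Rightarrow> ((real ^ 'd) set \<Rightarrow> real ^ 'd) \<Rightarrow> (real ^ 'd) set \<Rightarrow> real" where
  "mid \<alpha> \<beta> T \<equiv> \<alpha> T + \<beta> T \<bullet> barycenter T"

lemma psi_eq: "T \<in> \<T> \<Longrightarrow> x \<in> interior T \<Longrightarrow> \<psi> x = \<psi> (barycenter T)"
  using psi_const bary_barycenter(2)[OF element] by blast

lemma RT0_is_RT: "y \<in> RT0N \<Longrightarrow> \<exists>a b. is_RT y a b"
  unfolding RT0_N_def RT0_def is_RT_def by simp metis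

lemma RT_normal_component:
  assumes y: "is_RT y a b" and T: "T \<in> \<T>" "v \<in> verts T" and x: "x \<in> opp_face T v"
    and n: "\<forall>x\<in>opp_face T v. \<forall>y\<in>opp_face T v. n \<bullet> (x - y) = 0"
  shows "on_element T y x \<bullet> n = rt_coef T (a T) (b T) v * ((x - v) \<bullet> n)"
proof -
  note fs = element[OF T(1)]
  have "x \<in> T" using opp_face_subset[OF fs T(2)] x by blast
  then have "on_element T y x = a T + b T *\<^sub>R (x - barycenter T)"
    by (rule on_element_eq[OF T(1)]) (use y T in \<open>auto simp: is_RT_def intro!: continuous_intros\<close>)
  then have "on_element T y x \<bullet> n = (\<Sum>w\<in>verts T. rt_coef T (a T) (b T) w * ((x - w) \<bullet> n))"
    by (simp add: rt_coef(2)[OF fs, symmetric] inner_sum_left)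
  also have "\<dots> = (\<Sum>w\<in>verts T. if w = v then rt_coef T (a T) (b T) w * ((x - w) \<bullet> n) else 0)"
  proof (rule sum.cong)
    fix w assume w: "w \<in> verts T"
    have "w \<in> opp_face T v" if "w \<noteq> v" unfolding opp_face_def using w that by (intro hull_inc) simp
    then show "rt_coef T (a T) (b T) w * ((x - w) \<bullet> n) = (if w = v then rt_coef T (a T) (b T) w * ((x - w) \<bullet> n) else 0)"
      using n x by (auto simp: inner_commute)
  qed simp
  finally show ?thesis using T finite_verts by simp
qed

text \<open>The normal component is the coefficient times a positive function on the face. If the
  coefficient were nonzero, the boundary condition would make the part of the face in
  \<open>\<Gamma>N\<close> null; as the side belongs to \<open>\<Gamma>N\<close> up to a null set,
  the whole face would be null.\<close>

lemma RT0_N_coef: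
  assumes y: "y \<in> RT0N" "is_RT y a b" and T: "T \<in> \<T>" "v \<in> verts T"
    and S: "opp_face T v \<in> boundary_sides \<Omega> \<T>" "\<not> side_within (opp_face T v) \<Gamma>D"
  shows "rt_coef T (a T) (b T) v = 0"
proof (rule ccontr)
  assume c: "rt_coef T (a T) (b T) v \<noteq> 0"
  note fs = element[OF T(1)]
  let ?S = "opp_face T v"
  obtain n where n: "outer_unit_normal T ?S n" "\<And>x. x \<in> ?S \<Longrightarrow> 0 < (x - v) \<bullet> n"
    using outer_normal_exists[OF fs T(2)] by blast
  have "?S facet_of T" using facet_of_simplex[OF fs] T(2) by blast
  then have "surface_null {x \<in> ?S \<inter> \<Gamma>N. on_element T y x \<bullet> n \<noteq> 0}"
    using y(1) S(1) T(1) n(1) unfolding RT0_N_def by blast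
  moreover have "on_element T y x \<bullet> n \<noteq> 0" if "x \<in> ?S" for x
    using RT_normal_component[OF y(2) T that] n c that unfolding outer_unit_normal_def by force
  then have "{x \<in> ?S \<inter> \<Gamma>N. on_element T y x \<bullet> n \<noteq> 0} = ?S \<inter> \<Gamma>N" by blast
  moreover have "surface_null (?S - \<Gamma>N)" using bdry S unfolding side_within_def by blast
  ultimately have "surface_null ((?S \<inter> \<Gamma>N) \<union> (?S - \<Gamma>N))" using surface_null_Un by metis
  moreover have "(?S \<inter> \<Gamma>N) \<union> (?S - \<Gamma>N) = ?S" by blast
  ultimately show False using face_not_surface_null[OF fs T(2)] by simp
qed

lemma RT0_N_flux_jump:
  assumes y: "y \<in> RT0N" "is_RT y a b" and S: "S \<in> sides \<T>" "\<not> dirichlet_side S"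
  shows "flux_jump a b S = 0"
proof (cases "barycenter S \<in> \<Omega>")
  case True
  obtain g where "has_weak_div \<Omega> y g" using y(1) unfolding RT0_N_def RT0_def by blast
  from flux_jump_RT[OF y(2) this S(1) True] show ?thesis .
next
  case False
  obtain T v where T: "T \<in> \<T>" "v \<in> verts T" "S = opp_face T v" using sideE[OF S(1)] by blast
  have "S \<in> boundary_sides \<Omega> \<T>" using boundary_side_iff[OF T(1,2)] T(3) False by simp
  then have "rt_coef T (a T) (b T) v = 0" using RT0_N_coef[OF y T(1,2)] S(2) T(3) by blast
  then show ?thesis using flux_jump_boundary[OF T(1,2)] False T(3) by simp
qed

lemma RT0_N_I:
  assumes y: "is_RT y a b" and j: "\<And>S. S \<in> sides \<T> \<Longrightarrow> \<not> dirichlet_side S \<Longrightarrow> flux_jump a b S = 0"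
  shows "y \<in> RT0N"
proof -
  have "barycenter S \<notin> \<Omega>" if S: "S \<in> boundary_sides \<Omega> \<T>" for S
  proof -
    obtain T v where T: "T \<in> \<T>" "v \<in> verts T" "S = opp_face T v"
      using S unfolding boundary_sides_def sides_eq vfaces_def by auto
    then show ?thesis using boundary_side_iff[OF T(1,2)] S by simp
  qed
  then have "has_weak_div \<Omega> y (div_h b)" using j by (intro has_weak_div_RT[OF y]) blast
  moreover have "integrable (lebesgue_on \<Omega>) y" by (rule integrable_is_RT[OF y])
  moreover have "\<forall>T\<in>\<T>. \<exists>a b. \<forall>x\<in>interior T. y x = a + b *\<^sub>R (x - barycenter T)"
    using y unfolding is_RT_def by blast
  ultimately have "y \<in> RT0 \<Omega> \<T>" unfolding RT0_def by blast
  moreover have "surface_null {x \<in> S \<inter> \<Gamma>N. on_element T y x \<bullet> n \<noteq> 0}"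
    if S: "S \<in> boundary_sides \<Omega> \<T>" and T: "T \<in> \<T>" "S facet_of T" and n: "outer_unit_normal T S n" for S T n
  proof (cases "side_within S \<Gamma>D")
    case True
    \<comment> \<open>On a side that belongs to \<open>\<Gamma>D\<close> the Neumann condition
      concerns a null set only and holds for every field.\<close>
    have "S \<inter> \<Gamma>N \<subseteq> S - \<Gamma>D" unfolding Gamma by blast
    then show ?thesis using True surface_null_subset[of "S - \<Gamma>D" "{x \<in> S \<inter> \<Gamma>N. on_element T y x \<bullet> n \<noteq> 0}"]
      unfolding side_within_def by blast
  next
    case False
    obtain v where v: "v \<in> verts T" "S = opp_face T v" using facet_of_simplex[OF element[OF T(1)]] T(2) by blast
    have out: "barycenter (opp_face T v) \<notin> \<Omega>" using boundary_side_iff[OF T(1) v(1)] S v(2) by simp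
    have "flux_jump a b S = 0" using j False S unfolding boundary_sides_def by blast
    then have "rt_coef T (a T) (b T) v = 0"
      using flux_jump_boundary[OF T(1) v(1) out] measure_pos[OF T(1)] v(2) by simp
    then have "on_element T y x \<bullet> n = 0" if "x \<in> S" for x
      using RT_normal_component[OF y T(1) v(1)] that n v(2) unfolding outer_unit_normal_def by force
    then have "{x \<in> S \<inter> \<Gamma>N. on_element T y x \<bullet> n \<noteq> 0} = {}" by blast
    then show ?thesis by (simp only: surface_null_empty)
  qed
  ultimately show ?thesis unfolding RT0_N_def by blast
qed

text \<open>Each side contributes its barycenter value times its flux jump: on Dirichlet sides the
  value vanishes, on all others the jump.\<close>

lemma discrete_integration_by_parts:
  assumes u: "u \<in> CR0" "is_P1 u \<alpha> \<beta>" and y: "y \<in> RT0N" "is_RT y a b"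
  shows "(\<Sum>T\<in>\<T>. \<mu> T * (a T \<bullet> \<beta> T + real CARD('d) * b T * mid \<alpha> \<beta> T)) = 0"
proof -
  have "\<exists>l. \<forall>S\<in>sides \<T>. (u \<longlongrightarrow> l S) (at (barycenter S) within skeleton_compl)"
    using u(1) unfolding CR_D_def CR_def by (intro bchoice) blast
  then obtain l where l: "\<And>S. S \<in> sides \<T> \<Longrightarrow> (u \<longlongrightarrow> l S) (at (barycenter S) within skeleton_compl)" by blast
  have lv: "\<alpha> T + \<beta> T \<bullet> barycenter (opp_face T v) = l (opp_face T v)" if T: "T \<in> \<T>" "v \<in> verts T" for T v
    by (rule P1_side_value[OF u(2) T l[OF opp_face_in_sides[OF T]]])
  have "(real CARD('d) * l S) * flux_jump a b S = 0" if S: "S \<in> sides \<T>" for S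
  proof (cases "dirichlet_side S")
    case True
    obtain T v where T: "T \<in> \<T>" "v \<in> verts T" "S = opp_face T v" using sideE[OF S] by blast
    have "(u \<longlongrightarrow> 0) (at (barycenter S) within skeleton_compl)" using u(1) True unfolding CR_D_def by blast
    then have "l S = 0" using P1_side_value[OF u(2) T(1,2), of 0] lv[OF T(1,2)] T(3) by simp
    then show ?thesis by simp
  qed (simp add: RT0_N_flux_jump[OF y S])
  then have "(\<Sum>S\<in>sides \<T>. (real CARD('d) * l S) * flux_jump a b S) = 0" by (rule sum.neutral[rule_format])
  then show ?thesis using RT_P1_pairing[of \<alpha> \<beta> l a b, OF lv] by simp
qed

lemma psi_not_MInf: "T \<in> \<T> \<Longrightarrow> \<psi> (barycenter T) s \<noteq> - \<infinity>"
  using psi barycenter_in_domain unfolding ereal_proper_def by blast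

lemma I_h_eq:
  assumes u: "is_P1 u \<alpha> \<beta>"
  shows "primal u = (\<Sum>T\<in>\<T>. ereal (\<mu> T) * ereal (\<phi> (\<beta> T)))
       + (\<Sum>T\<in>\<T>. ereal (\<mu> T) * \<psi> (barycenter T) (mid \<alpha> \<beta> T))"
proof -
  have "ereal_integral (lebesgue_on \<Omega>) (\<lambda>x. ereal (\<phi> (grad_h \<T> u x))) = (\<Sum>T\<in>\<T>. ereal (\<mu> T) * ereal (\<phi> (\<beta> T)))"
    by (rule ereal_integral_mesh) (auto simp: grad_h_P1[OF u])
  moreover have "ereal_integral (lebesgue_on \<Omega>) (\<lambda>x. \<psi> x (L2_proj0 \<T> u x))
      = (\<Sum>T\<in>\<T>. ereal (\<mu> T) * \<psi> (barycenter T) (mid \<alpha> \<beta> T))"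
    by (rule ereal_integral_mesh) (auto simp: L2_proj0_P1[OF u] psi_eq psi_not_MInf)
  ultimately show ?thesis unfolding I_h_def by simp
qed

lemma conjugate_not_MInf:
  "phi_conj t \<noteq> - \<infinity>"
  "T \<in> \<T> \<Longrightarrow> convex_conjugate (\<psi> (barycenter T)) r \<noteq> - \<infinity>"
proof -
  show "phi_conj t \<noteq> - \<infinity>"
    using fenchel_young[of t 0 "\<lambda>s. ereal (\<phi> s)"] by auto
  assume T: "T \<in> \<T>"
  obtain s where "\<psi> (barycenter T) s \<noteq> \<infinity>"
    using psi barycenter_in_domain[OF T] unfolding ereal_proper_def by blast
  then obtain q where "\<psi> (barycenter T) s = ereal q" using psi_not_MInf[OF T, of s] by (cases "\<psi> (barycenter T) s") auto
  then show "convex_conjugate (\<psi> (barycenter T)) r \<noteq> - \<infinity>"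
    using fenchel_young[of r s "\<psi> (barycenter T)"] by auto
qed

lemma weak_div_eq:
  assumes "y \<in> RT0N" "is_RT y a b"
  shows "AE x in lebesgue_on \<Omega>. \<forall>T\<in>\<T>. x \<in> interior T \<longrightarrow> weak_div \<Omega> y x = real CARD('d) * b T"
proof -
  have "AE x in lebesgue_on \<Omega>. weak_div \<Omega> y x = div_h b x"
    using assms by (intro weak_div_RT) (auto simp: RT0_N_def RT0_def)
  then show ?thesis by eventually_elim (auto simp: div_h_def elementwise_const_eq)
qed

lemma D_h_eq:
  assumes z: "z \<in> RT0N" "is_RT z a b"
  shows "dual z = - (\<Sum>T\<in>\<T>. ereal (\<mu> T) * phi_conj (a T))
       - (\<Sum>T\<in>\<T>. ereal (\<mu> T) * convex_conjugate (\<psi> (barycenter T)) (real CARD('d) * b T))"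
proof -
  have "ereal_integral (lebesgue_on \<Omega>) (\<lambda>x. phi_conj (L2_proj0 \<T> z x))
      = (\<Sum>T\<in>\<T>. ereal (\<mu> T) * phi_conj (a T))"
    by (rule ereal_integral_mesh) (auto simp: L2_proj0_RT[OF z(2)] conjugate_not_MInf)
  moreover have "ereal_integral (lebesgue_on \<Omega>) (\<lambda>x. convex_conjugate (\<psi> x) (weak_div \<Omega> z x))
      = (\<Sum>T\<in>\<T>. ereal (\<mu> T) * convex_conjugate (\<psi> (barycenter T)) (real CARD('d) * b T))"
  proof (rule ereal_integral_mesh)
    show "AE x in lebesgue_on \<Omega>. \<forall>T\<in>\<T>. x \<in> interior T \<longrightarrow>
        convex_conjugate (\<psi> x) (weak_div \<Omega> z x) = convex_conjugate (\<psi> (barycenter T)) (real CARD('d) * b T)"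
      using weak_div_eq[OF z] by eventually_elim (auto simp: psi_eq)
  qed (rule conjugate_not_MInf)
  ultimately show ?thesis unfolding D_h_def by simp
qed

lemma sum_conjugate_lower:
  assumes "\<And>T. T \<in> \<T> \<Longrightarrow> ereal (p T) \<le> X T"
  shows "ereal (\<Sum>T\<in>\<T>. \<mu> T * p T) \<le> (\<Sum>T\<in>\<T>. ereal (\<mu> T) * X T)"
proof -
  have "(\<Sum>T\<in>\<T>. ereal (\<mu> T) * ereal (p T)) \<le> (\<Sum>T\<in>\<T>. ereal (\<mu> T) * X T)"
    using assms by (intro sum_mono ereal_mult_left_mono) auto
  then show ?thesis by simp
qed

lemma weak_duality:
  assumes u: "u \<in> CR0" and z: "z \<in> RT0N"
  shows "dual z \<le> primal u"
proof -
  obtain \<alpha> \<beta> where P: "is_P1 u \<alpha> \<beta>" using CR_D_P1[OF u] by blast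
  obtain a b where R: "is_RT z a b" using RT0_is_RT[OF z] by blast
  let ?\<psi> = "\<lambda>T. \<psi> (barycenter T)"
  show ?thesis
  proof (cases "\<exists>T\<in>\<T>. ?\<psi> T (mid \<alpha> \<beta> T) = \<infinity>")
    case True
    then obtain T where T: "T \<in> \<T>" "?\<psi> T (mid \<alpha> \<beta> T) = \<infinity>" by blast
    have "(\<Sum>T\<in>\<T>. ereal (\<mu> T) * ?\<psi> T (mid \<alpha> \<beta> T)) = \<infinity>"
      using T measure_pos[OF T(1)] finite_mesh by (subst sum_Pinfty) auto
    then show ?thesis unfolding I_h_eq[OF P] by simp
  next
    case False
    define \<rho> where "\<rho> T = real_of_ereal (?\<psi> T (mid \<alpha> \<beta> T))" for T
    have \<rho>: "?\<psi> T (mid \<alpha> \<beta> T) = ereal (\<rho> T)" if T: "T \<in> \<T>" for T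
      using False psi_not_MInf[OF T] T by (auto simp: \<rho>_def ereal_real)
    have 1: "ereal (\<Sum>T\<in>\<T>. \<mu> T * (a T \<bullet> \<beta> T - \<phi> (\<beta> T))) \<le> (\<Sum>T\<in>\<T>. ereal (\<mu> T) * phi_conj (a T))"
      by (rule sum_conjugate_lower) (use fenchel_young[of _ _ "\<lambda>s. ereal (\<phi> s)"] in simp)
    have 2: "ereal (\<Sum>T\<in>\<T>. \<mu> T * (real CARD('d) * b T * mid \<alpha> \<beta> T - \<rho> T)) \<le> (\<Sum>T\<in>\<T>. ereal (\<mu> T) * convex_conjugate (?\<psi> T) (real CARD('d) * b T))"
    proof (rule sum_conjugate_lower)
      fix T assume T: "T \<in> \<T>"
      show "ereal (real CARD('d) * b T * mid \<alpha> \<beta> T - \<rho> T) \<le> convex_conjugate (?\<psi> T) (real CARD('d) * b T)"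
        using fenchel_young[of "real CARD('d) * b T" "mid \<alpha> \<beta> T" "?\<psi> T"] by (simp add: \<rho>[OF T])
    qed
    have I: "primal u = ereal ((\<Sum>T\<in>\<T>. \<mu> T * \<phi> (\<beta> T)) + (\<Sum>T\<in>\<T>. \<mu> T * \<rho> T))"
      unfolding I_h_eq[OF P] by (simp add: \<rho>)
    have "(\<Sum>T\<in>\<T>. \<mu> T * (a T \<bullet> \<beta> T - \<phi> (\<beta> T))) + (\<Sum>T\<in>\<T>. \<mu> T * (real CARD('d) * b T * mid \<alpha> \<beta> T - \<rho> T))
        = (\<Sum>T\<in>\<T>. \<mu> T * (a T \<bullet> \<beta> T + real CARD('d) * b T * mid \<alpha> \<beta> T)) - ((\<Sum>T\<in>\<T>. \<mu> T * \<phi> (\<beta> T)) + (\<Sum>T\<in>\<T>. \<mu> T * \<rho> T))"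
      by (simp add: sum.distrib[symmetric] sum_subtractf[symmetric] algebra_simps)
    then have eq: "(\<Sum>T\<in>\<T>. \<mu> T * (a T \<bullet> \<beta> T - \<phi> (\<beta> T))) + (\<Sum>T\<in>\<T>. \<mu> T * (real CARD('d) * b T * mid \<alpha> \<beta> T - \<rho> T))
        = - ((\<Sum>T\<in>\<T>. \<mu> T * \<phi> (\<beta> T)) + (\<Sum>T\<in>\<T>. \<mu> T * \<rho> T))"
      using discrete_integration_by_parts[OF u P z R] by simp
    \<comment> \<open>A sum of conjugates may be \<open>\<infinity>\<close>, and then the dual value
      is \<open>- \<infinity>\<close>; otherwise this is real arithmetic.\<close>
    have aux: "- X - Y \<le> ereal r" if "ereal p \<le> X" "ereal q \<le> Y" "p + q = - r" for X Y p q r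
      using that by (cases X; cases Y) auto
    show ?thesis unfolding D_h_eq[OF z R] I by (rule aux[OF 1 2 eq])
  qed
qed

end

section \<open>Optimality and strong duality for differentiable data\<close>

locale cr_rt_duality_differentiable = cr_rt_duality \<Omega> \<T> \<Gamma>D \<Gamma>N \<phi> \<psi>
  for \<Omega> :: "(real ^ 'd) set" and \<T> \<Gamma>D \<Gamma>N \<phi> \<psi> +
  assumes phi_diff: "\<forall>t. \<phi> differentiable (at t)"
    and psi_diff: "\<forall>x \<in> \<Omega>. \<forall>s. ereal_differentiable_at (\<psi> x) s"
begin

definition \<rho> :: "(real ^ 'd) set \<Rightarrow> real \<Rightarrow> real" where
  "\<rho> T s = real_of_ereal (\<psi> (barycenter T) s)"

definition D\<rho> :: "(real ^ 'd) set \<Rightarrow> real \<Rightarrow> real" where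
  "D\<rho> T s = ereal_gradient (\<psi> (barycenter T)) s"

lemma phi_gradient: "GDERIV \<phi> t :> gradient \<phi> t"
  using phi_diff differentiable_GDERIV by blast

text \<open>Differentiability at every \<open>s\<close> includes finiteness near \<open>s\<close>,
  so on each element \<open>\<psi>\<close> is a real convex function and real calculus
  applies.\<close>

lemma psi_rho:
  assumes T: "T \<in> \<T>"
  shows "\<psi> (barycenter T) = (\<lambda>s. ereal (\<rho> T s))" "GDERIV (\<rho> T) s :> D\<rho> T s" "convex_on UNIV (\<rho> T)"
proof -
  have d: "ereal_differentiable_at (\<psi> (barycenter T)) s" for s
    using psi_diff barycenter_in_domain[OF T] by blast
  show eq: "\<psi> (barycenter T) = (\<lambda>s. ereal (\<rho> T s))"
    using ereal_differentiable_finite(1)[OF d] by (simp add: \<rho>_def fun_eq_iff)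
  show "GDERIV (\<rho> T) s :> D\<rho> T s"
    using ereal_differentiable_finite(2)[OF d] by (simp add: \<rho>_def[abs_def] D\<rho>_def)
  show "convex_on UNIV (\<rho> T)"
    using psi barycenter_in_domain[OF T] eq by (intro ereal_convex_real) auto
qed

definition J :: "((real ^ 'd) set \<Rightarrow> real) \<Rightarrow> ((real ^ 'd) set \<Rightarrow> real ^ 'd) \<Rightarrow> real" where
  "J \<alpha> \<beta> = (\<Sum>T\<in>\<T>. \<mu> T * (\<phi> (\<beta> T) + \<rho> T (mid \<alpha> \<beta> T)))"

lemma I_h_J:
  assumes u: "is_P1 u \<alpha> \<beta>"
  shows "primal u = ereal (J \<alpha> \<beta>)"
proof -
  have "(\<Sum>T\<in>\<T>. ereal (\<mu> T) * \<psi> (barycenter T) (mid \<alpha> \<beta> T)) = (\<Sum>T\<in>\<T>. ereal (\<mu> T * \<rho> T (mid \<alpha> \<beta> T)))"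
    by (intro sum.cong refl) (simp add: psi_rho)
  then show ?thesis unfolding I_h_eq[OF u] J_def by (simp add: distrib_left sum.distrib)
qed

text \<open>Stationarity of the energy in the direction of the Crouzeix--Raviart basis function of a
  side is the continuity of the normal flux of the reconstructed field across that side.\<close>

lemma optimality_flux_jump:
  assumes u: "is_arg_min (primal) (\<lambda>v. v \<in> CR0) u" and P: "is_P1 u \<alpha> \<beta>"
    and S: "S \<in> sides \<T>" "\<not> dirichlet_side S"
  shows "flux_jump (\<lambda>T. gradient \<phi> (\<beta> T)) (\<lambda>T. D\<rho> T (mid \<alpha> \<beta> T) / real CARD('d)) S = 0"
proof -
  have uC: "u \<in> CR0" using u unfolding is_arg_min_def by blast
  obtain \<alpha>' \<beta>' where W: "is_P1 (cr_basis S) \<alpha>' \<beta>'" using is_P1_cr_basis by blast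
  have wC: "cr_basis S \<in> CR0" by (rule cr_basis_CR_D[OF S(2)])
  \<comment> \<open>The barycenter values of the basis function: its pairing with a field reduces to
    the flux jump at \<open>S\<close>.\<close>
  define l where "l S' = (if S' = S then 1 else 0 :: real)" for S'
  have lv: "\<alpha>' T + \<beta>' T \<bullet> barycenter (opp_face T v) = l (opp_face T v)" if T: "T \<in> \<T>" "v \<in> verts T" for T v
    unfolding l_def by (rule P1_side_value[OF W T cr_basis_limit[OF opp_face_in_sides[OF T]]])
  let ?j = "\<lambda>t. J (\<lambda>T. \<alpha> T + t * \<alpha>' T) (\<lambda>T. \<beta> T + t *\<^sub>R \<beta>' T)"
  have min: "?j 0 \<le> ?j t" for t
  proof -
    have "\<not> primal (\<lambda>x. u x + t * cr_basis S x) < primal u"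
      using u CR_D_add[OF uC wC] unfolding is_arg_min_def by blast
    then show ?thesis unfolding I_h_J[OF is_P1_add[OF P W]] I_h_J[OF P] by simp
  qed
  let ?D = "\<Sum>T\<in>\<T>. \<mu> T * (gradient \<phi> (\<beta> T) \<bullet> \<beta>' T + D\<rho> T (mid \<alpha> \<beta> T) * mid \<alpha>' \<beta>' T)"
  have "(?j has_real_derivative ?D) (at 0)"
    unfolding J_def
  proof (rule DERIV_sum)
    fix T assume T: "T \<in> \<T>"
    have 1: "((\<lambda>t. \<phi> (\<beta> T + t *\<^sub>R \<beta>' T)) has_real_derivative gradient \<phi> (\<beta> T) \<bullet> \<beta>' T) (at 0)"
      by (rule GDERIV_line) (use phi_gradient in simp)
    have "((\<lambda>t. \<rho> T (mid \<alpha> \<beta> T + t *\<^sub>R mid \<alpha>' \<beta>' T)) has_real_derivative D\<rho> T (mid \<alpha> \<beta> T) \<bullet> mid \<alpha>' \<beta>' T) (at 0)"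
      by (rule GDERIV_line) (use psi_rho(2)[OF T] in simp)
    then have 2: "((\<lambda>t. \<rho> T ((\<alpha> T + t * \<alpha>' T) + (\<beta> T + t *\<^sub>R \<beta>' T) \<bullet> barycenter T)) has_real_derivative D\<rho> T (mid \<alpha> \<beta> T) * mid \<alpha>' \<beta>' T) (at 0)"
      by (simp add: inner_simps algebra_simps)
    show "((\<lambda>t. \<mu> T * (\<phi> (\<beta> T + t *\<^sub>R \<beta>' T) + \<rho> T ((\<alpha> T + t * \<alpha>' T) + (\<beta> T + t *\<^sub>R \<beta>' T) \<bullet> barycenter T)))
        has_real_derivative \<mu> T * (gradient \<phi> (\<beta> T) \<bullet> \<beta>' T + D\<rho> T (mid \<alpha> \<beta> T) * mid \<alpha>' \<beta>' T)) (at 0)"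
      by (rule DERIV_cmult[OF DERIV_add[OF 1 2]])
  qed
  then have "?D = 0" by (rule DERIV_local_min[OF _ zero_less_one]) (use min in blast)
  \<comment> \<open>Rewritten so that the slope of the reconstructed field appears, as
    \<open>RT_P1_pairing\<close> requires.\<close>
  moreover have "?D = (\<Sum>T\<in>\<T>. \<mu> T * (gradient \<phi> (\<beta> T) \<bullet> \<beta>' T + real CARD('d) * (D\<rho> T (mid \<alpha> \<beta> T) / real CARD('d)) * mid \<alpha>' \<beta>' T))"
    by simp
  ultimately have "(\<Sum>S'\<in>sides \<T>. (real CARD('d) * l S') * flux_jump (\<lambda>T. gradient \<phi> (\<beta> T)) (\<lambda>T. D\<rho> T (mid \<alpha> \<beta> T) / real CARD('d)) S') = 0"
    using RT_P1_pairing[of \<alpha>' \<beta>' l "\<lambda>T. gradient \<phi> (\<beta> T)" "\<lambda>T. D\<rho> T (mid \<alpha> \<beta> T) / real CARD('d)", OF lv] by linarith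
  moreover have "finite (sides \<T>)" unfolding sides_eq using finite_vfaces by blast
  then have "(\<Sum>S'\<in>sides \<T>. (real CARD('d) * l S') * flux_jump (\<lambda>T. gradient \<phi> (\<beta> T)) (\<lambda>T. D\<rho> T (mid \<alpha> \<beta> T) / real CARD('d)) S')
      = (real CARD('d) * l S) * flux_jump (\<lambda>T. gradient \<phi> (\<beta> T)) (\<lambda>T. D\<rho> T (mid \<alpha> \<beta> T) / real CARD('d)) S"
    using S(1) by (subst sum.remove[of _ S]) (auto simp: l_def intro!: sum.neutral)
  ultimately show ?thesis by (simp add: l_def)
qed

lemma fenchel_equality:
  assumes T: "T \<in> \<T>"
  shows "phi_conj (gradient \<phi> s) = ereal (gradient \<phi> s \<bullet> s - \<phi> s)"
    "convex_conjugate (\<psi> (barycenter T)) (D\<rho> T r) = ereal (D\<rho> T r * r - \<rho> T r)"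
proof -
  show "phi_conj (gradient \<phi> s) = ereal (gradient \<phi> s \<bullet> s - \<phi> s)"
    by (rule conjugate_eqI) (rule convex_above_tangent[OF phi phi_gradient])
  show "convex_conjugate (\<psi> (barycenter T)) (D\<rho> T r) = ereal (D\<rho> T r * r - \<rho> T r)"
    using conjugate_eqI[of "\<rho> T" r "D\<rho> T r"] convex_above_tangent[OF psi_rho(3)[OF T] psi_rho(2)[OF T]]
    by (simp add: psi_rho(1)[OF T])
qed

text \<open>The reconstruction attains the primal value, so every dual maximizer does, and then all
  elementwise Fenchel inequalities are equalities.\<close>

lemma optimal_pair:
  assumes u: "is_arg_min (primal) (\<lambda>v. v \<in> CR0) u" and P: "is_P1 u \<alpha> \<beta>"
    and z: "is_arg_max (dual) (\<lambda>y. y \<in> RT0N) z" and R: "is_RT z a b"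
  shows "primal u = dual z"
    "T \<in> \<T> \<Longrightarrow> phi_conj (a T) = ereal (a T \<bullet> \<beta> T - \<phi> (\<beta> T))"
    "T \<in> \<T> \<Longrightarrow> a T = gradient \<phi> (\<beta> T)"
    "T \<in> \<T> \<Longrightarrow> real CARD('d) * b T = D\<rho> T (mid \<alpha> \<beta> T)"
proof -
  have uC: "u \<in> CR0" using u unfolding is_arg_min_def by blast
  have zR: "z \<in> RT0N" using z unfolding is_arg_max_def by blast
  let ?\<psi> = "\<lambda>T. \<psi> (barycenter T)"
  define a0 where "a0 = (\<lambda>T. gradient \<phi> (\<beta> T))"
  \<comment> \<open>The division by \<open>d\<close> compensates the divergence \<open>d\<close> of
    \<open>x - barycenter T\<close>.\<close>
  define b0 where "b0 = (\<lambda>T. D\<rho> T (mid \<alpha> \<beta> T) / real CARD('d))"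
  define z0 where "z0 x = elementwise_const \<T> (\<lambda>T. a0 T + b0 T *\<^sub>R (x - barycenter T)) x" for x
  have R0: "is_RT z0 a0 b0" unfolding is_RT_def z0_def by (simp add: elementwise_const_eq)
  have z0R: "z0 \<in> RT0N"
    by (rule RT0_N_I[OF R0]) (unfold a0_def b0_def, rule optimality_flux_jump[OF u P])
  have d: "real CARD('d) * b0 T = D\<rho> T (mid \<alpha> \<beta> T)" for T by (simp add: b0_def)
  \<comment> \<open>By discrete integration by parts, the Fenchel lower bounds have the same total
    for every admissible field.\<close>
  have sumJ: "(\<Sum>T\<in>\<T>. \<mu> T * (a' T \<bullet> \<beta> T - \<phi> (\<beta> T))) + (\<Sum>T\<in>\<T>. \<mu> T * (real CARD('d) * b' T * mid \<alpha> \<beta> T - \<rho> T (mid \<alpha> \<beta> T))) = - J \<alpha> \<beta>"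
    if "y \<in> RT0N" "is_RT y a' b'" for y a' b'
  proof -
    have "(\<Sum>T\<in>\<T>. \<mu> T * (a' T \<bullet> \<beta> T - \<phi> (\<beta> T))) + (\<Sum>T\<in>\<T>. \<mu> T * (real CARD('d) * b' T * mid \<alpha> \<beta> T - \<rho> T (mid \<alpha> \<beta> T)))
        = (\<Sum>T\<in>\<T>. \<mu> T * (a' T \<bullet> \<beta> T + real CARD('d) * b' T * mid \<alpha> \<beta> T)) - J \<alpha> \<beta>"
      unfolding J_def sum.distrib[symmetric] sum_subtractf[symmetric]
      by (intro sum.cong refl) (simp add: algebra_simps)
    then show ?thesis using discrete_integration_by_parts[OF uC P that] by simp
  qed
  have "dual z0 = - ereal (\<Sum>T\<in>\<T>. \<mu> T * (a0 T \<bullet> \<beta> T - \<phi> (\<beta> T)))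
      - ereal (\<Sum>T\<in>\<T>. \<mu> T * (real CARD('d) * b0 T * mid \<alpha> \<beta> T - \<rho> T (mid \<alpha> \<beta> T)))"
    unfolding D_h_eq[OF z0R R0] by (simp add: d a0_def fenchel_equality cong: sum.cong)
  also have "\<dots> = ereal (J \<alpha> \<beta>)" using sumJ[OF z0R R0] by simp
  finally have "\<not> dual z < ereal (J \<alpha> \<beta>)" using z z0R unfolding is_arg_max_def by metis
  moreover have "dual z \<le> ereal (J \<alpha> \<beta>)" using weak_duality[OF uC zR] I_h_J[OF P] by simp
  ultimately have Dz: "dual z = ereal (J \<alpha> \<beta>)" by simp
  then show "primal u = dual z" using I_h_J[OF P] by simp
  let ?p = "\<lambda>T. a T \<bullet> \<beta> T - \<phi> (\<beta> T)" and ?q = "\<lambda>T. real CARD('d) * b T * mid \<alpha> \<beta> T - \<rho> T (mid \<alpha> \<beta> T)"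
  let ?X = "\<lambda>T. phi_conj (a T)" and ?Y = "\<lambda>T. convex_conjugate (?\<psi> T) (real CARD('d) * b T)"
  have pX: "ereal (?p T) \<le> ?X T" for T
    using fenchel_young[of "a T" "\<beta> T" "\<lambda>s. ereal (\<phi> s)"] by simp
  have qY: "ereal (?q T) \<le> ?Y T" if "T \<in> \<T>" for T
    using fenchel_young[of "real CARD('d) * b T" "mid \<alpha> \<beta> T" "?\<psi> T"] by (simp add: psi_rho(1)[OF that])
  \<comment> \<open>The lower bounds already add up to the finite total, so neither sum can have
    slack or be infinite.\<close>
  have aux: "X = ereal p \<and> Y = ereal q" if "ereal p \<le> X" "ereal q \<le> Y" "- X - Y = ereal r" "p + q = - r" for X Y p q r
    using that by (cases X; cases Y) auto
  have eqs: "(\<Sum>T\<in>\<T>. ereal (\<mu> T) * ?X T) = ereal (\<Sum>T\<in>\<T>. \<mu> T * ?p T)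
      \<and> (\<Sum>T\<in>\<T>. ereal (\<mu> T) * ?Y T) = ereal (\<Sum>T\<in>\<T>. \<mu> T * ?q T)"
    by (rule aux[OF sum_conjugate_lower[OF pX] sum_conjugate_lower[OF qY] Dz[unfolded D_h_eq[OF zR R]] sumJ[OF zR R]])
  have cancel: "X = ereal p" if "ereal m * X = ereal (m * p)" "0 < m" for X m p
    using that by (cases X) auto
  have mono: "ereal (\<mu> T * p) \<le> ereal (\<mu> T) * X" if "ereal p \<le> X" for T p X
    using ereal_mult_left_mono[OF that, of "ereal (\<mu> T)"] by simp
  show X: "?X T = ereal (?p T)" if T: "T \<in> \<T>" for T
    by (rule cancel[OF ereal_sum_mono_eqD[OF finite_mesh mono[OF pX] conjunct1[OF eqs] T] measure_pos[OF T]])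
  show "a T = gradient \<phi> (\<beta> T)" if T: "T \<in> \<T>" for T
    by (rule conjugate_eq_gradient[OF X[OF T] phi_gradient])
  show "real CARD('d) * b T = D\<rho> T (mid \<alpha> \<beta> T)" if T: "T \<in> \<T>" for T
  proof -
    have "?Y T = ereal (?q T)"
      by (rule cancel[OF ereal_sum_mono_eqD[OF finite_mesh mono[OF qY] conjunct2[OF eqs] T] measure_pos[OF T]])
    then have "convex_conjugate (\<lambda>s. ereal (\<rho> T s)) (real CARD('d) * b T) = ereal ((real CARD('d) * b T) \<bullet> mid \<alpha> \<beta> T - \<rho> T (mid \<alpha> \<beta> T))"
      by (simp add: psi_rho(1)[OF T])
    then show ?thesis by (rule conjugate_eq_gradient[OF _ psi_rho(2)[OF T]])
  qed
qed

lemma optimality_system: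
  assumes u: "is_arg_min (primal) (\<lambda>v. v \<in> CR0) u"
    and z: "is_arg_max (dual) (\<lambda>y. y \<in> RT0N) z"
    and ubar: "ubar = elementwise_const \<T> (\<lambda>T. u (barycenter T))"
  shows "\<forall>T \<in> \<T>. \<forall>x \<in> T. on_element T z x = gradient \<phi> (on_element T (grad_h \<T> u) x)
      + (1 / real CARD('d) * ereal_gradient (\<psi> (barycenter T)) (u (barycenter T))) *\<^sub>R (x - barycenter T)"
      (is ?reconstruction)
    and "ubar \<in> piecewise_polynomials 0 \<T>"
    and "\<exists>q \<in> piecewise_polynomials 0 \<T>.
       (AE x in lebesgue_on \<Omega>.
          q x \<in> generalized_derivative (phi_conj) (L2_proj0 \<T> z x)) \<and>
       (\<forall>y \<in> RT0N. L2_inner \<Omega> q (L2_proj0 \<T> y) + L2_inner \<Omega> ubar (weak_div \<Omega> y) = 0)"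
      (is ?saddle1)
    and "\<forall>v \<in> piecewise_polynomials 0 \<T>.
       L2_inner \<Omega> (weak_div \<Omega> z) v - L2_inner \<Omega> (\<lambda>x. ereal_gradient (\<psi> x) (ubar x)) v = 0"
      (is ?saddle2)
    and "primal u = dual z"
proof -
  have uC: "u \<in> CR0" using u unfolding is_arg_min_def by blast
  have zR: "z \<in> RT0N" using z unfolding is_arg_max_def by blast
  obtain \<alpha> \<beta> where P: "is_P1 u \<alpha> \<beta>" using CR_D_P1[OF uC] by blast
  obtain a b where R: "is_RT z a b" using RT0_is_RT[OF zR] by blast
  note opt = optimal_pair[OF u P z R]
  have um: "u (barycenter T) = mid \<alpha> \<beta> T" if T: "T \<in> \<T>" for T
    using P T bary_barycenter(2)[OF element[OF T]] unfolding is_P1_def by blast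
  have ub: "ubar x = mid \<alpha> \<beta> T" if T: "T \<in> \<T>" "x \<in> interior T" for T x
    unfolding ubar elementwise_const_eq[OF T] by (rule um[OF T(1)])
  show ?reconstruction
  proof (intro ballI)
    fix T x assume T: "T \<in> \<T>" "x \<in> T"
    have "on_element T z x = a T + b T *\<^sub>R (x - barycenter T)"
      by (rule on_element_eq[OF T]) (use R T in \<open>auto simp: is_RT_def intro!: continuous_intros\<close>)
    moreover have "on_element T (grad_h \<T> u) x = \<beta> T"
      by (rule on_element_eq[OF T, where \<Phi>="\<lambda>_. \<beta> T"]) (auto simp: grad_h_P1[OF P T(1)])
    moreover have "b T = 1 / real CARD('d) * D\<rho> T (mid \<alpha> \<beta> T)" unfolding opt(4)[OF T(1), symmetric] by simp
    ultimately show "on_element T z x = gradient \<phi> (on_element T (grad_h \<T> u) x)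
      + (1 / real CARD('d) * ereal_gradient (\<psi> (barycenter T)) (u (barycenter T))) *\<^sub>R (x - barycenter T)"
      using opt(3)[OF T(1)] um[OF T(1)] by (simp add: D\<rho>_def)
  qed
  show "ubar \<in> piecewise_polynomials 0 \<T>"
    unfolding piecewise_polynomials_def polynomial_degree_le_0
  proof (intro CollectI ballI)
    fix T assume "T \<in> \<T>"
    then show "\<exists>p. (\<exists>c. \<forall>x. p x = c) \<and> (\<forall>x\<in>interior T. ubar x = p x)"
      by (intro exI[of _ "\<lambda>_. mid \<alpha> \<beta> T"]) (auto simp: ub)
  qed
  show ?saddle1
  \<comment> \<open>The discrete gradient takes the place of the derivative of the conjugate:
    Fenchel equality puts it into the generalized derivative at the elementwise mean of
    \<open>z\<close>.\<close>
  proof (intro bexI[of _ "grad_h \<T> u"] conjI ballI)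
    show "grad_h \<T> u \<in> piecewise_polynomials 0 \<T>"
      unfolding piecewise_polynomials_def polynomial_degree_le_0
    proof (intro CollectI ballI)
      fix T assume "T \<in> \<T>"
      then show "\<exists>p. (\<exists>c. \<forall>x. p x = c) \<and> (\<forall>x\<in>interior T. grad_h \<T> u x = p x)"
        by (intro exI[of _ "\<lambda>_. \<beta> T"]) (auto simp: grad_h_P1[OF P])
    qed
    show "AE x in lebesgue_on \<Omega>.
        grad_h \<T> u x \<in> generalized_derivative (phi_conj) (L2_proj0 \<T> z x)"
      using AE_mesh
    proof eventually_elim
      case (elim x)
      then obtain T where T: "T \<in> \<T>" "x \<in> interior T" by blast
      show ?case
        unfolding grad_h_P1[OF P T] L2_proj0_RT[OF R T]
        by (rule conjugate_generalized_derivative[OF opt(2)[OF T(1)]])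
    qed
    fix y assume y: "y \<in> RT0N"
    obtain a' b' where R': "is_RT y a' b'" using RT0_is_RT[OF y] by blast
    have "L2_inner \<Omega> (grad_h \<T> u) (L2_proj0 \<T> y) = (\<Sum>T\<in>\<T>. \<mu> T * (\<beta> T \<bullet> a' T))"
      unfolding L2_inner_def
      by (rule integral_mesh_const) (auto simp: grad_h_P1[OF P] L2_proj0_RT[OF R'])
    moreover have "L2_inner \<Omega> ubar (weak_div \<Omega> y) = (\<Sum>T\<in>\<T>. \<mu> T * (mid \<alpha> \<beta> T * (real CARD('d) * b' T)))"
      unfolding L2_inner_def
    proof (rule integral_mesh_const)
      show "AE x in lebesgue_on \<Omega>. \<forall>T\<in>\<T>. x \<in> interior T \<longrightarrow> ubar x \<bullet> weak_div \<Omega> y x = mid \<alpha> \<beta> T * (real CARD('d) * b' T)"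
        using weak_div_eq[OF y R'] by eventually_elim (auto simp: ub)
    qed
    ultimately have "L2_inner \<Omega> (grad_h \<T> u) (L2_proj0 \<T> y) + L2_inner \<Omega> ubar (weak_div \<Omega> y)
        = (\<Sum>T\<in>\<T>. \<mu> T * (a' T \<bullet> \<beta> T + real CARD('d) * b' T * mid \<alpha> \<beta> T))"
      by (simp add: sum.distrib[symmetric] inner_commute algebra_simps)
    then show "L2_inner \<Omega> (grad_h \<T> u) (L2_proj0 \<T> y) + L2_inner \<Omega> ubar (weak_div \<Omega> y) = 0"
      using discrete_integration_by_parts[OF uC P y R'] by simp
  qed
  show ?saddle2
  proof
    fix v :: "real ^ 'd \<Rightarrow> real" assume "v \<in> piecewise_polynomials 0 \<T>"
    then have "\<forall>T\<in>\<T>. \<exists>c. \<forall>x\<in>interior T. v x = c"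
      unfolding piecewise_polynomials_def polynomial_degree_le_0 by force
    then obtain c where c: "\<And>T x. T \<in> \<T> \<Longrightarrow> x \<in> interior T \<Longrightarrow> v x = c T" by metis
    have "L2_inner \<Omega> (weak_div \<Omega> z) v = (\<Sum>T\<in>\<T>. \<mu> T * (D\<rho> T (mid \<alpha> \<beta> T) * c T))"
      unfolding L2_inner_def
    proof (rule integral_mesh_const)
      show "AE x in lebesgue_on \<Omega>. \<forall>T\<in>\<T>. x \<in> interior T \<longrightarrow> weak_div \<Omega> z x \<bullet> v x = D\<rho> T (mid \<alpha> \<beta> T) * c T"
        using weak_div_eq[OF zR R] by eventually_elim (auto simp: c opt(4))
    qed
    moreover have "L2_inner \<Omega> (\<lambda>x. ereal_gradient (\<psi> x) (ubar x)) v = (\<Sum>T\<in>\<T>. \<mu> T * (D\<rho> T (mid \<alpha> \<beta> T) * c T))"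
      unfolding L2_inner_def by (rule integral_mesh_const) (auto simp: c ub psi_eq D\<rho>_def)
    ultimately show "L2_inner \<Omega> (weak_div \<Omega> z) v - L2_inner \<Omega> (\<lambda>x. ereal_gradient (\<psi> x) (ubar x)) v = 0" by simp
  qed
  show "primal u = dual z" by (rule opt(1))
qed

end

theorem proposition3p1:
  fixes \<Omega> \<Gamma>D \<Gamma>N :: "(real ^ 'd) set"
    and \<T> :: "(real ^ 'd) set set"
    and \<phi> :: "real ^ 'd \<Rightarrow> real"
    and \<psi> :: "real ^ 'd \<Rightarrow> real \<Rightarrow> ereal"
  assumes dim: "CARD('d) = 2 \<or> CARD('d) = 3"
    and domain: "bounded \<Omega>" "polyhedral_domain \<Omega>" "lipschitz_domain \<Omega>"
    and Gamma: "\<Gamma>D \<subseteq> frontier \<Omega>" "\<Gamma>N = frontier \<Omega> - \<Gamma>D"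
    and triang: "regular_triangulation \<Omega> \<T>"
    and bdry: "\<forall>S \<in> boundary_sides \<Omega> \<T>. side_within S \<Gamma>D \<or> side_within S \<Gamma>N"
    and phi: "convex_on UNIV \<phi>"
    and psi: "\<forall>x \<in> \<Omega>. ereal_proper (\<psi> x) \<and> ereal_convex (\<psi> x)"
    and psi_const: "\<forall>T \<in> \<T>. \<forall>x \<in> interior T. \<forall>y \<in> interior T. \<psi> x = \<psi> y"
  shows
    "(INF u \<in> CR_D \<Omega> \<Gamma>D \<T>. I_h \<Omega> \<T> \<phi> \<psi> u) \<ge> (SUP z \<in> RT0_N \<Omega> \<Gamma>N \<T>. D_h \<Omega> \<T> \<phi> \<psi> z)
     \<and>
     ((\<forall>t. \<phi> differentiable (at t)) \<and> (\<forall>x \<in> \<Omega>. \<forall>s. ereal_differentiable_at (\<psi> x) s) \<longrightarrow>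
      (\<forall>u z ubar.
         is_arg_min (I_h \<Omega> \<T> \<phi> \<psi>) (\<lambda>v. v \<in> CR_D \<Omega> \<Gamma>D \<T>) u \<and>
         is_arg_max (D_h \<Omega> \<T> \<phi> \<psi>) (\<lambda>y. y \<in> RT0_N \<Omega> \<Gamma>N \<T>) z \<and>
         ubar = elementwise_const \<T> (\<lambda>T. u (barycenter T)) \<longrightarrow>
         (\<forall>T \<in> \<T>. \<forall>x \<in> T.
            on_element T z x =
              gradient \<phi> (on_element T (grad_h \<T> u) x)
              + (1 / real CARD('d) * ereal_gradient (\<psi> (barycenter T)) (u (barycenter T)))
                  *\<^sub>R (x - barycenter T)) \<and>
         (z \<in> RT0_N \<Omega> \<Gamma>N \<T> \<and> ubar \<in> piecewise_polynomials 0 \<T> \<and>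
          (\<exists>q \<in> piecewise_polynomials 0 \<T>.
             (AE x in lebesgue_on \<Omega>.
                q x \<in> generalized_derivative (convex_conjugate (\<lambda>s. ereal (\<phi> s))) (L2_proj0 \<T> z x)) \<and>
             (\<forall>y \<in> RT0_N \<Omega> \<Gamma>N \<T>.
                L2_inner \<Omega> q (L2_proj0 \<T> y) + L2_inner \<Omega> ubar (weak_div \<Omega> y) = 0)) \<and>
          (\<forall>v \<in> piecewise_polynomials 0 \<T>.
             L2_inner \<Omega> (weak_div \<Omega> z) v
             - L2_inner \<Omega> (\<lambda>x. ereal_gradient (\<psi> x) (ubar x)) v = 0)) \<and>
         I_h \<Omega> \<T> \<phi> \<psi> u = D_h \<Omega> \<T> \<phi> \<psi> z))"
proof -
  interpret cr_rt_duality \<Omega> \<T> \<Gamma>D \<Gamma>N \<phi> \<psi>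
    by unfold_locales (fact domain(3) triang Gamma(2) bdry phi psi psi_const)+
  show ?thesis
  proof (intro conjI impI allI)
    show "(INF u \<in> CR_D \<Omega> \<Gamma>D \<T>. I_h \<Omega> \<T> \<phi> \<psi> u) \<ge> (SUP z \<in> RT0_N \<Omega> \<Gamma>N \<T>. D_h \<Omega> \<T> \<phi> \<psi> z)"
      by (intro SUP_least INF_greatest weak_duality)
  next
    fix u z ubar
    assume diff: "(\<forall>t. \<phi> differentiable (at t)) \<and> (\<forall>x \<in> \<Omega>. \<forall>s. ereal_differentiable_at (\<psi> x) s)"
      and uz: "is_arg_min (I_h \<Omega> \<T> \<phi> \<psi>) (\<lambda>v. v \<in> CR_D \<Omega> \<Gamma>D \<T>) u \<and>
         is_arg_max (D_h \<Omega> \<T> \<phi> \<psi>) (\<lambda>y. y \<in> RT0_N \<Omega> \<Gamma>N \<T>) z \<and>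
         ubar = elementwise_const \<T> (\<lambda>T. u (barycenter T))"
    interpret cr_rt_duality_differentiable \<Omega> \<T> \<Gamma>D \<Gamma>N \<phi> \<psi>
      by unfold_locales (fact diff[THEN conjunct1] diff[THEN conjunct2])+
    note os = optimality_system[OF uz[THEN conjunct1] uz[THEN conjunct2, THEN conjunct1] uz[THEN conjunct2, THEN conjunct2]]
    show "z \<in> RT0_N \<Omega> \<Gamma>N \<T>" using uz unfolding is_arg_max_def by blast
    show "\<forall>T \<in> \<T>. \<forall>x \<in> T.
            on_element T z x =
              gradient \<phi> (on_element T (grad_h \<T> u) x)
              + (1 / real CARD('d) * ereal_gradient (\<psi> (barycenter T)) (u (barycenter T)))
                  *\<^sub>R (x - barycenter T)" by (rule os(1))
    show "ubar \<in> piecewise_polynomials 0 \<T>" by (rule os(2))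
    show "\<exists>q \<in> piecewise_polynomials 0 \<T>.
             (AE x in lebesgue_on \<Omega>.
                q x \<in> generalized_derivative (convex_conjugate (\<lambda>s. ereal (\<phi> s))) (L2_proj0 \<T> z x)) \<and>
             (\<forall>y \<in> RT0_N \<Omega> \<Gamma>N \<T>.
                L2_inner \<Omega> q (L2_proj0 \<T> y) + L2_inner \<Omega> ubar (weak_div \<Omega> y) = 0)" by (rule os(3))
    show "\<forall>v \<in> piecewise_polynomials 0 \<T>.
             L2_inner \<Omega> (weak_div \<Omega> z) v
             - L2_inner \<Omega> (\<lambda>x. ereal_gradient (\<psi> x) (ubar x)) v = 0" by (rule os(4))
    show "I_h \<Omega> \<T> \<phi> \<psi> u = D_h \<Omega> \<T> \<phi> \<psi> z" by (rule os(5))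
  qed
qed

end
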